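(* Let $X$ be a Frobenius algebra in a semisimple tensor category over $\mathbb{C}$. Then for every basis $\mathcal{B}$ of $X$, the Frobenius $\mathcal{B}$-subalgebra poset of $X$ is a lattice with $[A]\wedge[B]=[A\cap B]$.
   Context: Tensor categories are in the sense of Etingof–Gelaki–Nikshych–Ostrik (locally finite linear abelian rigid monoidal, bilinear tensor product, $\mathrm{End}(\mathbf 1)=\mathbb{C}$), taken strict. A left dual of $X$ is a triple $(X^*,\mathrm{ev}_X:X^*\otimes X\to\mathbf 1,\mathrm{coev}_X:\mathbf 1\to X\otimes X^* )$ satisfying the zigzag identities; $f^*:Y^*\to X^*$ denotes the dual of $f:X\to Y$. A Frobenius algebra is $(X,m,\delta,e,\epsilon)$ with $(X,m,e)$ a unital algebra, $(X,\delta,\epsilon)$ a counital coalgebra and $(\mathrm{id}_X\otimes m)\circ(\delta\otimes \mathrm{id}_X)=\delta\circ m=(m\otimes \mathrm{id}_X)\circ(\mathrm{id}_X\otimes\delta)$. It is always regarded as selfdual, $X^*=X$, with $\mathrm{ev}_X=\epsilon\circ m$, $\mathrm{coev}_X=\delta\circ e$. A Frobenius algebra $X'$ is a Frobenius subalgebra of $X$ if there is a unital algebra monomorphism $i:X'\to X$ with $i^{**}=i$ and $i^*\circ i=\mathrm{id}_{X'}$; put $b_{X'}:=i\circ i^*$, an idempotent. Two Frobenius subalgebras $X_1,X_2$ are equivalent iff $b_{X_1}=b_{X_2}$; the class of $X_1$ is $[X_1]$. The Frobenius subalgebra poset of $X$ is the set of classes with $[X_1]\le[X_2]$ iff $b_{X_1}\circ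 b_{X_2}=b_{X_1}=b_{X_2}\circ b_{X_1}$. $A\cap B$ is the intersection (pullback) of subobjects of $X$. Rigidity invariance. Let $C$ be a semisimple object of finite length. A basis $\mathcal{B}$ of $C$ is a family $(\mathcal{B}_S)_S$, $S$ running over representatives of isomorphism classes of simple objects, with $\mathcal{B}_S$ a basis of $\mathrm{Hom}(C,S)$. For each simple $S$, a bilinear form $\kappa'_{C,S}:\mathrm{Hom}(C,S)\times\mathrm{Hom}(C^*,S^* )\to\mathbb{C}$ is defined by $(f\otimes g)\circ\mathrm{coev}_C=\kappa'_{C,S}(f,g)\,\mathrm{coev}_S$. Let $\langle\cdot,\cdot\rangle$ be the Hermitian form on $\mathrm{Hom}(C,S)$, conjugate-linear in the second argument, for which $\mathcal{B}_S$ is orthonormal, and let $M'_{C,S}:\mathrm{Hom}(C^*,S^* )\to\mathrm{Hom}(C,S)$ be the conjugate-linear map with $\langle f,M'_{C,S}g\rangle=\kappa'_{C,S}(f,g)$. A split subobject $(A,i,p)$ of $C$ ($p\circ i=\mathrm{id}_A$) is $\mathcal{B}$-rigid invariant if $M'_{C,S}(\mathrm{Hom}(A^*,S^* )\circ i^* )=\mathrm{Hom}(A,S)\circ p$ for all simple $S$. A Frobenius $\mathcal{B}$-subalgebra of $X$ is a Frobenius subalgebra $A$ such that $(A,i,i^* )$ is $\mathcal{B}$-rigid invariant; the Frobenius $\mathcal{B}$-subalgebra poset is the subposet of the Frobenius subalgebra poset consisting of their classes. *)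

theory Defs
  imports Complex_Main "HOL-Algebra.Lattice"
begin

section \<open>Linear categories with a strict tensor product\<close>

text \<open>
  All Hom-spaces are subspaces of one ambient complex vector space on the type \<open>'m\<close>; for an
  arbitrary small linear category take the direct sum of its Hom-spaces. Composition and tensor
  product are only constrained on the Hom-spaces. Distinct Hom-spaces may overlap (at least in
  \<open>0\<close>), so source and target of a morphism are always given separately.
\<close>

record ('o, 'm) tcat =
  Obj :: "'o set"
  Hom :: "'o \<Rightarrow> 'o \<Rightarrow> 'm set"
  ide :: "'o \<Rightarrow> 'm"
  cmp :: "'m \<Rightarrow> 'm \<Rightarrow> 'm"  (infixr "\<cdot>\<index>" 70)
  scl :: "complex \<Rightarrow> 'm \<Rightarrow> 'm"
  tob :: "'o \<Rightarrow> 'o \<Rightarrow> 'o"  (infixr "\<boxtimes>\<index>" 75)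
  tar :: "'m \<Rightarrow> 'm \<Rightarrow> 'm"  (infixr "\<otimes>\<index>" 75)
  one :: "'o"  ("\<one>\<index>")

locale linear_category = vector_space "scl C"
  for C :: "('o, 'm::ab_group_add) tcat" (structure) +
  assumes Hom_subspace: "\<lbrakk>X \<in> Obj C; Y \<in> Obj C\<rbrakk> \<Longrightarrow> subspace (Hom C X Y)"
    and ide_in_Hom: "X \<in> Obj C \<Longrightarrow> ide C X \<in> Hom C X X"
    and cmp_in_Hom:
      "\<lbrakk>X \<in> Obj C; Y \<in> Obj C; Z \<in> Obj C; f \<in> Hom C X Y; g \<in> Hom C Y Z\<rbrakk> \<Longrightarrow> g \<cdot> f \<in> Hom C X Z"
    and cmp_assoc:
      "\<lbrakk>W \<in> Obj C; X \<in> Obj C; Y \<in> Obj C; Z \<in> Obj C;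
        f \<in> Hom C W X; g \<in> Hom C X Y; h \<in> Hom C Y Z\<rbrakk> \<Longrightarrow> (h \<cdot> g) \<cdot> f = h \<cdot> (g \<cdot> f)"
    and cmp_ide: "\<lbrakk>X \<in> Obj C; Y \<in> Obj C; f \<in> Hom C X Y\<rbrakk> \<Longrightarrow> f \<cdot> ide C X = f"
    and ide_cmp: "\<lbrakk>X \<in> Obj C; Y \<in> Obj C; f \<in> Hom C X Y\<rbrakk> \<Longrightarrow> ide C Y \<cdot> f = f"
    and cmp_add_right:
      "\<lbrakk>X \<in> Obj C; Y \<in> Obj C; Z \<in> Obj C; f \<in> Hom C X Y; f' \<in> Hom C X Y; g \<in> Hom C Y Z\<rbrakk>
        \<Longrightarrow> g \<cdot> (f + f') = g \<cdot> f + g \<cdot> f'"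
    and cmp_add_left:
      "\<lbrakk>X \<in> Obj C; Y \<in> Obj C; Z \<in> Obj C; f \<in> Hom C X Y; g \<in> Hom C Y Z; g' \<in> Hom C Y Z\<rbrakk>
        \<Longrightarrow> (g + g') \<cdot> f = g \<cdot> f + g' \<cdot> f"
    and cmp_scl_right:
      "\<lbrakk>X \<in> Obj C; Y \<in> Obj C; Z \<in> Obj C; f \<in> Hom C X Y; g \<in> Hom C Y Z\<rbrakk>
        \<Longrightarrow> g \<cdot> scl C c f = scl C c (g \<cdot> f)"
    and cmp_scl_left:
      "\<lbrakk>X \<in> Obj C; Y \<in> Obj C; Z \<in> Obj C; f \<in> Hom C X Y; g \<in> Hom C Y Z\<rbrakk>
        \<Longrightarrow> scl C c g \<cdot> f = scl C c (g \<cdot> f)"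

section \<open>Abelian and semisimple categories\<close>

definition zero_object :: "('o, 'm::ab_group_add) tcat \<Rightarrow> 'o \<Rightarrow> bool" where
  "zero_object C Z \<longleftrightarrow> Z \<in> Obj C \<and> Hom C Z Z = {0}"

definition monic :: "('o, 'm::ab_group_add) tcat \<Rightarrow> 'o \<Rightarrow> 'o \<Rightarrow> 'm \<Rightarrow> bool" where
  "monic C X Y f \<longleftrightarrow> f \<in> Hom C X Y \<and>
     (\<forall>W\<in>Obj C. \<forall>g\<in>Hom C W X. \<forall>h\<in>Hom C W X. f \<cdot>\<^bsub>C\<^esub> g = f \<cdot>\<^bsub>C\<^esub> h \<longrightarrow> g = h)"

definition iso_arrow :: "('o, 'm::ab_group_add) tcat \<Rightarrow> 'o \<Rightarrow> 'o \<Rightarrow> 'm \<Rightarrow> bool" where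
  "iso_arrow C X Y f \<longleftrightarrow> f \<in> Hom C X Y \<and>
     (\<exists>g\<in>Hom C Y X. g \<cdot>\<^bsub>C\<^esub> f = ide C X \<and> f \<cdot>\<^bsub>C\<^esub> g = ide C Y)"

definition isomorphic :: "('o, 'm::ab_group_add) tcat \<Rightarrow> 'o \<Rightarrow> 'o \<Rightarrow> bool" where
  "isomorphic C X Y \<longleftrightarrow> (\<exists>f. iso_arrow C X Y f)"

definition is_kernel :: "('o, 'm::ab_group_add) tcat \<Rightarrow> 'o \<Rightarrow> 'o \<Rightarrow> 'm \<Rightarrow> 'o \<Rightarrow> 'm \<Rightarrow> bool" where
  "is_kernel C X Y f K k \<longleftrightarrow> K \<in> Obj C \<and> k \<in> Hom C K X \<and> f \<cdot>\<^bsub>C\<^esub> k = 0 \<and>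
     (\<forall>W\<in>Obj C. \<forall>h\<in>Hom C W X. f \<cdot>\<^bsub>C\<^esub> h = 0 \<longrightarrow> (\<exists>!l. l \<in> Hom C W K \<and> k \<cdot>\<^bsub>C\<^esub> l = h))"

definition is_cokernel :: "('o, 'm::ab_group_add) tcat \<Rightarrow> 'o \<Rightarrow> 'o \<Rightarrow> 'm \<Rightarrow> 'o \<Rightarrow> 'm \<Rightarrow> bool" where
  "is_cokernel C X Y f Q q \<longleftrightarrow> Q \<in> Obj C \<and> q \<in> Hom C Y Q \<and> q \<cdot>\<^bsub>C\<^esub> f = 0 \<and>
     (\<forall>W\<in>Obj C. \<forall>h\<in>Hom C Y W. h \<cdot>\<^bsub>C\<^esub> f = 0 \<longrightarrow> (\<exists>!l. l \<in> Hom C Q W \<and> l \<cdot>\<^bsub>C\<^esub> q = h))"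

definition simple_object :: "('o, 'm::ab_group_add) tcat \<Rightarrow> 'o \<Rightarrow> bool" where
  "simple_object C S \<longleftrightarrow> S \<in> Obj C \<and> \<not> zero_object C S \<and>
     (\<forall>Y\<in>Obj C. \<forall>i. monic C Y S i \<longrightarrow> zero_object C Y \<or> iso_arrow C Y S i)"

text \<open>Existence of a finite filtration with simple subquotients.\<close>

inductive finite_length :: "('o, 'm::ab_group_add) tcat \<Rightarrow> 'o \<Rightarrow> bool" for C where
  "zero_object C Z \<Longrightarrow> finite_length C Z"
| "\<lbrakk>finite_length C Y; X \<in> Obj C; monic C Y X i; is_cokernel C Y X i S q; simple_object C S\<rbrakk>
    \<Longrightarrow> finite_length C X"

definition semisimple_object :: "('o, 'm::ab_group_add) tcat \<Rightarrow> 'o \<Rightarrow> bool" where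
  "semisimple_object C X \<longleftrightarrow> X \<in> Obj C \<and>
     (\<exists>(n::nat) S i p. (\<forall>k<n. simple_object C (S k) \<and> i k \<in> Hom C (S k) X \<and> p k \<in> Hom C X (S k)) \<and>
        (\<forall>k<n. \<forall>l<n. p k \<cdot>\<^bsub>C\<^esub> i l = (if k = l then ide C (S k) else 0)) \<and>
        (\<Sum>k<n. i k \<cdot>\<^bsub>C\<^esub> p k) = ide C X)"

locale abelian_linear_category = linear_category +
  assumes ex_zero_object: "\<exists>Z. zero_object C Z"
    and ex_direct_sum: "\<lbrakk>X \<in> Obj C; Y \<in> Obj C\<rbrakk> \<Longrightarrow>
      \<exists>Z\<in>Obj C. \<exists>i\<in>Hom C X Z. \<exists>j\<in>Hom C Y Z. \<exists>p\<in>Hom C Z X. \<exists>q\<in>Hom C Z Y.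
        p \<cdot> i = ide C X \<and> q \<cdot> j = ide C Y \<and> i \<cdot> p + j \<cdot> q = ide C Z"
    and ex_canonical_decomposition: "\<lbrakk>X \<in> Obj C; Y \<in> Obj C; f \<in> Hom C X Y\<rbrakk> \<Longrightarrow>
      \<exists>K k I i j Q q. i \<in> Hom C X I \<and> j \<in> Hom C I Y \<and> j \<cdot> i = f \<and>
        is_kernel C X Y f K k \<and> is_cokernel C X Y f Q q \<and>
        is_cokernel C K X k I i \<and> is_kernel C Y Q q I j"

section \<open>Duals and tensor categories\<close>

type_synonym ('o, 'm) dual_data = "'o \<times> 'm \<times> 'm"

text \<open>The triple is \<open>(X\<^sup>*, ev\<^sub>X, coev\<^sub>X)\<close>.\<close>

fun left_dual :: "('o, 'm::ab_group_add) tcat \<Rightarrow> 'o \<Rightarrow> ('o, 'm) dual_data \<Rightarrow> bool" where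
  "left_dual C X (X', ev, coev) \<longleftrightarrow> X' \<in> Obj C \<and>
     ev \<in> Hom C (X' \<boxtimes>\<^bsub>C\<^esub> X) \<one>\<^bsub>C\<^esub> \<and> coev \<in> Hom C \<one>\<^bsub>C\<^esub> (X \<boxtimes>\<^bsub>C\<^esub> X') \<and>
     (ide C X \<otimes>\<^bsub>C\<^esub> ev) \<cdot>\<^bsub>C\<^esub> (coev \<otimes>\<^bsub>C\<^esub> ide C X) = ide C X \<and>
     (ev \<otimes>\<^bsub>C\<^esub> ide C X') \<cdot>\<^bsub>C\<^esub> (ide C X' \<otimes>\<^bsub>C\<^esub> coev) = ide C X'"

locale semisimple_tensor_category = abelian_linear_category +
  assumes Hom_finite_dim:
      "\<lbrakk>X \<in> Obj C; Y \<in> Obj C\<rbrakk> \<Longrightarrow> \<exists>B. finite B \<and> span B = Hom C X Y"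
    and all_finite_length: "X \<in> Obj C \<Longrightarrow> finite_length C X"
    and all_semisimple: "X \<in> Obj C \<Longrightarrow> semisimple_object C X"
    and one_Obj: "\<one> \<in> Obj C"
    and tob_Obj: "\<lbrakk>X \<in> Obj C; Y \<in> Obj C\<rbrakk> \<Longrightarrow> X \<boxtimes> Y \<in> Obj C"
    and tob_assoc:
      "\<lbrakk>X \<in> Obj C; Y \<in> Obj C; Z \<in> Obj C\<rbrakk> \<Longrightarrow> (X \<boxtimes> Y) \<boxtimes> Z = X \<boxtimes> (Y \<boxtimes> Z)"
    and one_tob: "X \<in> Obj C \<Longrightarrow> \<one> \<boxtimes> X = X"
    and tob_one: "X \<in> Obj C \<Longrightarrow> X \<boxtimes> \<one> = X"
    and tar_in_Hom:
      "\<lbrakk>X \<in> Obj C; X' \<in> Obj C; Y \<in> Obj C; Y' \<in> Obj C; f \<in> Hom C X X'; g \<in> Hom C Y Y'\<rbrakk>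
        \<Longrightarrow> f \<otimes> g \<in> Hom C (X \<boxtimes> Y) (X' \<boxtimes> Y')"
    and tar_ide: "\<lbrakk>X \<in> Obj C; Y \<in> Obj C\<rbrakk> \<Longrightarrow> ide C X \<otimes> ide C Y = ide C (X \<boxtimes> Y)"
    and interchange:
      "\<lbrakk>X \<in> Obj C; X' \<in> Obj C; X'' \<in> Obj C; Y \<in> Obj C; Y' \<in> Obj C; Y'' \<in> Obj C;
        f \<in> Hom C X X'; f' \<in> Hom C X' X''; g \<in> Hom C Y Y'; g' \<in> Hom C Y' Y''\<rbrakk>
        \<Longrightarrow> (f' \<cdot> f) \<otimes> (g' \<cdot> g) = (f' \<otimes> g') \<cdot> (f \<otimes> g)"
    and tar_assoc:
      "\<lbrakk>X \<in> Obj C; X' \<in> Obj C; Y \<in> Obj C; Y' \<in> Obj C; Z \<in> Obj C; Z' \<in> Obj C;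
        f \<in> Hom C X X'; g \<in> Hom C Y Y'; h \<in> Hom C Z Z'\<rbrakk> \<Longrightarrow> (f \<otimes> g) \<otimes> h = f \<otimes> (g \<otimes> h)"
    and one_tar: "\<lbrakk>X \<in> Obj C; Y \<in> Obj C; f \<in> Hom C X Y\<rbrakk> \<Longrightarrow> ide C \<one> \<otimes> f = f"
    and tar_one: "\<lbrakk>X \<in> Obj C; Y \<in> Obj C; f \<in> Hom C X Y\<rbrakk> \<Longrightarrow> f \<otimes> ide C \<one> = f"
    and tar_add_left:
      "\<lbrakk>X \<in> Obj C; X' \<in> Obj C; Y \<in> Obj C; Y' \<in> Obj C;
        f \<in> Hom C X X'; f' \<in> Hom C X X'; g \<in> Hom C Y Y'\<rbrakk> \<Longrightarrow> (f + f') \<otimes> g = f \<otimes> g + f' \<otimes> g"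
    and tar_add_right:
      "\<lbrakk>X \<in> Obj C; X' \<in> Obj C; Y \<in> Obj C; Y' \<in> Obj C;
        f \<in> Hom C X X'; g \<in> Hom C Y Y'; g' \<in> Hom C Y Y'\<rbrakk> \<Longrightarrow> f \<otimes> (g + g') = f \<otimes> g + f \<otimes> g'"
    and tar_scl_left:
      "\<lbrakk>X \<in> Obj C; X' \<in> Obj C; Y \<in> Obj C; Y' \<in> Obj C; f \<in> Hom C X X'; g \<in> Hom C Y Y'\<rbrakk>
        \<Longrightarrow> scl C c f \<otimes> g = scl C c (f \<otimes> g)"
    and tar_scl_right:
      "\<lbrakk>X \<in> Obj C; X' \<in> Obj C; Y \<in> Obj C; Y' \<in> Obj C; f \<in> Hom C X X'; g \<in> Hom C Y Y'\<rbrakk>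
        \<Longrightarrow> f \<otimes> scl C c g = scl C c (f \<otimes> g)"
    and End_one: "Hom C \<one> \<one> = range (\<lambda>c. scl C c (ide C \<one>))" "ide C \<one> \<noteq> 0"
    and ex_left_dual: "X \<in> Obj C \<Longrightarrow> \<exists>D. left_dual C X D"
    and ex_right_dual: "X \<in> Obj C \<Longrightarrow> \<exists>Y\<in>Obj C. \<exists>ev coev. left_dual C Y (X, ev, coev)"

text \<open>The dual \<open>f\<^sup>* : Y\<^sup>* \<rightarrow> X\<^sup>*\<close> of \<open>f : X \<rightarrow> Y\<close> with respect to chosen left duals of \<open>X\<close> and \<open>Y\<close>.\<close>

fun dual_arrow ::
  "('o, 'm::ab_group_add) tcat \<Rightarrow> ('o, 'm) dual_data \<Rightarrow> ('o, 'm) dual_data \<Rightarrow> 'm \<Rightarrow> 'm" where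
  "dual_arrow C (X', evX, coevX) (Y', evY, coevY) f =
     (evY \<otimes>\<^bsub>C\<^esub> ide C X') \<cdot>\<^bsub>C\<^esub> (ide C Y' \<otimes>\<^bsub>C\<^esub> f \<otimes>\<^bsub>C\<^esub> ide C X') \<cdot>\<^bsub>C\<^esub> (ide C Y' \<otimes>\<^bsub>C\<^esub> coevX)"

section \<open>Frobenius algebras and Frobenius subalgebras\<close>

record ('o, 'm) frob =
  ob :: 'o
  mult :: 'm
  comult :: 'm
  unt :: 'm
  counit :: 'm

definition algebra :: "('o, 'm::ab_group_add) tcat \<Rightarrow> 'o \<Rightarrow> 'm \<Rightarrow> 'm \<Rightarrow> bool" where
  "algebra C X m e \<longleftrightarrow> X \<in> Obj C \<and> m \<in> Hom C (X \<boxtimes>\<^bsub>C\<^esub> X) X \<and> e \<in> Hom C \<one>\<^bsub>C\<^esub> X \<and>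
     m \<cdot>\<^bsub>C\<^esub> (m \<otimes>\<^bsub>C\<^esub> ide C X) = m \<cdot>\<^bsub>C\<^esub> (ide C X \<otimes>\<^bsub>C\<^esub> m) \<and>
     m \<cdot>\<^bsub>C\<^esub> (e \<otimes>\<^bsub>C\<^esub> ide C X) = ide C X \<and> m \<cdot>\<^bsub>C\<^esub> (ide C X \<otimes>\<^bsub>C\<^esub> e) = ide C X"

definition coalgebra :: "('o, 'm::ab_group_add) tcat \<Rightarrow> 'o \<Rightarrow> 'm \<Rightarrow> 'm \<Rightarrow> bool" where
  "coalgebra C X d e \<longleftrightarrow> X \<in> Obj C \<and> d \<in> Hom C X (X \<boxtimes>\<^bsub>C\<^esub> X) \<and> e \<in> Hom C X \<one>\<^bsub>C\<^esub> \<and>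
     (d \<otimes>\<^bsub>C\<^esub> ide C X) \<cdot>\<^bsub>C\<^esub> d = (ide C X \<otimes>\<^bsub>C\<^esub> d) \<cdot>\<^bsub>C\<^esub> d \<and>
     (e \<otimes>\<^bsub>C\<^esub> ide C X) \<cdot>\<^bsub>C\<^esub> d = ide C X \<and> (ide C X \<otimes>\<^bsub>C\<^esub> e) \<cdot>\<^bsub>C\<^esub> d = ide C X"

definition frobenius_algebra :: "('o, 'm::ab_group_add) tcat \<Rightarrow> ('o, 'm) frob \<Rightarrow> bool" where
  "frobenius_algebra C X \<longleftrightarrow>
     algebra C (ob X) (mult X) (unt X) \<and> coalgebra C (ob X) (comult X) (counit X) \<and>
     (ide C (ob X) \<otimes>\<^bsub>C\<^esub> mult X) \<cdot>\<^bsub>C\<^esub> (comult X \<otimes>\<^bsub>C\<^esub> ide C (ob X)) = comult X \<cdot>\<^bsub>C\<^esub> mult X \<and>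
     comult X \<cdot>\<^bsub>C\<^esub> mult X = (mult X \<otimes>\<^bsub>C\<^esub> ide C (ob X)) \<cdot>\<^bsub>C\<^esub> (ide C (ob X) \<otimes>\<^bsub>C\<^esub> comult X)"

text \<open>A Frobenius algebra is always regarded as its own left dual.\<close>

definition frob_dual :: "('o, 'm::ab_group_add) tcat \<Rightarrow> ('o, 'm) frob \<Rightarrow> ('o, 'm) dual_data" where
  "frob_dual C X = (ob X, counit X \<cdot>\<^bsub>C\<^esub> mult X, comult X \<cdot>\<^bsub>C\<^esub> unt X)"

definition adj :: "('o, 'm::ab_group_add) tcat \<Rightarrow> ('o, 'm) frob \<Rightarrow> ('o, 'm) frob \<Rightarrow> 'm \<Rightarrow> 'm" where
  "adj C A X f = dual_arrow C (frob_dual C A) (frob_dual C X) f"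

definition algebra_mono ::
  "('o, 'm::ab_group_add) tcat \<Rightarrow> ('o, 'm) frob \<Rightarrow> ('o, 'm) frob \<Rightarrow> 'm \<Rightarrow> bool" where
  "algebra_mono C A X i \<longleftrightarrow> monic C (ob A) (ob X) i \<and>
     i \<cdot>\<^bsub>C\<^esub> mult A = mult X \<cdot>\<^bsub>C\<^esub> (i \<otimes>\<^bsub>C\<^esub> i) \<and> i \<cdot>\<^bsub>C\<^esub> unt A = unt X"

text \<open>A Frobenius subalgebra is a pair \<open>(A, i)\<close>, the embedding \<open>i\<close> being part of the data.\<close>

fun frobenius_subalgebra ::
  "('o, 'm::ab_group_add) tcat \<Rightarrow> ('o, 'm) frob \<Rightarrow> ('o, 'm) frob \<times> 'm \<Rightarrow> bool" where
  "frobenius_subalgebra C X (A, i) \<longleftrightarrow> frobenius_algebra C A \<and> algebra_mono C A X i \<and>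
     adj C X A (adj C A X i) = i \<and> adj C A X i \<cdot>\<^bsub>C\<^esub> i = ide C (ob A)"

fun sub_idem ::
  "('o, 'm::ab_group_add) tcat \<Rightarrow> ('o, 'm) frob \<Rightarrow> ('o, 'm) frob \<times> 'm \<Rightarrow> 'm" where
  "sub_idem C X (A, i) = i \<cdot>\<^bsub>C\<^esub> adj C A X i"

text \<open>
  The class \<open>[A]\<close> always consists of all equivalent Frobenius subalgebras, so that the classes of
  Frobenius \<open>\<B>\<close>-subalgebras are elements of the Frobenius subalgebra poset.
\<close>

definition sub_class ::
  "('o, 'm::ab_group_add) tcat \<Rightarrow> ('o, 'm) frob \<Rightarrow> ('o, 'm) frob \<times> 'm \<Rightarrow> (('o, 'm) frob \<times> 'm) set" where
  "sub_class C X A = {A'. frobenius_subalgebra C X A' \<and> sub_idem C X A' = sub_idem C X A}"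

definition frobenius_poset ::
  "('o, 'm::ab_group_add) tcat \<Rightarrow> ('o, 'm) frob \<Rightarrow> (('o, 'm) frob \<times> 'm) set gorder" where
  "frobenius_poset C X = \<lparr>carrier = {sub_class C X A | A. frobenius_subalgebra C X A}, eq = (=),
     le = (\<lambda>K L. \<exists>A\<in>K. \<exists>B\<in>L. sub_idem C X A \<cdot>\<^bsub>C\<^esub> sub_idem C X B = sub_idem C X A \<and>
                            sub_idem C X A = sub_idem C X B \<cdot>\<^bsub>C\<^esub> sub_idem C X A)\<rparr>"

section \<open>Rigidity invariance\<close>

text \<open>Here \<open>R\<close> is a set of representatives of the simple objects, and \<open>\<B> S\<close> a basis for each \<open>S \<in> R\<close>.\<close>

definition simple_representatives :: "('o, 'm::ab_group_add) tcat \<Rightarrow> 'o set \<Rightarrow> bool" where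
  "simple_representatives C R \<longleftrightarrow> (\<forall>S\<in>R. simple_object C S) \<and>
     (\<forall>T. simple_object C T \<longrightarrow> (\<exists>!S. S \<in> R \<and> isomorphic C T S))"

definition hom_basis ::
  "('o, 'm::ab_group_add) tcat \<Rightarrow> 'o \<Rightarrow> 'o set \<Rightarrow> ('o \<Rightarrow> 'm set) \<Rightarrow> bool" where
  "hom_basis C X R \<B> \<longleftrightarrow> simple_representatives C R \<and>
     (\<forall>S\<in>R. \<not> module.dependent (scl C) (\<B> S) \<and> module.span (scl C) (\<B> S) = Hom C X S)"

fun kappa ::
  "('o, 'm::ab_group_add) tcat \<Rightarrow> ('o, 'm) dual_data \<Rightarrow> ('o, 'm) dual_data \<Rightarrow> 'm \<Rightarrow> 'm \<Rightarrow> complex" where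
  "kappa C (X', evX, coevX) (S', evS, coevS) f g =
     (THE c. (f \<otimes>\<^bsub>C\<^esub> g) \<cdot>\<^bsub>C\<^esub> coevX = scl C c coevS)"

text \<open>The Hermitian form, conjugate-linear in the second argument, with orthonormal basis \<open>BS\<close>.\<close>

definition basis_form ::
  "('o, 'm::ab_group_add) tcat \<Rightarrow> 'm set \<Rightarrow> 'm \<Rightarrow> 'm \<Rightarrow> complex" where
  "basis_form C BS x y = (\<Sum>b\<in>BS. module.representation (scl C) BS x b *
                                 cnj (module.representation (scl C) BS y b))"

text \<open>
  Since the form is nondegenerate on the finite-dimensional space \<open>Hom C X S\<close>, the defining property
  determines \<open>M' g\<close> for each \<open>g\<close> separately; conjugate-linearity in \<open>g\<close> is a consequence.
\<close>

definition M_map ::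
  "('o, 'm::ab_group_add) tcat \<Rightarrow> 'm set \<Rightarrow> 'o \<Rightarrow> ('o, 'm) dual_data \<Rightarrow> 'o \<Rightarrow> ('o, 'm) dual_data
    \<Rightarrow> 'm \<Rightarrow> 'm" where
  "M_map C BS X DX S DS g =
     (THE h. h \<in> Hom C X S \<and> (\<forall>f\<in>Hom C X S. basis_form C BS f h = kappa C DX DS f g))"

definition split_subobject ::
  "('o, 'm::ab_group_add) tcat \<Rightarrow> 'o \<Rightarrow> 'o \<Rightarrow> 'm \<Rightarrow> 'm \<Rightarrow> bool" where
  "split_subobject C X A i p \<longleftrightarrow> A \<in> Obj C \<and> i \<in> Hom C A X \<and> p \<in> Hom C X A \<and> p \<cdot>\<^bsub>C\<^esub> i = ide C A"

text \<open>\<open>DX\<close>, \<open>DA\<close> and \<open>DS S\<close> are the left duals used for \<open>X\<close>, \<open>A\<close> and the simple objects \<open>S\<close>.\<close>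

definition rigid_invariant ::
  "('o, 'm::ab_group_add) tcat \<Rightarrow> 'o set \<Rightarrow> ('o \<Rightarrow> 'm set) \<Rightarrow> ('o \<Rightarrow> ('o, 'm) dual_data)
    \<Rightarrow> 'o \<Rightarrow> ('o, 'm) dual_data \<Rightarrow> 'o \<Rightarrow> ('o, 'm) dual_data \<Rightarrow> 'm \<Rightarrow> 'm \<Rightarrow> bool" where
  "rigid_invariant C R \<B> DS X DX A DA i p \<longleftrightarrow> split_subobject C X A i p \<and>
     (\<forall>S\<in>R. M_map C (\<B> S) X DX S (DS S) `
               {g \<cdot>\<^bsub>C\<^esub> dual_arrow C DA DX i | g. g \<in> Hom C (fst DA) (fst (DS S))}
            = {f \<cdot>\<^bsub>C\<^esub> p | f. f \<in> Hom C A S})"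

text \<open>
  The left duals of the Frobenius algebras are the canonical ones; the duals \<open>DS S\<close> of the simple
  objects are independent of these, also when a simple object underlies a Frobenius algebra.
\<close>

fun frobenius_B_subalgebra ::
  "('o, 'm::ab_group_add) tcat \<Rightarrow> 'o set \<Rightarrow> ('o \<Rightarrow> 'm set) \<Rightarrow> ('o \<Rightarrow> ('o, 'm) dual_data)
    \<Rightarrow> ('o, 'm) frob \<Rightarrow> ('o, 'm) frob \<times> 'm \<Rightarrow> bool" where
  "frobenius_B_subalgebra C R \<B> DS X (A, i) \<longleftrightarrow> frobenius_subalgebra C X (A, i) \<and>
     rigid_invariant C R \<B> DS (ob X) (frob_dual C X) (ob A) (frob_dual C A) i (adj C A X i)"

definition frobenius_B_poset ::
  "('o, 'm::ab_group_add) tcat \<Rightarrow> 'o set \<Rightarrow> ('o \<Rightarrow> 'm set) \<Rightarrow> ('o \<Rightarrow> ('o, 'm) dual_data)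
    \<Rightarrow> ('o, 'm) frob \<Rightarrow> (('o, 'm) frob \<times> 'm) set gorder" where
  "frobenius_B_poset C R \<B> DS X = (frobenius_poset C X)
     \<lparr>carrier := {sub_class C X A | A. frobenius_B_subalgebra C R \<B> DS X A}\<rparr>"

section \<open>Intersections\<close>

definition is_pullback ::
  "('o, 'm::ab_group_add) tcat \<Rightarrow> 'o \<Rightarrow> 'o \<Rightarrow> 'm \<Rightarrow> 'm \<Rightarrow> 'o \<Rightarrow> 'm \<Rightarrow> 'm \<Rightarrow> bool" where
  "is_pullback C A B i j P p q \<longleftrightarrow> P \<in> Obj C \<and> p \<in> Hom C P A \<and> q \<in> Hom C P B \<and>
     i \<cdot>\<^bsub>C\<^esub> p = j \<cdot>\<^bsub>C\<^esub> q \<and>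
     (\<forall>W\<in>Obj C. \<forall>f\<in>Hom C W A. \<forall>g\<in>Hom C W B. i \<cdot>\<^bsub>C\<^esub> f = j \<cdot>\<^bsub>C\<^esub> g \<longrightarrow>
        (\<exists>!h. h \<in> Hom C W P \<and> p \<cdot>\<^bsub>C\<^esub> h = f \<and> q \<cdot>\<^bsub>C\<^esub> h = g))"

definition is_intersection ::
  "('o, 'm::ab_group_add) tcat \<Rightarrow> 'o \<Rightarrow> 'm \<Rightarrow> 'o \<Rightarrow> 'm \<Rightarrow> 'o \<Rightarrow> 'm \<Rightarrow> bool" where
  "is_intersection C A i B j P k \<longleftrightarrow> (\<exists>p q. is_pullback C A B i j P p q \<and> k = i \<cdot>\<^bsub>C\<^esub> p)"

end

theory Submission
  imports "HOL-Computational_Algebra.Fundamental_Theorem_Algebra" Defs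
begin

text \<open>
  A Frobenius subalgebra \<open>(A, i)\<close> of \<open>X\<close> is determined up to equivalence by the idempotent
  \<open>b = i i\<^sup>*\<close> of \<open>End(X)\<close>, and the order on classes is an order on these idempotents. The idempotents
  that occur are those with \<open>b\<^sup>* = b\<close> that fix the unit and have an image closed under multiplication
  (\<open>frob_idem_sub_idem\<close>). Conversely, let \<open>b\<close> be such an idempotent. Invariance of the
  Frobenius pairing gives \<open>b(x b(y)) = b(x) b(y) = b(b(x) y)\<close>, so \<open>b\<close> is a conditional expectation, and
  the Frobenius structure of \<open>X\<close> can be compressed to the image of \<open>b\<close>
  (\<open>frobenius_subalgebra_of_splitting\<close>).

  Rigid invariance is a statement about the spaces \<open>V = Hom(X,S)\<close> with their Hermitian
  forms: it says that the projection \<open>f \<mapsto> f b\<close> of \<open>V\<close> is orthogonal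
  (\<open>rigid_invariant_iff_selfadjoint\<close>). This rests on Schur's lemma, by which \<open>\<kappa>'\<close> is a perfect
  pairing, and on the identity \<open>\<kappa>'(f b, g) = \<kappa>'(f, g b\<^sup>*)\<close>.

  For two such idempotents \<open>b\<^sub>1\<close> and \<open>b\<^sub>2\<close> the meet is the orthogonal projection onto the intersection
  of the ranges of the two projections. Semisimplicity gives \<open>End(X)\<close> an inner product for which right
  multiplications by \<open>b\<^sub>1\<close> and \<open>b\<^sub>2\<close> are orthogonal projections, and the meet is the component \<open>c\<close> of \<open>1\<close>
  orthogonal to the left ideal generated by \<open>1 - b\<^sub>1\<close> and \<open>1 - b\<^sub>2\<close>. That \<open>c\<close> is self-dual follows from
  applying the duality to the decomposition of \<open>1\<close> (\<open>meet_idempotent\<close>). Since \<open>c\<close> fixes every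
  morphism into \<open>X\<close> that \<open>b\<^sub>1\<close> and \<open>b\<^sub>2\<close> fix, its image is the pullback \<open>A \<inter> B\<close>.

  Finally, \<open>X\<close> itself is the top element, because \<open>1\<close> is self-adjoint, and \<open>End(X)\<close> is
  finite-dimensional. Hence two elements have an upper bound of minimal rank, and by the existence of
  meets it is their least upper bound (\<open>idems_join\<close>).
\<close>

section \<open>Typed arrows\<close>

text \<open>
  Hom-sets may overlap, so a morphism alone has no source or target. Bundling it with its objects
  makes source and target functions of the arrow. All side conditions of the categorical laws are
  then decided by rewriting, and diagrammatic identities can be proved by simplification.
\<close>

datatype ('o, 'm) arr = Arr (src: 'o) (mor: 'm) (trg: 'o)

context semisimple_tensor_category
begin

definition arrow :: "('a, 'b) arr \<Rightarrow> bool" where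
  "arrow f \<longleftrightarrow> src f \<in> Obj C \<and> trg f \<in> Obj C \<and> mor f \<in> Hom C (src f) (trg f)"

definition comp :: "('a, 'b) arr \<Rightarrow> ('a, 'b) arr \<Rightarrow> ('a, 'b) arr" (infixr "\<bullet>" 70) where
  "g \<bullet> f = Arr (src f) (mor g \<cdot> mor f) (trg g)"

definition tens :: "('a, 'b) arr \<Rightarrow> ('a, 'b) arr \<Rightarrow> ('a, 'b) arr" (infixr "\<star>" 75) where
  "f \<star> g = Arr (src f \<boxtimes> src g) (mor f \<otimes> mor g) (trg f \<boxtimes> trg g)"

definition I :: "'a \<Rightarrow> ('a, 'b) arr" where
  "I X = Arr X (ide C X) X"

declare one_Obj [simp] tob_Obj [simp] tob_assoc [simp] one_tob [simp] tob_one [simp]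

lemma src_trg_simps [simp]:
  "src (g \<bullet> f) = src f" "trg (g \<bullet> f) = trg g"
  "src (f \<star> g) = src f \<boxtimes> src g" "trg (f \<star> g) = trg f \<boxtimes> trg g"
  "src (I X) = X" "trg (I X) = X"
  by (simp_all add: comp_def tens_def I_def)

lemma mor_simps:
  "mor (g \<bullet> f) = mor g \<cdot> mor f" "mor (f \<star> g) = mor f \<otimes> mor g" "mor (I X) = ide C X"
  by (simp_all add: comp_def tens_def I_def)

lemma arrow_Arr: "X \<in> Obj C \<Longrightarrow> Y \<in> Obj C \<Longrightarrow> arrow (Arr X f Y) \<longleftrightarrow> f \<in> Hom C X Y"
  by (simp add: arrow_def)

lemma arrow_I [simp]: "X \<in> Obj C \<Longrightarrow> arrow (I X)"
  by (simp add: arrow_def I_def ide_in_Hom)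

lemma arrow_comp [simp]: "arrow f \<Longrightarrow> arrow g \<Longrightarrow> trg f = src g \<Longrightarrow> arrow (g \<bullet> f)"
  by (auto simp: arrow_def comp_def intro: cmp_in_Hom)

lemma arrow_tens [simp]: "arrow f \<Longrightarrow> arrow g \<Longrightarrow> arrow (f \<star> g)"
  by (auto simp: arrow_def tens_def intro: tar_in_Hom)

lemma comp_assoc [simp]:
  "arrow f \<Longrightarrow> arrow g \<Longrightarrow> arrow h \<Longrightarrow> trg f = src g \<Longrightarrow> trg g = src h
    \<Longrightarrow> (h \<bullet> g) \<bullet> f = h \<bullet> g \<bullet> f"
  by (auto simp: arrow_def comp_def intro: cmp_assoc)

lemma comp_I [simp]: "arrow f \<Longrightarrow> src f = X \<Longrightarrow> f \<bullet> I X = f"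
  by (cases f) (auto simp: arrow_def comp_def I_def intro: cmp_ide)

lemma I_comp [simp]: "arrow f \<Longrightarrow> trg f = X \<Longrightarrow> I X \<bullet> f = f"
  by (cases f) (auto simp: arrow_def comp_def I_def intro: ide_cmp)

lemma tens_assoc [simp]:
  "arrow f \<Longrightarrow> arrow g \<Longrightarrow> arrow h \<Longrightarrow> (f \<star> g) \<star> h = f \<star> g \<star> h"
  by (simp add: arrow_def tens_def
      tar_assoc [of "src f" "trg f" "src g" "trg g" "src h" "trg h"])

lemma I_tens_I [simp]: "X \<in> Obj C \<Longrightarrow> Y \<in> Obj C \<Longrightarrow> I X \<star> I Y = I (X \<boxtimes> Y)"
  by (simp add: tens_def I_def tar_ide)

lemma I_one_tens [simp]: "arrow f \<Longrightarrow> I \<one> \<star> f = f"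
  by (cases f) (auto simp: arrow_def tens_def I_def intro: one_tar)

lemma tens_I_one [simp]: "arrow f \<Longrightarrow> f \<star> I \<one> = f"
  by (cases f) (auto simp: arrow_def tens_def I_def intro: tar_one)

lemma tens_comp:
  "arrow f \<Longrightarrow> arrow g \<Longrightarrow> arrow f' \<Longrightarrow> arrow g' \<Longrightarrow> trg f = src f' \<Longrightarrow> trg g = src g'
    \<Longrightarrow> (f' \<star> g') \<bullet> (f \<star> g) = (f' \<bullet> f) \<star> (g' \<bullet> g)"
  by (simp add: arrow_def tens_def comp_def
      interchange [symmetric, of "src f" "trg f" "trg f'" "src g" "trg g" "trg g'"])

lemma I_tens_split [simp]:
  "X \<in> Obj C \<Longrightarrow> Y \<in> Obj C \<Longrightarrow> arrow f \<Longrightarrow> I (X \<boxtimes> Y) \<star> f = I X \<star> I Y \<star> f"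
  by (simp flip: I_tens_I)

lemma whisker:
  "arrow f \<Longrightarrow> arrow g \<Longrightarrow> trg f = src g \<Longrightarrow> X \<in> Obj C \<Longrightarrow> (g \<bullet> f) \<star> I X = (g \<star> I X) \<bullet> (f \<star> I X)"
  "arrow f \<Longrightarrow> arrow g \<Longrightarrow> trg f = src g \<Longrightarrow> X \<in> Obj C \<Longrightarrow> I X \<star> (g \<bullet> f) = (I X \<star> g) \<bullet> (I X \<star> f)"
  by (simp_all add: tens_comp)

text \<open>
  Compositions are normalised by nesting to the right; these rules apply an equation for a
  composite \<open>a \<bullet> b\<close> in front of a further arrow.
\<close>

lemma rewrite_left:
  assumes "a \<bullet> b = c" "arrow a" "arrow b" "arrow r" "trg b = src a" "trg r = src b"
  shows "a \<bullet> b \<bullet> r = c \<bullet> r"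
  using assms by (simp flip: assms(1))

lemma arrowD [simp]: "arrow f \<Longrightarrow> src f \<in> Obj C" "arrow f \<Longrightarrow> trg f \<in> Obj C"
  by (simp_all add: arrow_def)

text \<open>Arrows on disjoint strands slide past each other.\<close>

lemma tens_slide:
  assumes "arrow f" "arrow g"
  shows "(I (trg f) \<star> g) \<bullet> (f \<star> I (src g)) = f \<star> g"
    and "(f \<star> I (trg g)) \<bullet> (I (src f) \<star> g) = f \<star> g"
  using assms by (simp_all add: tens_comp)

lemma rewrite_left':
  assumes "a \<bullet> b = c \<bullet> d" "arrow a" "arrow b" "arrow r" "trg b = src a" "trg r = src b"
    and "arrow c" "arrow d" "trg d = src c" "src d = src b"
  shows "a \<bullet> b \<bullet> r = c \<bullet> d \<bullet> r"
  using rewrite_left [OF assms(1-6)] assms(4-) by simp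

section \<open>Duals\<close>

definition Ev :: "'a \<Rightarrow> ('a, 'b) dual_data \<Rightarrow> ('a, 'b) arr" where
  "Ev X D = Arr (fst D \<boxtimes> X) (fst (snd D)) \<one>"

definition Coev :: "'a \<Rightarrow> ('a, 'b) dual_data \<Rightarrow> ('a, 'b) arr" where
  "Coev X D = Arr \<one> (snd (snd D)) (X \<boxtimes> fst D)"

definition transp :: "('a, 'b) dual_data \<Rightarrow> ('a, 'b) dual_data \<Rightarrow> ('a, 'b) arr \<Rightarrow> ('a, 'b) arr" where
  "transp DX DY f = Arr (fst DY) (dual_arrow C DX DY (mor f)) (fst DX)"

lemma dual_src_trg [simp]:
  "src (Ev X D) = fst D \<boxtimes> X" "trg (Ev X D) = \<one>" "src (Coev X D) = \<one>" "trg (Coev X D) = X \<boxtimes> fst D"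
  "src (transp DX DY f) = fst DY" "trg (transp DX DY f) = fst DX"
  "mor (transp DX DY f) = dual_arrow C DX DY (mor f)"
  by (simp_all add: Ev_def Coev_def transp_def)

lemma left_dual_iff:
  assumes "X \<in> Obj C"
  shows "left_dual C X D \<longleftrightarrow> fst D \<in> Obj C \<and> arrow (Ev X D) \<and> arrow (Coev X D) \<and>
    (I X \<star> Ev X D) \<bullet> (Coev X D \<star> I X) = I X \<and>
    (Ev X D \<star> I (fst D)) \<bullet> (I (fst D) \<star> Coev X D) = I (fst D)"
  using assms by (cases D) (auto simp: arrow_def comp_def tens_def I_def Ev_def Coev_def simp del: arrowD)

lemma transp_eq:
  assumes "fst DX \<in> Obj C" "fst DY \<in> Obj C"
  shows "transp DX DY (Arr X f Y) =
    (Ev Y DY \<star> I (fst DX)) \<bullet> (I (fst DY) \<star> Arr X f Y \<star> I (fst DX)) \<bullet> (I (fst DY) \<star> Coev X DX)"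
  using assms
  by (cases DX; cases DY) (simp add: transp_def comp_def tens_def I_def Ev_def Coev_def)

context
  fixes X Y :: 'a and DX DY :: "('a, 'b) dual_data" and f :: "('a, 'b) arr"
  assumes X: "X \<in> Obj C" and Y: "Y \<in> Obj C"
    and DX: "left_dual C X DX" and DY: "left_dual C Y DY"
    and f: "arrow f" "src f = X" "trg f = Y"
begin

private abbreviation (input) "X' \<equiv> fst DX"
private abbreviation (input) "Y' \<equiv> fst DY"

private lemma dual_rules:
  "X \<in> Obj C" "Y \<in> Obj C" "X' \<in> Obj C" "Y' \<in> Obj C" "arrow f" "src f = X" "trg f = Y"
  "arrow (Ev X DX)" "arrow (Coev X DX)" "arrow (Ev Y DY)" "arrow (Coev Y DY)"
  "(I X \<star> Ev X DX) \<bullet> (Coev X DX \<star> I X) = I X" "(Ev X DX \<star> I X') \<bullet> (I X' \<star> Coev X DX) = I X'"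
  "(I Y \<star> Ev Y DY) \<bullet> (Coev Y DY \<star> I Y) = I Y" "(Ev Y DY \<star> I Y') \<bullet> (I Y' \<star> Coev Y DY) = I Y'"
  using DX DY X Y f by (simp_all add: left_dual_iff)

private lemma transp_formula:
  "transp DX DY f = (Ev Y DY \<star> I X') \<bullet> (I Y' \<star> f \<star> I X') \<bullet> (I Y' \<star> Coev X DX)"
  using transp_eq [of DX DY X "mor f" Y] dual_rules by (cases f) simp

lemma arrow_transp: "arrow (transp DX DY f)"
  using dual_rules by (simp add: transp_formula)

lemma Ev_transp: "Ev Y DY \<bullet> (I Y' \<star> f) = Ev X DX \<bullet> (transp DX DY f \<star> I X)"
proof -
  note [simp] = dual_rules
  have "Ev X DX \<bullet> (transp DX DY f \<star> I X) =
      Ev X DX \<bullet> (Ev Y DY \<star> I X' \<star> I X) \<bullet> (I Y' \<star> f \<star> I X' \<star> I X) \<bullet> (I Y' \<star> Coev X DX \<star> I X)"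
    by (simp add: transp_formula whisker)
  also have "\<dots> = (Ev Y DY \<bullet> (I Y' \<star> I Y \<star> Ev X DX)) \<bullet> (I Y' \<star> f \<star> I X' \<star> I X) \<bullet> (I Y' \<star> Coev X DX \<star> I X)"
    using tens_slide [of "Ev Y DY" "Ev X DX"] by (intro rewrite_left) simp_all
  also have "\<dots> = Ev Y DY \<bullet> (I Y' \<star> ((I Y \<star> Ev X DX) \<bullet> (f \<star> I X' \<star> I X) \<bullet> (Coev X DX \<star> I X)))"
    by (simp add: whisker)
  also have "(I Y \<star> Ev X DX) \<bullet> (f \<star> I X' \<star> I X) \<bullet> (Coev X DX \<star> I X) =
      (f \<bullet> (I X \<star> Ev X DX)) \<bullet> (Coev X DX \<star> I X)"
    using tens_slide [of f "Ev X DX"] by (intro rewrite_left) simp_all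
  also have "\<dots> = f"
    by simp
  finally show ?thesis by simp
qed

lemma Coev_transp: "(f \<star> I X') \<bullet> Coev X DX = (I Y \<star> transp DX DY f) \<bullet> Coev Y DY"
proof -
  note [simp] = dual_rules
  have "(I Y \<star> transp DX DY f) \<bullet> Coev Y DY =
      (I Y \<star> Ev Y DY \<star> I X') \<bullet> (I Y \<star> I Y' \<star> f \<star> I X') \<bullet> (I Y \<star> I Y' \<star> Coev X DX) \<bullet> Coev Y DY"
    by (simp add: transp_formula whisker)
  also have "(I Y \<star> I Y' \<star> Coev X DX) \<bullet> Coev Y DY = (Coev Y DY \<star> I X \<star> I X') \<bullet> Coev X DX"
    using tens_slide [of "Coev Y DY" "Coev X DX"] by simp
  also have "(I Y \<star> I Y' \<star> f \<star> I X') \<bullet> (Coev Y DY \<star> I X \<star> I X') \<bullet> Coev X DX =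
      (((I Y \<star> I Y' \<star> f) \<bullet> (Coev Y DY \<star> I X)) \<star> I X') \<bullet> Coev X DX"
    by (simp add: whisker)
  also have "(I Y \<star> I Y' \<star> f) \<bullet> (Coev Y DY \<star> I X) = (Coev Y DY \<star> I Y) \<bullet> f"
    using tens_slide [of "Coev Y DY" f] by simp
  also have "(I Y \<star> Ev Y DY \<star> I X') \<bullet> (((Coev Y DY \<star> I Y) \<bullet> f) \<star> I X') \<bullet> Coev X DX =
      (((I Y \<star> Ev Y DY) \<bullet> (Coev Y DY \<star> I Y)) \<star> I X') \<bullet> (f \<star> I X') \<bullet> Coev X DX"
    by (simp add: whisker del: dual_rules(12-15))
  finally show ?thesis by simp
qed

end

text \<open>The evaluation pairing is nondegenerate in both variables.\<close>

lemma Ev_cancel_left: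
  assumes "X \<in> Obj C" "left_dual C X D"
    and "arrow f" "trg f = fst D" "arrow g" "trg g = fst D" "src g = src f"
    and eq: "Ev X D \<bullet> (f \<star> I X) = Ev X D \<bullet> (g \<star> I X)"
  shows "f = g"
proof -
  have [simp]: "X \<in> Obj C" "fst D \<in> Obj C" "arrow (Ev X D)" "arrow (Coev X D)"
    "(Ev X D \<star> I (fst D)) \<bullet> (I (fst D) \<star> Coev X D) = I (fst D)"
    using assms(1,2) by (simp_all add: left_dual_iff)
  have *: "h = ((Ev X D \<bullet> (h \<star> I X)) \<star> I (fst D)) \<bullet> (I (src h) \<star> Coev X D)"
    if h: "arrow h" "trg h = fst D" for h
  proof -
    have "h = ((Ev X D \<star> I (fst D)) \<bullet> (I (fst D) \<star> Coev X D)) \<bullet> h"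
      using h by simp
    also have "\<dots> = (Ev X D \<star> I (fst D)) \<bullet> (I (fst D) \<star> Coev X D) \<bullet> h"
      using h by (intro comp_assoc) simp_all
    also have "(I (fst D) \<star> Coev X D) \<bullet> h = (h \<star> I X \<star> I (fst D)) \<bullet> (I (src h) \<star> Coev X D)"
      using h tens_slide [of h "Coev X D"] by simp
    finally show ?thesis
      using h by (simp add: whisker)
  qed
  show ?thesis
    using * [of f] * [of g] assms by simp
qed

lemma Ev_cancel_right:
  assumes "X \<in> Obj C" "left_dual C X D"
    and "arrow f" "trg f = X" "arrow g" "trg g = X" "src g = src f"
    and eq: "Ev X D \<bullet> (I (fst D) \<star> f) = Ev X D \<bullet> (I (fst D) \<star> g)"
  shows "f = g"
proof -
  have [simp]: "X \<in> Obj C" "fst D \<in> Obj C" "arrow (Ev X D)" "arrow (Coev X D)"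
    "(I X \<star> Ev X D) \<bullet> (Coev X D \<star> I X) = I X"
    using assms(1,2) by (simp_all add: left_dual_iff)
  have *: "h = (I X \<star> (Ev X D \<bullet> (I (fst D) \<star> h))) \<bullet> (Coev X D \<star> I (src h))"
    if h: "arrow h" "trg h = X" for h
  proof -
    have "h = ((I X \<star> Ev X D) \<bullet> (Coev X D \<star> I X)) \<bullet> h"
      using h by simp
    also have "\<dots> = (I X \<star> Ev X D) \<bullet> (Coev X D \<star> I X) \<bullet> h"
      using h by (intro comp_assoc) simp_all
    also have "(Coev X D \<star> I X) \<bullet> h = (I X \<star> I (fst D) \<star> h) \<bullet> (Coev X D \<star> I (src h))"
      using h tens_slide [of "Coev X D" h] by simp
    finally show ?thesis
      using h by (simp add: whisker)
  qed
  show ?thesis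
    using * [of f] * [of g] assms by simp
qed

text \<open>
  Nondegeneracy of the evaluation makes this equation a characterisation of \<open>f\<^sup>*\<close>,
  which is easier to verify than the defining composite.
\<close>

lemma transp_eqI:
  assumes "X \<in> Obj C" "Y \<in> Obj C" "left_dual C X DX" "left_dual C Y DY"
    and "arrow f" "src f = X" "trg f = Y" "arrow h" "src h = fst DY" "trg h = fst DX"
    and "Ev Y DY \<bullet> (I (fst DY) \<star> f) = Ev X DX \<bullet> (h \<star> I X)"
  shows "transp DX DY f = h"
proof (rule Ev_cancel_left [OF assms(1,3)])
  show "Ev X DX \<bullet> (transp DX DY f \<star> I X) = Ev X DX \<bullet> (h \<star> I X)"
    using Ev_transp [OF assms(1-7)] assms(11) by simp
qed (use assms arrow_transp [OF assms(1-7)] in simp_all)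

end

section \<open>Frobenius algebras and their Frobenius idempotents\<close>

context semisimple_tensor_category
begin

definition Mul :: "('a, 'b) frob \<Rightarrow> ('a, 'b) arr" where
  "Mul A = Arr (ob A \<boxtimes> ob A) (mult A) (ob A)"

definition Comul :: "('a, 'b) frob \<Rightarrow> ('a, 'b) arr" where
  "Comul A = Arr (ob A) (comult A) (ob A \<boxtimes> ob A)"

definition Unit :: "('a, 'b) frob \<Rightarrow> ('a, 'b) arr" where
  "Unit A = Arr \<one> (unt A) (ob A)"

definition Counit :: "('a, 'b) frob \<Rightarrow> ('a, 'b) arr" where
  "Counit A = Arr (ob A) (counit A) \<one>"

lemma frob_src_trg [simp]:
  "src (Mul A) = ob A \<boxtimes> ob A" "trg (Mul A) = ob A"
  "src (Comul A) = ob A" "trg (Comul A) = ob A \<boxtimes> ob A"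
  "src (Unit A) = \<one>" "trg (Unit A) = ob A" "src (Counit A) = ob A" "trg (Counit A) = \<one>"
  by (simp_all add: Mul_def Comul_def Unit_def Counit_def)

lemma frobenius_algebra_iff:
  "frobenius_algebra C A \<longleftrightarrow> ob A \<in> Obj C \<and>
    arrow (Mul A) \<and> arrow (Comul A) \<and> arrow (Unit A) \<and> arrow (Counit A) \<and>
    Mul A \<bullet> (Mul A \<star> I (ob A)) = Mul A \<bullet> (I (ob A) \<star> Mul A) \<and>
    Mul A \<bullet> (Unit A \<star> I (ob A)) = I (ob A) \<and> Mul A \<bullet> (I (ob A) \<star> Unit A) = I (ob A) \<and>
    (Comul A \<star> I (ob A)) \<bullet> Comul A = (I (ob A) \<star> Comul A) \<bullet> Comul A \<and>
    (Counit A \<star> I (ob A)) \<bullet> Comul A = I (ob A) \<and> (I (ob A) \<star> Counit A) \<bullet> Comul A = I (ob A) \<and>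
    (I (ob A) \<star> Mul A) \<bullet> (Comul A \<star> I (ob A)) = Comul A \<bullet> Mul A \<and>
    Comul A \<bullet> Mul A = (Mul A \<star> I (ob A)) \<bullet> (I (ob A) \<star> Comul A)"
  by (auto simp: frobenius_algebra_def algebra_def coalgebra_def arrow_def comp_def tens_def I_def
      Mul_def Comul_def Unit_def Counit_def simp del: arrowD)

lemma fst_frob_dual [simp]: "fst (frob_dual C A) = ob A"
  by (simp add: frob_dual_def)

lemma Ev_frob_dual: "Ev (ob A) (frob_dual C A) = Counit A \<bullet> Mul A"
  by (simp add: Ev_def frob_dual_def comp_def Counit_def Mul_def)

lemma Coev_frob_dual: "Coev (ob A) (frob_dual C A) = Comul A \<bullet> Unit A"
  by (simp add: Coev_def frob_dual_def comp_def Comul_def Unit_def)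

text \<open>
  The Frobenius relations turn each zigzag into \<open>\<delta> m\<close> between a unit and a counit.
\<close>

lemma left_dual_frob_dual:
  assumes "frobenius_algebra C A"
  shows "left_dual C (ob A) (frob_dual C A)"
proof -
  define X where "X = ob A"
  have [simp]: "ob A = X" by (simp add: X_def)
  have [simp]: "X \<in> Obj C" "arrow (Mul A)" "arrow (Comul A)" "arrow (Unit A)" "arrow (Counit A)"
    "Mul A \<bullet> (Unit A \<star> I X) = I X" "Mul A \<bullet> (I X \<star> Unit A) = I X"
    "(Counit A \<star> I X) \<bullet> Comul A = I X" "(I X \<star> Counit A) \<bullet> Comul A = I X"
    and frob: "(I X \<star> Mul A) \<bullet> (Comul A \<star> I X) = Comul A \<bullet> Mul A"
      "(Mul A \<star> I X) \<bullet> (I X \<star> Comul A) = Comul A \<bullet> Mul A"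
    using assms [unfolded frobenius_algebra_iff, folded X_def] by simp_all
  have "(I X \<star> (Counit A \<bullet> Mul A)) \<bullet> ((Comul A \<bullet> Unit A) \<star> I X) =
      (I X \<star> Counit A) \<bullet> ((I X \<star> Mul A) \<bullet> (Comul A \<star> I X)) \<bullet> (Unit A \<star> I X)"
    by (simp add: whisker)
  also have "\<dots> = ((I X \<star> Counit A) \<bullet> Comul A) \<bullet> (Mul A \<bullet> (Unit A \<star> I X))"
    unfolding frob by simp
  finally have 1: "(I X \<star> (Counit A \<bullet> Mul A)) \<bullet> ((Comul A \<bullet> Unit A) \<star> I X) = I X"
    by simp
  have "((Counit A \<bullet> Mul A) \<star> I X) \<bullet> (I X \<star> (Comul A \<bullet> Unit A)) =
      (Counit A \<star> I X) \<bullet> ((Mul A \<star> I X) \<bullet> (I X \<star> Comul A)) \<bullet> (I X \<star> Unit A)"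
    by (simp add: whisker)
  also have "\<dots> = ((Counit A \<star> I X) \<bullet> Comul A) \<bullet> (Mul A \<bullet> (I X \<star> Unit A))"
    unfolding frob by simp
  finally have 2: "((Counit A \<bullet> Mul A) \<star> I X) \<bullet> (I X \<star> (Comul A \<bullet> Unit A)) = I X"
    by simp
  show ?thesis
    using 1 2 Ev_frob_dual [of A] Coev_frob_dual [of A] by (simp add: left_dual_iff)
qed

text \<open>
  The last equation says that the image of \<open>b\<close> is closed under multiplication.
\<close>

definition frob_idem :: "('a, 'b) frob \<Rightarrow> 'b \<Rightarrow> bool" where
  "frob_idem X b \<longleftrightarrow> b \<in> Hom C (ob X) (ob X) \<and> b \<cdot> b = b \<and> adj C X X b = b \<and>
     b \<cdot> unt X = unt X \<and> b \<cdot> mult X \<cdot> (b \<otimes> b) = mult X \<cdot> (b \<otimes> b)"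

lemma split_mono_cancel:
  assumes "t \<bullet> s = I Y" "s \<bullet> f = s \<bullet> g"
    and "arrow s" "arrow t" "trg s = src t" "src s = Y"
    and "arrow f" "arrow g" "trg f = Y" "trg g = Y"
  shows "f = g"
proof -
  have "f = (t \<bullet> s) \<bullet> f"
    using assms by simp
  also have "\<dots> = t \<bullet> s \<bullet> f"
    using assms by (intro comp_assoc) simp_all
  also have "\<dots> = (t \<bullet> s) \<bullet> g"
    unfolding assms(2) using assms(3-) by (intro comp_assoc [symmetric]) simp_all
  also have "\<dots> = g"
    using assms by simp
  finally show ?thesis .
qed

lemma split_epi_cancel:
  assumes "t \<bullet> s = I Y" "f \<bullet> t = g \<bullet> t"
    and "arrow s" "arrow t" "trg s = src t" "trg t = Y"
    and "arrow f" "arrow g" "src f = Y" "src g = Y"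
  shows "f = g"
proof -
  have "f = f \<bullet> t \<bullet> s"
    using assms by simp
  also have "\<dots> = (g \<bullet> t) \<bullet> s"
    unfolding assms(2) [symmetric] using assms(3-) by (intro comp_assoc [symmetric]) simp_all
  also have "\<dots> = g \<bullet> t \<bullet> s"
    using assms by (intro comp_assoc) simp_all
  also have "\<dots> = g"
    using assms by simp
  finally show ?thesis .
qed

lemma arr_eq_iff: "f = g \<longleftrightarrow> src f = src g \<and> mor f = mor g \<and> trg f = trg g"
  by (cases f; cases g) auto

lemma adj_self_iff:
  assumes X: "frobenius_algebra C X" and b: "arrow b" "src b = ob X" "trg b = ob X"
  shows "adj C X X (mor b) = mor b \<longleftrightarrow>
    (Counit X \<bullet> Mul X) \<bullet> (b \<star> I (ob X)) = (Counit X \<bullet> Mul X) \<bullet> (I (ob X) \<star> b)"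
proof -
  have ob: "ob X \<in> Obj C"
    using X by (simp add: frobenius_algebra_iff)
  note D = left_dual_frob_dual [OF X]
  define T where "T = transp (frob_dual C X) (frob_dual C X) b"
  have eq: "(Counit X \<bullet> Mul X) \<bullet> (I (ob X) \<star> b) = (Counit X \<bullet> Mul X) \<bullet> (T \<star> I (ob X))"
    using Ev_transp [OF ob ob D D b] unfolding Ev_frob_dual fst_frob_dual T_def .
  have "adj C X X (mor b) = mor b \<longleftrightarrow> T = b"
    by (auto simp: adj_def T_def arr_eq_iff b)
  also have "\<dots> \<longleftrightarrow> (Counit X \<bullet> Mul X) \<bullet> (b \<star> I (ob X)) = (Counit X \<bullet> Mul X) \<bullet> (I (ob X) \<star> b)"
  proof
    assume "(Counit X \<bullet> Mul X) \<bullet> (b \<star> I (ob X)) = (Counit X \<bullet> Mul X) \<bullet> (I (ob X) \<star> b)"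
    then show "T = b"
      unfolding T_def by (intro transp_eqI [OF ob ob D D b b(1)]) (simp_all only: b fst_frob_dual Ev_frob_dual)
  qed (use eq in simp)
  finally show ?thesis .
qed

lemma frob_idem_iff:
  assumes X: "frobenius_algebra C X" and b: "src b = ob X" "trg b = ob X"
  shows "frob_idem X (mor b) \<longleftrightarrow> arrow b \<and> b \<bullet> b = b \<and>
    (Counit X \<bullet> Mul X) \<bullet> (b \<star> I (ob X)) = (Counit X \<bullet> Mul X) \<bullet> (I (ob X) \<star> b) \<and>
    b \<bullet> Unit X = Unit X \<and> b \<bullet> Mul X \<bullet> (b \<star> b) = Mul X \<bullet> (b \<star> b)"
proof -
  have ob: "ob X \<in> Obj C"
    using X by (simp add: frobenius_algebra_iff)
  have 1: "arrow b \<longleftrightarrow> mor b \<in> Hom C (ob X) (ob X)"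
    using b ob by (simp add: arrow_def)
  have 2: "b \<bullet> b = b \<longleftrightarrow> mor b \<cdot> mor b = mor b"
    "b \<bullet> Unit X = Unit X \<longleftrightarrow> mor b \<cdot> unt X = unt X"
    "b \<bullet> Mul X \<bullet> (b \<star> b) = Mul X \<bullet> (b \<star> b) \<longleftrightarrow>
      mor b \<cdot> mult X \<cdot> (mor b \<otimes> mor b) = mult X \<cdot> (mor b \<otimes> mor b)"
    using b by (simp_all add: arr_eq_iff comp_def tens_def Unit_def Mul_def)
  show ?thesis
    using adj_self_iff [OF X _ b] unfolding frob_idem_def 2 1 [symmetric] by blast
qed

section \<open>Splitting a Frobenius idempotent\<close>

context
  fixes X :: "('a, 'b) frob" and b :: "('a, 'b) arr"
  assumes X: "frobenius_algebra C X"
    and b_src: "src b = ob X" and b_trg: "trg b = ob X" and b: "frob_idem X (mor b)"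
begin

private abbreviation (input) "i \<equiv> I (ob X)"
private abbreviation (input) "m \<equiv> Mul X"
private abbreviation (input) "d \<equiv> Comul X"
private abbreviation (input) "u \<equiv> Unit X"
private abbreviation (input) "e \<equiv> Counit X"
private abbreviation (input) "q \<equiv> Counit X \<bullet> Mul X"

private lemma frob_rules:
  "ob X \<in> Obj C" "arrow m" "arrow d" "arrow u" "arrow e"
  "m \<bullet> (m \<star> i) = m \<bullet> (i \<star> m)" "m \<bullet> (u \<star> i) = i" "m \<bullet> (i \<star> u) = i"
  "(d \<star> i) \<bullet> d = (i \<star> d) \<bullet> d" "(e \<star> i) \<bullet> d = i" "(i \<star> e) \<bullet> d = i"
  "(i \<star> m) \<bullet> (d \<star> i) = d \<bullet> m" "(m \<star> i) \<bullet> (i \<star> d) = d \<bullet> m"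
  using X [unfolded frobenius_algebra_iff] by simp_all

private lemma b_rules:
  "src b = ob X" "trg b = ob X" "arrow b" "b \<bullet> b = b" "b \<bullet> u = u"
  "b \<bullet> m \<bullet> (b \<star> b) = m \<bullet> (b \<star> b)" "q \<bullet> (b \<star> i) = q \<bullet> (i \<star> b)"
  using b [unfolded frob_idem_iff [OF X b_src b_trg]] b_src b_trg by simp_all

private lemmas r = frob_rules(1-5) b_rules(1-3)

text \<open>
  Two ways to move factors inside a triple product \<open>\<epsilon>(fgh)\<close>: associativity, and passing
  \<open>b\<close> from one factor of the pairing \<open>q\<close> to the other.
\<close>

private lemma pairing_swap:
  assumes "arrow f" "arrow g" "trg f = ob X" "trg g = ob X"
  shows "q \<bullet> (f \<star> (b \<bullet> g)) = q \<bullet> ((b \<bullet> f) \<star> g)"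
proof -
  have "q \<bullet> (f \<star> (b \<bullet> g)) = (q \<bullet> (i \<star> b)) \<bullet> (f \<star> g)"
    using assms r by (simp add: tens_comp)
  also have "\<dots> = (q \<bullet> (b \<star> i)) \<bullet> (f \<star> g)"
    by (simp only: b_rules)
  also have "\<dots> = q \<bullet> ((b \<bullet> f) \<star> g)"
    using assms r by (simp add: tens_comp)
  finally show ?thesis .
qed

private lemma pairing_assoc:
  assumes "arrow f" "arrow g" "arrow h" "trg f = ob X" "trg g = ob X" "trg h = ob X"
  shows "q \<bullet> (f \<star> (m \<bullet> (g \<star> h))) = q \<bullet> ((m \<bullet> (f \<star> g)) \<star> h)"
proof -
  have "q \<bullet> (f \<star> (m \<bullet> (g \<star> h))) = e \<bullet> (m \<bullet> (i \<star> m)) \<bullet> (f \<star> g \<star> h)"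
    using assms r by (simp add: tens_comp)
  also have "\<dots> = e \<bullet> (m \<bullet> (m \<star> i)) \<bullet> ((f \<star> g) \<star> h)"
    using assms r frob_rules(6) by simp
  also have "\<dots> = q \<bullet> ((m \<bullet> (f \<star> g)) \<star> h)"
    using assms r by (simp add: tens_comp del: tens_assoc)
  finally show ?thesis .
qed

text \<open>
  An idempotent onto a subalgebra that is symmetric for the pairing is a conditional
  expectation: \<open>b(xb(y)) = b(b(x)b(y)) = b(b(x)y)\<close>. Paired with a third factor, all of
  them become \<open>\<epsilon>(b(x)b(y)b(z))\<close>.
\<close>

private lemma b_mul_left: "b \<bullet> m \<bullet> (b \<star> i) = m \<bullet> (b \<star> b)"
proof (rule Ev_cancel_right [OF _ left_dual_frob_dual [OF X]])
  have "q \<bullet> (i \<star> (b \<bullet> m \<bullet> (b \<star> i))) = q \<bullet> (b \<star> (m \<bullet> (b \<star> i)))"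
    using r by (simp add: pairing_swap del: comp_assoc)
  also have "\<dots> = q \<bullet> ((m \<bullet> (b \<star> b)) \<star> i)"
    using r by (simp add: pairing_assoc del: comp_assoc)
  also have "\<dots> = q \<bullet> ((b \<bullet> m \<bullet> (b \<star> b)) \<star> i)"
    by (simp only: b_rules)
  also have "\<dots> = q \<bullet> ((m \<bullet> (b \<star> b)) \<star> b)"
    using r by (simp add: pairing_swap [symmetric] del: comp_assoc)
  also have "\<dots> = q \<bullet> (b \<star> (m \<bullet> (b \<star> b)))"
    using r by (simp add: pairing_assoc del: comp_assoc)
  also have "\<dots> = q \<bullet> (i \<star> (b \<bullet> m \<bullet> (b \<star> b)))"
    using r by (simp add: pairing_swap del: comp_assoc)
  finally show "Ev (ob X) (frob_dual C X) \<bullet> (I (fst (frob_dual C X)) \<star> (b \<bullet> m \<bullet> (b \<star> i))) =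
      Ev (ob X) (frob_dual C X) \<bullet> (I (fst (frob_dual C X)) \<star> (m \<bullet> (b \<star> b)))"
    by (simp only: b_rules Ev_frob_dual fst_frob_dual)
qed (use r in simp_all)

private lemma b_mul_right: "b \<bullet> m \<bullet> (i \<star> b) = m \<bullet> (b \<star> b)"
proof (rule Ev_cancel_left [OF _ left_dual_frob_dual [OF X]])
  have "q \<bullet> ((b \<bullet> m \<bullet> (i \<star> b)) \<star> i) = q \<bullet> ((m \<bullet> (i \<star> b)) \<star> b)"
    using r by (simp add: pairing_swap [symmetric] del: comp_assoc)
  also have "\<dots> = q \<bullet> (i \<star> (m \<bullet> (b \<star> b)))"
    using r by (simp add: pairing_assoc del: comp_assoc)
  also have "\<dots> = q \<bullet> (i \<star> (b \<bullet> m \<bullet> (b \<star> b)))"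
    by (simp only: b_rules)
  also have "\<dots> = q \<bullet> (b \<star> (m \<bullet> (b \<star> b)))"
    using r by (simp add: pairing_swap del: comp_assoc)
  also have "\<dots> = q \<bullet> ((m \<bullet> (b \<star> b)) \<star> b)"
    using r by (simp add: pairing_assoc del: comp_assoc)
  also have "\<dots> = q \<bullet> ((b \<bullet> m \<bullet> (b \<star> b)) \<star> i)"
    using r by (simp add: pairing_swap [symmetric] del: comp_assoc)
  finally show "Ev (ob X) (frob_dual C X) \<bullet> ((b \<bullet> m \<bullet> (i \<star> b)) \<star> i) =
      Ev (ob X) (frob_dual C X) \<bullet> ((m \<bullet> (b \<star> b)) \<star> i)"
    by (simp only: b_rules Ev_frob_dual fst_frob_dual)
qed (use r in simp_all)

private lemma counit_b: "e \<bullet> b = e"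
proof -
  have eq: "q \<bullet> (u \<star> f) = e \<bullet> f" if "arrow f" "trg f = ob X" for f
  proof -
    have "q \<bullet> (u \<star> f) = e \<bullet> (m \<bullet> (u \<star> i)) \<bullet> f"
      using that r tens_slide(2) [of u f] by simp
    then show ?thesis
      using that r frob_rules(7) by simp
  qed
  have "e \<bullet> b = q \<bullet> (u \<star> (b \<bullet> i))"
    using r eq [of b] by simp
  also have "\<dots> = q \<bullet> ((b \<bullet> u) \<star> i)"
    using r by (intro pairing_swap) simp_all
  also have "\<dots> = e"
    using r eq [of i] b_rules(5) by simp
  finally show ?thesis .
qed

text \<open>
  The mirror image of multiplicativity. It follows from the expectation property because the
  comultiplication is \<open>(1 \<otimes> m)(coev \<otimes> 1)\<close>.
\<close>

private lemma comul_b: "(b \<star> b) \<bullet> d \<bullet> b = (b \<star> b) \<bullet> d"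
proof -
  define n where "n = d \<bullet> u"
  have [simp]: "arrow n" "src n = \<one>" "trg n = ob X \<boxtimes> ob X"
    using r by (simp_all add: n_def)
  note [simp] = r
  have d_eq: "d = (i \<star> m) \<bullet> (n \<star> i)"
  proof -
    have "(i \<star> m) \<bullet> (n \<star> i) = ((i \<star> m) \<bullet> (d \<star> i)) \<bullet> (u \<star> i)"
      by (simp add: n_def whisker)
    then show ?thesis
      unfolding frob_rules(12) using frob_rules(7) by simp
  qed
  have bn: "(b \<star> i) \<bullet> n = (i \<star> b) \<bullet> n"
  proof -
    note D = left_dual_frob_dual [OF X]
    have "transp (frob_dual C X) (frob_dual C X) b = b"
      using b by (simp add: frob_idem_def adj_def arr_eq_iff)
    then show ?thesis
      using Coev_transp [OF _ _ D D, of b] by (simp add: Coev_frob_dual n_def)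
  qed
  have "(b \<star> b) \<bullet> d \<bullet> b = (b \<star> b) \<bullet> (i \<star> m) \<bullet> ((n \<star> i) \<bullet> b)"
    by (subst d_eq) simp
  also have "(n \<star> i) \<bullet> b = (i \<star> i \<star> b) \<bullet> (n \<star> i)"
    using tens_slide [of n b] by simp
  also have "(b \<star> b) \<bullet> (i \<star> m) \<bullet> (i \<star> i \<star> b) \<bullet> (n \<star> i) = (b \<star> (b \<bullet> m \<bullet> (i \<star> b))) \<bullet> (n \<star> i)"
    by (simp add: rewrite_left [OF tens_comp] tens_comp)
  also have "\<dots> = (b \<star> (b \<bullet> m \<bullet> (b \<star> i))) \<bullet> (n \<star> i)"
    by (simp only: b_mul_left b_mul_right)
  also have "\<dots> = (i \<star> (b \<bullet> m)) \<bullet> (((b \<star> b) \<bullet> n) \<star> i)"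
    by (simp add: whisker(1) [of n "b \<star> b"] rewrite_left [OF tens_comp] tens_comp)
  also have "(b \<star> b) \<bullet> n = (b \<star> i) \<bullet> (i \<star> b) \<bullet> n"
    by (simp add: rewrite_left [OF tens_comp])
  also have "\<dots> = (b \<star> i) \<bullet> n"
    unfolding bn [symmetric] using b_rules(4) by (simp add: rewrite_left [OF tens_comp])
  also have "(i \<star> (b \<bullet> m)) \<bullet> (((b \<star> i) \<bullet> n) \<star> i) = (b \<star> b) \<bullet> (i \<star> m) \<bullet> (n \<star> i)"
    by (simp add: whisker(1) [of n "b \<star> i"] rewrite_left [OF tens_comp] tens_comp)
  finally show ?thesis
    unfolding d_eq [symmetric] .
qed

text \<open>
  A splitting \<open>k\<close>, \<open>p\<close> of \<open>b\<close> carries a Frobenius structure obtained by sandwiching the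
  structure maps of \<open>X\<close> between \<open>k\<close> and \<open>p\<close>. Its axioms can be checked after composing with the
  split monomorphism \<open>k\<close> or the split epimorphism \<open>p\<close>; the expectation property then removes the
  copies of \<open>b\<close> from the middle of a diagram.
\<close>

lemma frobenius_subalgebra_of_splitting:
  assumes P: "P \<in> Obj C" and k: "k \<in> Hom C P (ob X)" and p: "p \<in> Hom C (ob X) P"
    and pk: "p \<cdot> k = ide C P" and kp: "k \<cdot> p = mor b"
  obtains F where "ob F = P" "frobenius_subalgebra C X (F, k)" "adj C F X k = p"
proof -
  define K where "K = Arr P k (ob X)"
  define T where "T = Arr (ob X) p P"
  define F where "F = \<lparr>ob = P, mult = mor (T \<bullet> m \<bullet> (K \<star> K)), comult = mor ((T \<star> T) \<bullet> d \<bullet> K),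
    unt = mor (T \<bullet> u), counit = mor (e \<bullet> K)\<rparr>"
  note [simp] = r P
  have K_T [simp]: "src K = P" "trg K = ob X" "src T = ob X" "trg T = P" "arrow K" "arrow T"
    using k p frob_rules(1) P by (simp_all add: K_def T_def arrow_def)
  have TK: "T \<bullet> K = I P" and KT: "K \<bullet> T = b"
    using pk kp by (simp_all add: arr_eq_iff comp_def I_def K_def T_def)
  have [simp]: "ob F = P"
    by (simp add: F_def)
  have M: "Mul F = T \<bullet> m \<bullet> (K \<star> K)" and D: "Comul F = (T \<star> T) \<bullet> d \<bullet> K"
    and U: "Unit F = T \<bullet> u" and E: "Counit F = e \<bullet> K"
    by (simp_all add: F_def arr_eq_iff Mul_def Comul_def Unit_def Counit_def)
  have [simp]: "arrow (Mul F)" "arrow (Comul F)" "arrow (Unit F)" "arrow (Counit F)"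
    by (simp_all add: M D U E)
  have TKf [simp]: "T \<bullet> K \<bullet> f = f" if "arrow f" "trg f = P" for f
    using that TK rewrite_left [of T K "I P" f] by simp
  have KTf: "K \<bullet> T \<bullet> f = b \<bullet> f" if "arrow f" "trg f = ob X" for f
    using that KT rewrite_left [of K T b f] by simp
  have bK [simp]: "b \<bullet> K = K"
    using KTf [of K] TK by simp
  have Tb [simp]: "T \<bullet> b = T"
    using TKf [of T] KT by simp
  have Tbf [simp]: "T \<bullet> b \<bullet> f = T \<bullet> f" if "arrow f" "trg f = ob X" for f
    using that rewrite_left [OF Tb] by simp
  have KM: "K \<bullet> Mul F = m \<bullet> (K \<star> K)"
  proof -
    have "K \<bullet> Mul F = (b \<bullet> m \<bullet> (b \<star> b)) \<bullet> (K \<star> K)"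
      by (simp add: M KTf tens_comp)
    also have "\<dots> = m \<bullet> (K \<star> K)"
      unfolding b_rules(6) by (simp add: tens_comp)
    finally show ?thesis .
  qed
  have DT: "Comul F \<bullet> T = (T \<star> T) \<bullet> d"
  proof -
    have "Comul F \<bullet> T = (T \<star> T) \<bullet> (b \<star> b) \<bullet> d \<bullet> b"
      by (simp add: D KT rewrite_left [OF tens_comp])
    also have "\<dots> = (T \<star> T) \<bullet> d"
      unfolding comul_b by (simp add: rewrite_left [OF tens_comp])
    finally show ?thesis .
  qed
  have KU: "K \<bullet> Unit F = u"
    using b_rules(5) by (simp add: U KTf)
  have ET: "Counit F \<bullet> T = e"
    by (simp add: E KT counit_b)
  have MT1: "Mul F \<bullet> (T \<star> I P) = T \<bullet> m \<bullet> (i \<star> K)"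
  proof -
    have "Mul F \<bullet> (T \<star> I P) = T \<bullet> (m \<bullet> (b \<star> b)) \<bullet> (i \<star> K)"
      by (simp add: M KT tens_comp)
    also have "\<dots> = T \<bullet> m \<bullet> (i \<star> K)"
      unfolding b_mul_right [symmetric] by (simp add: tens_comp)
    finally show ?thesis .
  qed
  have MT2: "Mul F \<bullet> (I P \<star> T) = T \<bullet> m \<bullet> (K \<star> i)"
  proof -
    have "Mul F \<bullet> (I P \<star> T) = T \<bullet> (m \<bullet> (b \<star> b)) \<bullet> (K \<star> i)"
      by (simp add: M KT tens_comp)
    also have "\<dots> = T \<bullet> m \<bullet> (K \<star> i)"
      unfolding b_mul_left [symmetric] by (simp add: tens_comp)
    finally show ?thesis .
  qed
  have assoc: "Mul F \<bullet> (Mul F \<star> I P) = Mul F \<bullet> (I P \<star> Mul F)"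
  proof (rule split_mono_cancel [OF TK])
    have "K \<bullet> Mul F \<bullet> (Mul F \<star> I P) = m \<bullet> (K \<star> K) \<bullet> (Mul F \<star> I P)"
      using KM by (intro rewrite_left') simp_all
    also have "\<dots> = (m \<bullet> (m \<star> i)) \<bullet> (K \<star> K \<star> K)"
      by (simp add: tens_comp KM flip: tens_assoc)
    also have "\<dots> = m \<bullet> (K \<star> K) \<bullet> (I P \<star> Mul F)"
      unfolding frob_rules(6) by (simp add: tens_comp KM)
    also have "\<dots> = K \<bullet> Mul F \<bullet> (I P \<star> Mul F)"
      using KM by (intro rewrite_left' [symmetric]) simp_all
    finally show "K \<bullet> Mul F \<bullet> (Mul F \<star> I P) = K \<bullet> Mul F \<bullet> (I P \<star> Mul F)" .
  qed simp_all
  have unit_left: "Mul F \<bullet> (Unit F \<star> I P) = I P"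
  proof (rule split_mono_cancel [OF TK])
    have "K \<bullet> Mul F \<bullet> (Unit F \<star> I P) = m \<bullet> (K \<star> K) \<bullet> (Unit F \<star> I P)"
      using KM by (intro rewrite_left') simp_all
    also have "\<dots> = (m \<bullet> (u \<star> i)) \<bullet> K"
      using tens_slide [of u K] by (simp add: tens_comp KU)
    finally show "K \<bullet> Mul F \<bullet> (Unit F \<star> I P) = K \<bullet> I P"
      unfolding frob_rules(7) by simp
  qed simp_all
  have unit_right: "Mul F \<bullet> (I P \<star> Unit F) = I P"
  proof (rule split_mono_cancel [OF TK])
    have "K \<bullet> Mul F \<bullet> (I P \<star> Unit F) = m \<bullet> (K \<star> K) \<bullet> (I P \<star> Unit F)"
      using KM by (intro rewrite_left') simp_all
    also have "\<dots> = (m \<bullet> (i \<star> u)) \<bullet> K"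
      using tens_slide [of K u] by (simp add: tens_comp KU)
    finally show "K \<bullet> Mul F \<bullet> (I P \<star> Unit F) = K \<bullet> I P"
      unfolding frob_rules(8) by simp
  qed simp_all
  have coassoc: "(Comul F \<star> I P) \<bullet> Comul F = (I P \<star> Comul F) \<bullet> Comul F"
  proof (rule split_epi_cancel [OF TK])
    have "((Comul F \<star> I P) \<bullet> Comul F) \<bullet> T = (((T \<star> T) \<bullet> d) \<star> T) \<bullet> d"
      by (simp add: DT rewrite_left [OF tens_comp])
    also have "\<dots> = (T \<star> T \<star> T) \<bullet> (d \<star> i) \<bullet> d"
      by (simp add: rewrite_left [OF tens_comp] flip: tens_assoc)
    also have "\<dots> = ((I P \<star> Comul F) \<bullet> Comul F) \<bullet> T"
      unfolding frob_rules(9) by (simp add: DT rewrite_left [OF tens_comp])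
    finally show "((Comul F \<star> I P) \<bullet> Comul F) \<bullet> T = ((I P \<star> Comul F) \<bullet> Comul F) \<bullet> T" .
  qed simp_all
  have counit_left: "(Counit F \<star> I P) \<bullet> Comul F = I P"
  proof (rule split_epi_cancel [OF TK])
    have "((Counit F \<star> I P) \<bullet> Comul F) \<bullet> T = (e \<star> T) \<bullet> d"
      by (simp add: DT ET rewrite_left [OF tens_comp])
    also have "\<dots> = T \<bullet> (e \<star> i) \<bullet> d"
      using tens_slide [of e T] by (simp flip: comp_assoc)
    finally show "((Counit F \<star> I P) \<bullet> Comul F) \<bullet> T = I P \<bullet> T"
      unfolding frob_rules(10) by simp
  qed simp_all
  have counit_right: "(I P \<star> Counit F) \<bullet> Comul F = I P"
  proof (rule split_epi_cancel [OF TK])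
    have "((I P \<star> Counit F) \<bullet> Comul F) \<bullet> T = (T \<star> e) \<bullet> d"
      by (simp add: DT ET rewrite_left [OF tens_comp])
    also have "\<dots> = T \<bullet> (i \<star> e) \<bullet> d"
      using tens_slide [of T e] by (simp flip: comp_assoc)
    finally show "((I P \<star> Counit F) \<bullet> Comul F) \<bullet> T = I P \<bullet> T"
      unfolding frob_rules(11) by simp
  qed simp_all
  have frob1: "(I P \<star> Mul F) \<bullet> (Comul F \<star> I P) = Comul F \<bullet> Mul F"
  proof (rule split_epi_cancel [of "T \<star> I P" "K \<star> I P"])
    have "((I P \<star> Mul F) \<bullet> (Comul F \<star> I P)) \<bullet> (T \<star> I P) =
        (I P \<star> Mul F) \<bullet> (((T \<star> T) \<bullet> d) \<star> I P)"
      by (simp add: tens_comp DT)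
    also have "\<dots> = (T \<star> (Mul F \<bullet> (T \<star> I P))) \<bullet> (d \<star> I P)"
      by (simp add: whisker(1) [of d "T \<star> T"] rewrite_left [OF tens_comp])
    also have "\<dots> = (T \<star> T) \<bullet> (i \<star> m) \<bullet> ((i \<star> i \<star> K) \<bullet> (d \<star> I P))"
      unfolding MT1 by (simp add: rewrite_left [OF tens_comp] tens_comp)
    also have "(i \<star> i \<star> K) \<bullet> (d \<star> I P) = (d \<star> i) \<bullet> (i \<star> K)"
      using tens_slide [of d K] by simp
    also have "(T \<star> T) \<bullet> (i \<star> m) \<bullet> (d \<star> i) \<bullet> (i \<star> K) = (T \<star> T) \<bullet> d \<bullet> m \<bullet> (i \<star> K)"
      by (simp add: rewrite_left [OF frob_rules(12)])
    also have "\<dots> = (Comul F \<bullet> Mul F) \<bullet> (T \<star> I P)"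
      by (simp add: MT1 rewrite_left [OF DT])
    finally show "((I P \<star> Mul F) \<bullet> (Comul F \<star> I P)) \<bullet> (T \<star> I P) =
        (Comul F \<bullet> Mul F) \<bullet> (T \<star> I P)" .
  qed (simp_all add: tens_comp TK)
  have frob2: "(Mul F \<star> I P) \<bullet> (I P \<star> Comul F) = Comul F \<bullet> Mul F"
  proof (rule split_epi_cancel [of "I P \<star> T" "I P \<star> K"])
    have "((Mul F \<star> I P) \<bullet> (I P \<star> Comul F)) \<bullet> (I P \<star> T) =
        (Mul F \<star> I P) \<bullet> (I P \<star> ((T \<star> T) \<bullet> d))"
      by (simp add: tens_comp DT)
    also have "\<dots> = ((Mul F \<bullet> (I P \<star> T)) \<star> T) \<bullet> (I P \<star> d)"
      by (simp add: whisker(2) [of d "T \<star> T"] rewrite_left [OF tens_comp] flip: tens_assoc)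
    also have "\<dots> = (T \<star> T) \<bullet> (m \<star> i) \<bullet> (((K \<star> i) \<star> i) \<bullet> (I P \<star> d))"
      unfolding MT2 by (simp add: rewrite_left [OF tens_comp] tens_comp del: tens_assoc)
    also have "((K \<star> i) \<star> i) \<bullet> (I P \<star> d) = (i \<star> d) \<bullet> (K \<star> i)"
      using tens_slide [of K d] by simp
    also have "(T \<star> T) \<bullet> (m \<star> i) \<bullet> (i \<star> d) \<bullet> (K \<star> i) = (T \<star> T) \<bullet> d \<bullet> m \<bullet> (K \<star> i)"
      by (simp add: rewrite_left [OF frob_rules(13)])
    also have "\<dots> = (Comul F \<bullet> Mul F) \<bullet> (I P \<star> T)"
      by (simp add: MT2 rewrite_left [OF DT])
    finally show "((Mul F \<star> I P) \<bullet> (I P \<star> Comul F)) \<bullet> (I P \<star> T) =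
        (Comul F \<bullet> Mul F) \<bullet> (I P \<star> T)" .
  qed (simp_all add: tens_comp TK)
  have F: "frobenius_algebra C F"
    unfolding frobenius_algebra_iff
    using assoc unit_left unit_right coassoc counit_left counit_right frob1 frob2 by simp

  note DF = left_dual_frob_dual [OF F, unfolded \<open>ob F = P\<close>] and DX = left_dual_frob_dual [OF X]
  have "transp (frob_dual C F) (frob_dual C X) K = T"
  proof (rule transp_eqI [OF P _ DF DX])
    show "Ev (ob X) (frob_dual C X) \<bullet> (I (fst (frob_dual C X)) \<star> K) =
        Ev P (frob_dual C F) \<bullet> (T \<star> I P)"
      using Ev_frob_dual [of F] by (simp add: Ev_frob_dual MT1 rewrite_left [OF ET])
  qed simp_all
  then have adj_k: "adj C F X k = p"
    by (simp add: adj_def transp_def K_def T_def)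
  have "transp (frob_dual C X) (frob_dual C F) T = K"
  proof (rule transp_eqI [OF _ P DX DF])
    show "Ev P (frob_dual C F) \<bullet> (I (fst (frob_dual C F)) \<star> T) =
        Ev (ob X) (frob_dual C X) \<bullet> (K \<star> i)"
      using Ev_frob_dual [of F] by (simp add: Ev_frob_dual MT2 rewrite_left [OF ET])
  qed simp_all
  then have adj_p: "adj C X F p = k"
    by (simp add: adj_def transp_def K_def T_def)
  have "monic C P (ob X) k"
    unfolding monic_def
  proof (intro conjI ballI impI k)
    fix W g h
    assume W: "W \<in> Obj C" "g \<in> Hom C W P" "h \<in> Hom C W P" and eq: "k \<cdot> g = k \<cdot> h"
    have "Arr W g P = Arr W h P"
    proof (rule split_mono_cancel [OF TK])
      show "K \<bullet> Arr W g P = K \<bullet> Arr W h P"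
        using eq by (simp add: comp_def K_def)
    qed (simp_all add: arrow_Arr W)
    then show "g = h"
      by simp
  qed
  then have "algebra_mono C F X k"
    using KM KU by (simp add: algebra_mono_def arr_eq_iff comp_def tens_def K_def Mul_def Unit_def)
  then have "frobenius_subalgebra C X (F, k)"
    using F adj_k adj_p pk by simp
  then show thesis
    using that [of F] adj_k \<open>ob F = P\<close> by blast
qed

end

text \<open>
  Each property of \<open>b = i i\<^sup>*\<close> comes from one of \<open>i\<close>: idempotence from \<open>i\<^sup>* i = 1\<close>, self-duality from
  \<open>i\<^sup>*\<^sup>* = i\<close>, and the two closure properties from \<open>i\<close> being a unital algebra morphism.
\<close>

lemma frob_idem_sub_idem:
  assumes X: "frobenius_algebra C X" and A: "frobenius_subalgebra C X (A, i)"
  shows "frob_idem X (sub_idem C X (A, i))"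
proof -
  have FA: "frobenius_algebra C A" and mono: "algebra_mono C A X i"
    and ii: "adj C X A (adj C A X i) = i" "adj C A X i \<cdot> i = ide C (ob A)"
    using A by simp_all
  note DA = left_dual_frob_dual [OF FA] and DX = left_dual_frob_dual [OF X]
  have [simp]: "ob A \<in> Obj C" "arrow (Mul A)" "arrow (Counit A)" "arrow (Unit A)"
    "ob X \<in> Obj C" "arrow (Mul X)" "arrow (Counit X)" "arrow (Unit X)"
    using FA X by (simp_all add: frobenius_algebra_iff)
  define J where "J = Arr (ob A) i (ob X)"
  define T where "T = transp (frob_dual C A) (frob_dual C X) J"
  have [simp]: "src J = ob A" "trg J = ob X" "src T = ob X" "trg T = ob A"
    by (simp_all add: J_def T_def)
  have J: "arrow J"
    using mono by (simp add: J_def arrow_Arr algebra_mono_def monic_def)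
  note [simp] = J
  have [simp]: "arrow T"
    unfolding T_def using arrow_transp [OF _ _ DA DX J] by simp
  have morT: "mor T = adj C A X i"
    by (simp add: T_def adj_def J_def)
  have TK: "T \<bullet> J = I (ob A)"
    using ii(2) by (simp add: arr_eq_iff comp_def I_def morT J_def)
  have transpT: "transp (frob_dual C X) (frob_dual C A) T = J"
    using ii(1) morT by (simp add: J_def arr_eq_iff adj_def)
  have JM: "J \<bullet> Mul A = Mul X \<bullet> (J \<star> J)" and JU: "J \<bullet> Unit A = Unit X"
    using mono by (simp_all add: algebra_mono_def arr_eq_iff comp_def tens_def J_def Mul_def Unit_def)
  have TJf [simp]: "T \<bullet> J \<bullet> f = f" if "arrow f" "trg f = ob A" for f
    using that TK rewrite_left [of T J "I (ob A)" f] by simp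
  define b where "b = J \<bullet> T"
  have [simp]: "arrow b" "src b = ob X" "trg b = ob X"
    by (simp_all add: b_def)
  have bU: "b \<bullet> Unit X = Unit X"
    unfolding JU [symmetric] by (simp add: b_def)
  have bM: "b \<bullet> Mul X \<bullet> (b \<star> b) = Mul X \<bullet> (b \<star> b)"
  proof -
    have "Mul X \<bullet> (b \<star> b) = (Mul X \<bullet> (J \<star> J)) \<bullet> (T \<star> T)"
      by (simp add: b_def tens_comp)
    then have eq: "Mul X \<bullet> (b \<star> b) = J \<bullet> Mul A \<bullet> (T \<star> T)"
      unfolding JM [symmetric] by simp
    show ?thesis
      unfolding eq by (simp add: b_def)
  qed
  \<comment> \<open>Passing first \<open>i\<close> and then \<open>i\<^sup>*\<close> across the pairings gives \<open>(i i\<^sup>*)\<^sup>* = i i\<^sup>*\<close>.\<close>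
  have 1: "(Counit X \<bullet> Mul X) \<bullet> (I (ob X) \<star> J) = (Counit A \<bullet> Mul A) \<bullet> (T \<star> I (ob A))"
    using Ev_transp [OF _ _ DA DX J] by (simp add: Ev_frob_dual T_def)
  have 2: "(Counit A \<bullet> Mul A) \<bullet> (I (ob A) \<star> T) = (Counit X \<bullet> Mul X) \<bullet> (J \<star> I (ob X))"
    using Ev_transp [OF _ _ DX DA \<open>arrow T\<close>] by (simp add: Ev_frob_dual transpT)
  have "(Counit X \<bullet> Mul X) \<bullet> (I (ob X) \<star> b) =
      ((Counit X \<bullet> Mul X) \<bullet> (I (ob X) \<star> J)) \<bullet> (I (ob X) \<star> T)"
    by (simp add: b_def whisker)
  also have "\<dots> = ((Counit A \<bullet> Mul A) \<bullet> (I (ob A) \<star> T)) \<bullet> (T \<star> I (ob X))"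
    unfolding 1 by (simp add: tens_comp)
  also have "\<dots> = (Counit X \<bullet> Mul X) \<bullet> (b \<star> I (ob X))"
    unfolding 2 by (simp add: b_def whisker)
  finally have "frob_idem X (mor b)"
    using bU bM by (simp add: frob_idem_iff [OF X] b_def)
  then show ?thesis
    by (simp add: b_def comp_def morT J_def)
qed

end

section \<open>Schur's lemma and semisimple decompositions\<close>

context linear_category
begin

lemma zero_in_Hom [simp]: "X \<in> Obj C \<Longrightarrow> Y \<in> Obj C \<Longrightarrow> 0 \<in> Hom C X Y"
  by (simp add: Hom_subspace subspace_0)

lemma cmp_zero_right:
  "X \<in> Obj C \<Longrightarrow> Y \<in> Obj C \<Longrightarrow> g \<in> Hom C X Y \<Longrightarrow> g \<cdot> 0 = 0"
  using cmp_add_right [of X X Y 0 0 g] by simp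

lemma cmp_zero_left:
  "X \<in> Obj C \<Longrightarrow> Y \<in> Obj C \<Longrightarrow> f \<in> Hom C X Y \<Longrightarrow> 0 \<cdot> f = 0"
  using cmp_add_left [of X Y Y f 0 0] by simp

lemma cmp_diff_right:
  assumes "X \<in> Obj C" "Y \<in> Obj C" "Z \<in> Obj C" "f \<in> Hom C X Y" "f' \<in> Hom C X Y" "g \<in> Hom C Y Z"
  shows "g \<cdot> (f - f') = g \<cdot> f - g \<cdot> f'"
proof -
  have "f - f' \<in> Hom C X Y"
    using assms by (simp add: Hom_subspace subspace_diff)
  then show ?thesis
    using cmp_add_right [of X Y Z "f - f'" f' g] assms by (simp add: algebra_simps)
qed

lemma cmp_diff_left:
  assumes "X \<in> Obj C" "Y \<in> Obj C" "Z \<in> Obj C" "f \<in> Hom C X Y" "g \<in> Hom C Y Z" "g' \<in> Hom C Y Z"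
  shows "(g - g') \<cdot> f = g \<cdot> f - g' \<cdot> f"
proof -
  have "g - g' \<in> Hom C Y Z"
    using assms by (simp add: Hom_subspace subspace_diff)
  then show ?thesis
    using cmp_add_left [of X Y Z f "g - g'" g'] assms by (simp add: algebra_simps)
qed

lemma cmp_sum_right:
  assumes "X \<in> Obj C" "Y \<in> Obj C" "Z \<in> Obj C" "g \<in> Hom C Y Z" "\<And>a. a \<in> A \<Longrightarrow> f a \<in> Hom C X Y"
  shows "g \<cdot> (\<Sum>a\<in>A. f a) = (\<Sum>a\<in>A. g \<cdot> f a)"
  using assms(5)
proof (induction A rule: infinite_finite_induct)
  case (insert a A)
  then have "(\<Sum>a\<in>A. f a) \<in> Hom C X Y"
    using assms by (simp add: Hom_subspace subspace_sum)
  then show ?case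
    using insert assms by (simp add: cmp_add_right [of X Y Z])
qed (use assms in \<open>simp_all add: cmp_zero_right [of Y Z]\<close>)

lemma cmp_sum_left:
  assumes "X \<in> Obj C" "Y \<in> Obj C" "Z \<in> Obj C" "f \<in> Hom C X Y" "\<And>a. a \<in> A \<Longrightarrow> g a \<in> Hom C Y Z"
  shows "(\<Sum>a\<in>A. g a) \<cdot> f = (\<Sum>a\<in>A. g a \<cdot> f)"
  using assms(5)
proof (induction A rule: infinite_finite_induct)
  case (insert a A)
  then have "(\<Sum>a\<in>A. g a) \<in> Hom C Y Z"
    using assms by (simp add: Hom_subspace subspace_sum)
  then show ?case
    using insert assms by (simp add: cmp_add_left [of X Y Z])
qed (use assms in \<open>simp_all add: cmp_zero_left [of X Y]\<close>)

lemma zero_object_arrows: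
  assumes "zero_object C Z" "X \<in> Obj C" "f \<in> Hom C Z X"
  shows "f = 0"
proof -
  have "ide C Z = 0" "Z \<in> Obj C"
    using assms(1) ide_in_Hom [of Z] by (auto simp: zero_object_def)
  then show ?thesis
    using assms cmp_ide [of Z X f] cmp_zero_right [of Z X f] by simp
qed

lemma simple_ide_nonzero:
  assumes "simple_object C S"
  shows "ide C S \<noteq> 0"
proof
  assume 0: "ide C S = 0"
  have S: "S \<in> Obj C"
    using assms by (simp add: simple_object_def)
  have "f = 0" if "f \<in> Hom C S S" for f
    using that S 0 cmp_ide [of S S f] cmp_zero_right [of S S f] by simp
  then show False
    using assms S by (auto simp: simple_object_def zero_object_def)
qed

lemma iso_arrow_inverse:
  assumes "iso_arrow C X Y f"
  obtains g where "g \<in> Hom C Y X" "g \<cdot> f = ide C X" "f \<cdot> g = ide C Y"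
  using assms by (auto simp: iso_arrow_def)

lemma iso_arrow_cancel:
  assumes "iso_arrow C X Y f" "X \<in> Obj C" "Y \<in> Obj C" "W \<in> Obj C" "h \<in> Hom C W X" "f \<cdot> h = 0"
  shows "h = 0"
proof -
  obtain g where g: "g \<in> Hom C Y X" "g \<cdot> f = ide C X"
    using assms(1) by (rule iso_arrow_inverse)
  have "f \<in> Hom C X Y"
    using assms(1) by (simp add: iso_arrow_def)
  then have "h = g \<cdot> (f \<cdot> h)"
    using g assms cmp_assoc [of W X Y X h f g] ide_cmp [of W X h] by simp
  then show ?thesis
    using assms g by (simp add: cmp_zero_right [of Y X])
qed

lemma iso_arrow_cmp:
  assumes "iso_arrow C X Y f" "iso_arrow C Y Z g" "X \<in> Obj C" "Y \<in> Obj C" "Z \<in> Obj C"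
  shows "iso_arrow C X Z (g \<cdot> f)"
proof -
  obtain f' g' where *: "f' \<in> Hom C Y X" "f' \<cdot> f = ide C X" "f \<cdot> f' = ide C Y"
    "g' \<in> Hom C Z Y" "g' \<cdot> g = ide C Y" "g \<cdot> g' = ide C Z"
    using assms(1,2) by (auto simp: iso_arrow_def)
  have fg: "f \<in> Hom C X Y" "g \<in> Hom C Y Z"
    using assms(1,2) by (auto simp: iso_arrow_def)
  have [simp]: "g \<cdot> f \<in> Hom C X Z" "f' \<cdot> g' \<in> Hom C Z X"
    using cmp_in_Hom [of X Y Z f g] cmp_in_Hom [of Z Y X g' f'] assms * fg by simp_all
  have "(f' \<cdot> g') \<cdot> (g \<cdot> f) = f' \<cdot> ((g' \<cdot> g) \<cdot> f)"
    using * fg assms cmp_assoc [of X Z Y X "g \<cdot> f" g' f'] cmp_assoc [of X Y Z Y f g g'] by simp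
  then have "(f' \<cdot> g') \<cdot> (g \<cdot> f) = ide C X"
    using * fg assms ide_cmp [of X Y f] by simp
  moreover have "(g \<cdot> f) \<cdot> (f' \<cdot> g') = g \<cdot> ((f \<cdot> f') \<cdot> g')"
    using * fg assms cmp_assoc [of Z X Y Z "f' \<cdot> g'" f g] cmp_assoc [of Z Y X Y g' f' f] by simp
  then have "(g \<cdot> f) \<cdot> (f' \<cdot> g') = ide C Z"
    using * fg assms ide_cmp [of Z Y g'] by simp
  ultimately show ?thesis
    by (auto simp: iso_arrow_def)
qed

lemma kernel_monic:
  assumes "is_kernel C X Y f K k" "X \<in> Obj C" "Y \<in> Obj C" "f \<in> Hom C X Y"
  shows "monic C K X k"
  unfolding monic_def
proof (intro conjI ballI impI)
  show k: "k \<in> Hom C K X"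
    using assms(1) by (simp add: is_kernel_def)
  have K: "K \<in> Obj C"
    using assms(1) by (simp add: is_kernel_def)
  fix W g h
  assume W: "W \<in> Obj C" "g \<in> Hom C W K" "h \<in> Hom C W K" and eq: "k \<cdot> g = k \<cdot> h"
  have "k \<cdot> g \<in> Hom C W X"
    using W K k assms by (blast intro: cmp_in_Hom)
  moreover have "f \<cdot> (k \<cdot> g) = (f \<cdot> k) \<cdot> g"
    using W K k assms cmp_assoc [of W K X Y g k f] by simp
  then have "f \<cdot> (k \<cdot> g) = 0"
    using assms(1) W K by (simp add: is_kernel_def cmp_zero_left [of W K])
  ultimately have "\<exists>!l. l \<in> Hom C W K \<and> k \<cdot> l = k \<cdot> g"
    using assms(1) W by (simp add: is_kernel_def)
  then show "g = h"
    using W eq by metis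
qed

lemma cokernel_of_zero_iso:
  assumes "is_cokernel C X Y 0 Q q" "X \<in> Obj C" "Y \<in> Obj C"
  shows "iso_arrow C Y Q q"
proof -
  have Q: "Q \<in> Obj C" "q \<in> Hom C Y Q"
    and univ: "\<And>W h. W \<in> Obj C \<Longrightarrow> h \<in> Hom C Y W \<Longrightarrow> \<exists>!l. l \<in> Hom C Q W \<and> l \<cdot> q = h"
    using assms by (auto simp: is_cokernel_def cmp_zero_right)
  obtain l where l: "l \<in> Hom C Q Y" "l \<cdot> q = ide C Y"
    using univ [of Y "ide C Y"] assms ide_in_Hom by blast
  have "(q \<cdot> l) \<cdot> q = q"
    using l Q assms cmp_assoc [of Y Q Y Q q l q] cmp_ide by simp
  moreover have "ide C Q \<cdot> q = q"
    using Q assms ide_cmp by blast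
  moreover have "q \<cdot> l \<in> Hom C Q Q" "ide C Q \<in> Hom C Q Q"
    using Q l assms ide_in_Hom cmp_in_Hom [of Q Y Q l q] by auto
  ultimately have "q \<cdot> l = ide C Q"
    using univ [of Q q] Q by blast
  then show ?thesis
    using l Q by (auto simp: iso_arrow_def)
qed

end

text \<open>
  The image of \<open>f\<close> is a subobject of \<open>T\<close> and its kernel a subobject of \<open>S\<close>. If \<open>f \<noteq> 0\<close>, simplicity
  leaves only a full image and a zero kernel.
\<close>

lemma (in abelian_linear_category) schur_zero_or_iso:
  assumes S: "simple_object C S" and T: "simple_object C T" and f: "f \<in> Hom C S T"
  shows "f = 0 \<or> iso_arrow C S T f"
proof (rule disjCI)
  assume not_iso: "\<not> iso_arrow C S T f"
  have ST: "S \<in> Obj C" "T \<in> Obj C"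
    using S T by (simp_all add: simple_object_def)
  obtain K k J i j Q q where ij: "i \<in> Hom C S J" "j \<in> Hom C J T" "j \<cdot> i = f"
    and k: "is_kernel C S T f K k" and q: "is_cokernel C S T f Q q"
    and i: "is_cokernel C K S k J i" and j: "is_kernel C T Q q J j"
    using ex_canonical_decomposition [OF ST f] by blast
  have obs: "K \<in> Obj C" "J \<in> Obj C" "Q \<in> Obj C" "k \<in> Hom C K S" "q \<in> Hom C T Q" "f \<cdot> k = 0"
    using k q i by (simp_all add: is_kernel_def is_cokernel_def)
  have "zero_object C J \<or> iso_arrow C J T j"
    using kernel_monic [OF j] obs ST T by (auto simp: simple_object_def)
  moreover have "zero_object C K \<or> iso_arrow C K S k"
    using kernel_monic [OF k] obs ST S f by (auto simp: simple_object_def)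
  ultimately consider "zero_object C J" | "iso_arrow C K S k"
    | "zero_object C K" "iso_arrow C J T j"
    by blast
  then show "f = 0"
  proof cases
    case 1
    then have "j = 0"
      using zero_object_arrows ST ij by blast
    then show ?thesis
      using ij ST obs cmp_zero_left [of S J i] by simp
  next
    case 2
    then obtain k' where k': "k' \<in> Hom C S K" "k \<cdot> k' = ide C S"
      by (rule iso_arrow_inverse)
    then have "f = (f \<cdot> k) \<cdot> k'"
      using cmp_assoc [of S K S T k' k f] cmp_ide [of S T f] ST obs f by simp
    then show ?thesis
      using obs k' ST cmp_zero_left [of S K k'] by simp
  next
    case 3
    then have "k = 0"
      using zero_object_arrows ST obs by blast
    then have "iso_arrow C S J i"
      using cokernel_of_zero_iso i obs ST by blast
    then show ?thesis
      using 3 iso_arrow_cmp [of S J i T j] obs ST ij not_iso by simp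
  qed
qed

context semisimple_tensor_category
begin

text \<open>
  The powers of \<open>f\<close> in the finite-dimensional space \<open>End(S)\<close> are dependent, so \<open>p(f) = 0\<close> for
  some polynomial \<open>p \<noteq> 0\<close>. For a root \<open>z\<close> of \<open>p\<close> the factor \<open>f - z\<close> is either zero, as wanted, or
  invertible, and then it can be cancelled.
\<close>

lemma schur_scalar:
  assumes S: "simple_object C S" and f: "f \<in> Hom C S S"
  shows "\<exists>c. f = scl C c (ide C S)"
proof -
  have [simp]: "S \<in> Obj C"
    using S by (simp add: simple_object_def)
  have sub: "subspace (Hom C S S)"
    by (simp add: Hom_subspace)
  obtain B where B: "finite B" "span B = Hom C S S"
    using Hom_finite_dim [of S S] \<open>S \<in> Obj C\<close> by blast
  define N where "N = Suc (card B)"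
  define pow where "pow n = ((\<lambda>x. f \<cdot> x) ^^ n) (ide C S)" for n
  have pow [simp]: "pow n \<in> Hom C S S" for n
    by (induction n) (simp_all add: pow_def ide_in_Hom cmp_in_Hom [of S S S] f)
  have pow_Suc: "f \<cdot> pow n = pow (Suc n)" for n
    by (simp add: pow_def)
  define ev where "ev p = (\<Sum>n<N. scl C (coeff p n) (pow n))" for p
  have ev [simp]: "ev p \<in> Hom C S S" for p
    unfolding ev_def by (intro subspace_sum subspace_scale sub pow)
  have ev_factor: "ev ([:-z, 1:] * p) = (f - scl C z (ide C S)) \<cdot> ev p" if "Suc (degree p) < N" for z p
  proof -
    have "f \<cdot> ev p = (\<Sum>n<N. scl C (coeff p n) (pow (Suc n)))"
      unfolding ev_def using cmp_sum_right [of S S S f "{..<N}" "\<lambda>n. scl C (coeff p n) (pow n)"]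
      by (simp add: f cmp_scl_right [of S S S] pow_Suc subspace_scale [OF sub])
    also have "\<dots> = (\<Sum>n<Suc N. scl C (coeff (pCons 0 p) n) (pow n))"
      by (simp only: sum.lessThan_Suc_shift) simp
    also have "\<dots> = ev (pCons 0 p)"
      using that by (simp add: ev_def coeff_pCons coeff_eq_0 split: nat.split)
    finally have "f \<cdot> ev p = ev (pCons 0 p)" .
    moreover have "scl C z (ide C S) \<cdot> ev p = scl C z (ev p)"
      using cmp_scl_left [of S S S "ev p" "ide C S" z] ide_cmp [of S S "ev p"] ide_in_Hom [of S] by simp
    ultimately have "(f - scl C z (ide C S)) \<cdot> ev p = ev (pCons 0 p) - scl C z (ev p)"
      using cmp_diff_left [of S S S "ev p" f "scl C z (ide C S)"]
      by (simp add: f ide_in_Hom subspace_scale [OF sub])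
    also have "\<dots> = ev ([:-z, 1:] * p)"
      by (simp add: ev_def scale_sum_right sum_subtractf [symmetric] scale_left_diff_distrib)
    finally show ?thesis ..
  qed
  have *: "\<exists>c. f = scl C c (ide C S)" if "p \<noteq> 0" "degree p < N" "ev p = 0" for p
    using that
  proof (induction "degree p" arbitrary: p rule: less_induct)
    case less
    show ?case
    proof (cases "degree p = 0")
      case True
      then obtain a where p: "p = [:a:]"
        by (rule degree_eq_zeroE)
      have "ev p = (\<Sum>n<N. if n = 0 then scl C a (ide C S) else 0)"
        unfolding ev_def p by (intro sum.cong) (auto simp: pow_def coeff_pCons split: nat.split)
      then have "scl C a (ide C S) = 0"
        using less.prems by (simp add: N_def split: if_splits)
      then show ?thesis
        using less.prems p simple_ide_nonzero [OF S] by simp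
    next
      case False
      then obtain z where "poly p z = 0"
        using fundamental_theorem_of_algebra [of p] by (auto simp: constant_degree)
      then obtain q where p: "p = [:-z, 1:] * q"
        by (auto simp: poly_eq_0_iff_dvd)
      then have "q \<noteq> 0"
        using less.prems(1) by auto
      then have deg: "degree p = Suc (degree q)"
        unfolding p by (subst degree_mult_eq) simp_all
      define g where "g = f - scl C z (ide C S)"
      have g: "g \<in> Hom C S S"
        unfolding g_def by (intro subspace_diff subspace_scale sub f ide_in_Hom) simp
      have "g \<cdot> ev q = 0"
        using ev_factor [of q z] less.prems deg p by (simp add: g_def)
      then have "g = 0 \<or> ev q = 0"
        using schur_zero_or_iso [OF S S g] iso_arrow_cancel [of S S g S "ev q"] by auto
      then show ?thesis
        using less.hyps [of q] less.prems \<open>q \<noteq> 0\<close> deg by (auto simp: g_def)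
    qed
  qed
  obtain c where c: "\<exists>n<N. c n \<noteq> 0" "(\<Sum>n<N. scl C (c n) (pow n)) = 0"
  proof (cases "inj_on pow {..<N}")
    case True
    have "card (pow ` {..<N}) > card B"
      using True by (simp add: card_image N_def)
    then have "dependent (pow ` {..<N})"
      using independent_span_bound [OF B(1), of "pow ` {..<N}"] pow B(2) by fastforce
    then obtain v where "\<exists>x\<in>pow ` {..<N}. v x \<noteq> 0" "(\<Sum>x\<in>pow ` {..<N}. scl C (v x) x) = 0"
      by (auto simp: dependent_finite)
    then show ?thesis
      using that [of "v \<circ> pow"] True by (auto simp: sum.reindex)
  next
    case False
    then obtain a b where ab: "a < N" "b < N" "a \<noteq> b" "pow a = pow b"
      by (auto simp: inj_on_def)
    define c :: "nat \<Rightarrow> complex" where "c n = (if n = a then 1 else if n = b then -1 else 0)" for n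
    have "(\<Sum>n<N. scl C (c n) (pow n)) = (\<Sum>n\<in>{a, b}. scl C (c n) (pow n))"
      using ab by (intro sum.mono_neutral_right) (auto simp: c_def)
    then have "(\<Sum>n<N. scl C (c n) (pow n)) = 0"
      using ab by (simp add: c_def)
    moreover have "\<exists>n<N. c n \<noteq> 0"
      using ab by (auto simp: c_def)
    ultimately show ?thesis
      using that by blast
  qed
  define p where "p = (\<Sum>n<N. monom (c n) n)"
  have coeff_p: "coeff p n = (if n < N then c n else 0)" for n
    by (simp add: p_def coeff_sum if_distrib cong: if_cong)
  have "p \<noteq> 0"
    using c(1) coeff_p by (metis coeff_0)
  moreover have "degree p < N"
    using le_degree [of p N] coeff_p by (intro degree_lessI) (auto simp: N_def)
  moreover have "ev p = 0"
    using c(2) by (simp add: ev_def coeff_p)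
  ultimately show ?thesis
    by (rule *)
qed

lemma representatives_disjoint:
  assumes R: "simple_representatives C R" and "S \<in> R" "T \<in> R" and f: "f \<in> Hom C S T" "f \<noteq> 0"
  shows "S = T"
proof -
  have simple: "simple_object C S" "simple_object C T"
    using assms by (auto simp: simple_representatives_def)
  then have "S \<in> Obj C"
    by (simp add: simple_object_def)
  then have "iso_arrow C S S (ide C S)"
    using ide_in_Hom [of S] ide_cmp [of S S "ide C S"] by (auto simp: iso_arrow_def)
  then have "isomorphic C S S" "isomorphic C S T"
    using schur_zero_or_iso [OF simple f(1)] f(2) by (auto simp: isomorphic_def)
  then show ?thesis
    using R simple assms(2,3) by (auto simp: simple_representatives_def)
qed

lemma decomposition_into_representatives:
  assumes R: "simple_representatives C R" and X: "X \<in> Obj C"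
  obtains n :: nat and S i p where "\<And>k. k < n \<Longrightarrow> S k \<in> R" "\<And>k. k < n \<Longrightarrow> i k \<in> Hom C (S k) X"
    "\<And>k. k < n \<Longrightarrow> p k \<in> Hom C X (S k)" "(\<Sum>k<n. i k \<cdot> p k) = ide C X"
proof -
  obtain n :: nat and S i p where *:
    "\<And>k. k < n \<Longrightarrow> simple_object C (S k) \<and> i k \<in> Hom C (S k) X \<and> p k \<in> Hom C X (S k)"
    and sum: "(\<Sum>k<n. i k \<cdot> p k) = ide C X"
    using all_semisimple [OF X] unfolding semisimple_object_def by blast
  have "\<exists>T a b. T \<in> R \<and> a \<in> Hom C (S k) T \<and> b \<in> Hom C T (S k) \<and> b \<cdot> a = ide C (S k)" if "k < n" for k
    using R * [OF that] by (fastforce simp: simple_representatives_def isomorphic_def iso_arrow_def)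
  then obtain T a b where
    T: "\<And>k. k < n \<Longrightarrow> T k \<in> R \<and> a k \<in> Hom C (S k) (T k) \<and> b k \<in> Hom C (T k) (S k) \<and> b k \<cdot> a k = ide C (S k)"
    by metis
  have obs: "S k \<in> Obj C" "T k \<in> Obj C" if "k < n" for k
    using * T R that by (auto simp: simple_representatives_def simple_object_def)
  show thesis
  proof (rule that [of n T "\<lambda>k. i k \<cdot> b k" "\<lambda>k. a k \<cdot> p k"])
    fix k assume k: "k < n"
    show "T k \<in> R" "i k \<cdot> b k \<in> Hom C (T k) X" "a k \<cdot> p k \<in> Hom C X (T k)"
      using cmp_in_Hom [of "T k" "S k" X "b k" "i k"] cmp_in_Hom [of X "S k" "T k" "p k" "a k"]
        * T obs k X by simp_all
  next
    have "(i k \<cdot> b k) \<cdot> (a k \<cdot> p k) = i k \<cdot> p k" if k: "k < n" for k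
    proof -
      have "(i k \<cdot> b k) \<cdot> (a k \<cdot> p k) = i k \<cdot> (b k \<cdot> (a k \<cdot> p k))"
        using * T obs k X cmp_in_Hom [of X "S k" "T k" "p k" "a k"]
        by (intro cmp_assoc [of X "T k" "S k" X]) simp_all
      also have "b k \<cdot> (a k \<cdot> p k) = (b k \<cdot> a k) \<cdot> p k"
        using * T obs k X by (intro cmp_assoc [of X "S k" "T k" "S k", symmetric]) simp_all
      also have "\<dots> = p k"
        using * T obs k X ide_cmp by simp
      finally show ?thesis .
    qed
    then show "(\<Sum>k<n. (i k \<cdot> b k) \<cdot> (a k \<cdot> p k)) = ide C X"
      using sum by simp
  qed
qed

text \<open>
  Composition \<open>Hom(X,S) \<times> Hom(S,X) \<rightarrow> End(S) = \<complex>\<close> is a perfect pairing. In a decomposition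
  of \<open>X\<close> into simple objects only the summands \<open>S\<close> contribute to \<open>f = \<Sum> (f i\<^sub>k) p\<^sub>k\<close>, and the
  coefficients \<open>f i\<^sub>k\<close> are scalars, so \<open>s = \<Sum> l(p\<^sub>k) i\<^sub>k\<close> represents the functional \<open>l\<close>.
\<close>

lemma functional_represented_by_composition:
  assumes R: "simple_representatives C R" and S: "S \<in> R" and X: "X \<in> Obj C"
    and add: "\<And>f g. f \<in> Hom C X S \<Longrightarrow> g \<in> Hom C X S \<Longrightarrow> l (f + g) = l f + l g"
    and scl: "\<And>c f. f \<in> Hom C X S \<Longrightarrow> l (scl C c f) = c * l f"
  obtains s where "s \<in> Hom C S X" "\<And>f. f \<in> Hom C X S \<Longrightarrow> f \<cdot> s = scl C (l f) (ide C S)"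
proof -
  obtain n :: nat and T i p where T: "\<And>k. k < n \<Longrightarrow> T k \<in> R" "\<And>k. k < n \<Longrightarrow> i k \<in> Hom C (T k) X"
    "\<And>k. k < n \<Longrightarrow> p k \<in> Hom C X (T k)" and sum: "(\<Sum>k<n. i k \<cdot> p k) = ide C X"
    using decomposition_into_representatives [OF R X] by blast
  have simple: "simple_object C S"
    using R S by (auto simp: simple_representatives_def)
  then have So: "S \<in> Obj C"
    by (simp add: simple_object_def)
  have To: "T k \<in> Obj C" if "k < n" for k
    using T(1) R that by (auto simp: simple_representatives_def simple_object_def)
  define K where "K = {k. k < n \<and> T k = S}"
  have K: "finite K" "\<And>k. k \<in> K \<Longrightarrow> i k \<in> Hom C S X" "\<And>k. k \<in> K \<Longrightarrow> p k \<in> Hom C X S"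
    using T by (auto simp: K_def)
  have subX: "subspace (Hom C X S)" and subS: "subspace (Hom C S X)"
    using X So by (simp_all add: Hom_subspace)
  have l_sum: "l (\<Sum>k\<in>A. g k) = (\<Sum>k\<in>A. l (g k))" if "\<And>k. k \<in> A \<Longrightarrow> g k \<in> Hom C X S" for A :: "nat set" and g
  proof -
    have l0: "l 0 = 0"
      using scl [of 0 0] subspace_0 [OF subX] by simp
    show ?thesis
      using that
    proof (induction A rule: infinite_finite_induct)
      case (insert a A)
      then show ?case
        using add [of "g a" "\<Sum>k\<in>A. g k"] by (simp add: subspace_sum [OF subX])
    qed (simp_all add: l0)
  qed
  define s where "s = (\<Sum>k\<in>K. scl C (l (p k)) (i k))"
  have s: "s \<in> Hom C S X"
    unfolding s_def by (intro subspace_sum subspace_scale subS K)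
  have "f \<cdot> s = scl C (l f) (ide C S)" if f: "f \<in> Hom C X S" for f
  proof -
    have fi: "f \<cdot> i k \<in> Hom C (T k) S" if "k < n" for k
      using cmp_in_Hom [of "T k" X S "i k" f] that T To X So f by simp
    then have "\<exists>c. f \<cdot> i k = scl C c (ide C S)" if "k \<in> K" for k
      using schur_scalar [OF simple, of "f \<cdot> i k"] that by (auto simp: K_def)
    then obtain c where c: "\<And>k. k \<in> K \<Longrightarrow> f \<cdot> i k = scl C (c k) (ide C S)"
      by metis
    have ip: "i k \<cdot> p k \<in> Hom C X X" if "k < n" for k
      using cmp_in_Hom [of X "T k" X "p k" "i k"] that T To X by simp
    have "f = f \<cdot> (\<Sum>k<n. i k \<cdot> p k)"
      unfolding sum using cmp_ide X So f by simp
    also have "\<dots> = (\<Sum>k<n. f \<cdot> (i k \<cdot> p k))"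
      using ip X So f by (intro cmp_sum_right [of X X S]) simp_all
    also have "\<dots> = (\<Sum>k<n. (f \<cdot> i k) \<cdot> p k)"
      using T To X So f by (intro sum.cong cmp_assoc [of X "T k" X S for k, symmetric]) auto
    also have "\<dots> = (\<Sum>k\<in>K. (f \<cdot> i k) \<cdot> p k)"
    proof (intro sum.mono_neutral_right ballI)
      fix k assume k: "k \<in> {..<n} - K"
      then have "f \<cdot> i k = 0"
        using representatives_disjoint [OF R, of "T k" S "f \<cdot> i k"] T S fi by (auto simp: K_def)
      then show "(f \<cdot> i k) \<cdot> p k = 0"
        using k T To X cmp_zero_left [of X "T k" "p k"] by simp
    qed (auto simp: K_def)
    also have "\<dots> = (\<Sum>k\<in>K. scl C (c k) (p k))"
    proof (rule sum.cong [OF refl])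
      fix k assume k: "k \<in> K"
      show "(f \<cdot> i k) \<cdot> p k = scl C (c k) (p k)"
        unfolding c [OF k] using cmp_scl_left [of X S S "p k" "ide C S" "c k"] ide_cmp [of X S "p k"]
          ide_in_Hom [of S] X So K k by simp
    qed
    finally have "l f = (\<Sum>k\<in>K. c k * l (p k))"
      using l_sum [of K "\<lambda>k. scl C (c k) (p k)"] K scl by (simp add: subspace_scale [OF subX])
    moreover have "f \<cdot> s = (\<Sum>k\<in>K. f \<cdot> scl C (l (p k)) (i k))"
      unfolding s_def using K X So f by (intro cmp_sum_right [of S X S]) (auto intro: subspace_scale [OF subS])
    then have "f \<cdot> s = (\<Sum>k\<in>K. scl C (l (p k)) (f \<cdot> i k))"
      using K X So f cmp_scl_right [of S X S] by simp
    then have "f \<cdot> s = (\<Sum>k\<in>K. scl C (c k * l (p k)) (ide C S))"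
      using c by (simp add: mult.commute)
    ultimately show ?thesis
      by (simp add: scale_sum_left)
  qed
  then show thesis
    using that s by blast
qed

end

section \<open>Inner products on Hom-spaces\<close>

context linear_category
begin

text \<open>
  The form need only be controlled on \<open>V\<close>, since the Hom-spaces are subspaces of one ambient space.
\<close>

definition inner_product_on :: "'m set \<Rightarrow> ('m \<Rightarrow> 'm \<Rightarrow> complex) \<Rightarrow> bool" where
  "inner_product_on V Q \<longleftrightarrow> subspace V \<and>
    (\<forall>x\<in>V. \<forall>y\<in>V. \<forall>z\<in>V. Q (x + y) z = Q x z + Q y z) \<and>
    (\<forall>c. \<forall>x\<in>V. \<forall>y\<in>V. Q (scl C c x) y = c * Q x y) \<and>
    (\<forall>x\<in>V. \<forall>y\<in>V. Q y x = cnj (Q x y)) \<and>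
    (\<forall>x\<in>V. 0 \<le> Re (Q x x)) \<and> (\<forall>x\<in>V. Q x x = 0 \<longrightarrow> x = 0)"

lemma inner_productD:
  assumes "inner_product_on V Q"
  shows "subspace V"
    and "x \<in> V \<Longrightarrow> y \<in> V \<Longrightarrow> z \<in> V \<Longrightarrow> Q (x + y) z = Q x z + Q y z"
    and "x \<in> V \<Longrightarrow> y \<in> V \<Longrightarrow> Q (scl C c x) y = c * Q x y"
    and "x \<in> V \<Longrightarrow> y \<in> V \<Longrightarrow> Q y x = cnj (Q x y)"
    and "x \<in> V \<Longrightarrow> 0 \<le> Re (Q x x)"
    and "x \<in> V \<Longrightarrow> Q x x = 0 \<Longrightarrow> x = 0"
  using assms unfolding inner_product_on_def by blast+

lemma inner_product_rules:
  assumes Q: "inner_product_on V Q" and x: "x \<in> V" and y: "y \<in> V" and z: "z \<in> V"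
  shows "Q 0 z = 0" "Q z 0 = 0"
    and "Q (x - y) z = Q x z - Q y z"
    and "Q z (x + y) = Q z x + Q z y"
    and "Q z (x - y) = Q z x - Q z y"
    and "Q z (scl C c x) = cnj c * Q z x"
proof -
  note sub = inner_productD(1) [OF Q]
  show 0: "Q 0 z = 0"
    using inner_productD(3) [OF Q z z, of 0] by simp
  show "Q z 0 = 0"
    using inner_productD(4) [OF Q subspace_0 [OF sub] z] 0 by simp
  have xy: "x - y \<in> V" "x + y \<in> V" "scl C c x \<in> V"
    using sub x y by (auto intro: subspace_diff subspace_add subspace_scale)
  show diff: "Q (x - y) z = Q x z - Q y z"
    using inner_productD(2) [OF Q xy(1) y z] by simp
  show "Q z (x + y) = Q z x + Q z y"
    using inner_productD(2) [OF Q x y z] inner_productD(4) [OF Q _ z] x y xy by simp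
  show "Q z (x - y) = Q z x - Q z y"
    using diff inner_productD(4) [OF Q _ z] x y xy by simp
  show "Q z (scl C c x) = cnj c * Q z x"
    using inner_productD(3) [OF Q x z, of c] inner_productD(4) [OF Q _ z] x xy by simp
qed

text \<open>
  By induction on the spanning set, replacing each new element \<open>b\<close> by its component orthogonal to
  the earlier ones, as in the Gram--Schmidt process.
\<close>

lemma orthogonal_projection:
  assumes Q: "inner_product_on V Q" and "finite A" "A \<subseteq> V" "x \<in> V"
  shows "\<exists>u\<in>span A. \<forall>w\<in>span A. Q (x - u) w = 0"
  using assms(2-)
proof (induction A arbitrary: x rule: finite_induct)
  case empty
  then show ?case
    using inner_product_rules(2) [OF Q] by simp
next
  case (insert b A)
  note sub = inner_productD(1) [OF Q]
  have AV: "span A \<subseteq> V"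
    using insert.prems sub by (simp add: span_minimal)
  obtain ub where ub: "ub \<in> span A" "\<And>w. w \<in> span A \<Longrightarrow> Q (b - ub) w = 0"
    using insert.IH [of b] insert.prems by auto
  obtain ux where ux: "ux \<in> span A" "\<And>w. w \<in> span A \<Longrightarrow> Q (x - ux) w = 0"
    using insert.IH [of x] insert.prems by auto
  define b' where "b' = b - ub"
  define x' where "x' = x - ux"
  have V: "b' \<in> V" "x' \<in> V" "x \<in> V"
    using insert.prems ub(1) ux(1) AV by (auto simp: b'_def x'_def intro!: subspace_diff [OF sub])
  show ?case
  proof (cases "b' = 0")
    case True
    then have "span (insert b A) = span A"
      using ub by (simp add: b'_def span_redundant)
    then show ?thesis
      using ux by auto
  next
    case False
    then have nz: "Q b' b' \<noteq> 0"
      using inner_productD(6) [OF Q] V by blast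
    define t where "t = Q x' b' / Q b' b'"
    have in_span: "b' \<in> span (insert b A)" "ux \<in> span (insert b A)"
      using ub(1) ux(1) span_mono [OF subset_insertI [of A b]] span_base [of b "insert b A"]
      by (auto simp: b'_def intro: span_diff)
    have "Q (x - (ux + scl C t b')) w = 0" if w: "w \<in> span (insert b A)" for w
    proof -
      obtain k where k: "w - scl C k b \<in> span A"
        using w by (auto simp: span_breakdown_eq)
      define w' where "w' = w - scl C k b + scl C k ub"
      have w': "w' \<in> span A" "w' \<in> V"
        using k ub(1) AV by (auto simp: w'_def intro!: span_add span_scale)
      have w_eq: "w = w' + scl C k b'"
        by (simp add: w'_def b'_def scale_right_diff_distrib)
      have tb: "scl C t b' \<in> V" "scl C k b' \<in> V" "x' - scl C t b' \<in> V"
        using V by (auto intro!: subspace_scale subspace_diff sub)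
      have "Q (x - (ux + scl C t b')) w = Q (x' - scl C t b') (w' + scl C k b')"
        by (simp add: w_eq x'_def algebra_simps)
      also have "\<dots> = Q (x' - scl C t b') w' + cnj k * Q (x' - scl C t b') b'"
        using inner_product_rules(4) [OF Q w'(2) tb(2,3)]
          inner_product_rules(6) [OF Q V(1) V(1) tb(3), of k] by simp
      also have "\<dots> = Q x' w' - t * Q b' w' + cnj k * (Q x' b' - t * Q b' b')"
        using inner_product_rules(3) [OF Q V(2) tb(1) w'(2)] inner_product_rules(3) [OF Q V(2) tb(1) V(1)]
          inner_productD(3) [OF Q V(1) w'(2), of t] inner_productD(3) [OF Q V(1) V(1), of t] by simp
      also have "\<dots> = 0"
        using ub(2) [OF w'(1)] ux(2) [OF w'(1)] nz by (simp add: b'_def [symmetric] x'_def [symmetric] t_def)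
      finally show ?thesis .
    qed
    then show ?thesis
      using in_span by (blast intro: span_add span_scale)
  qed
qed

context
  fixes B V
  assumes B: "finite B" "independent B" "span B = V"
begin

lemma inner_product_basis_form: "inner_product_on V (basis_form C B)"
  unfolding inner_product_on_def
proof (intro conjI allI ballI impI)
  show "subspace V"
    using B by auto
next
  fix x y z assume "x \<in> V" "y \<in> V" "z \<in> V"
  then show "basis_form C B (x + y) z = basis_form C B x z + basis_form C B y z"
    using B by (simp add: basis_form_def representation_add ring_distribs sum.distrib)
next
  fix c x y assume "x \<in> V" "y \<in> V"
  then show "basis_form C B (scl C c x) y = c * basis_form C B x y"
    using B by (simp add: basis_form_def representation_scale sum_distrib_left mult.assoc)
next
  fix x y assume "x \<in> V" "y \<in> V"
  then show "basis_form C B y x = cnj (basis_form C B x y)"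
    by (simp add: basis_form_def mult.commute)
next
  fix x assume x: "x \<in> V"
  have eq: "basis_form C B x x = of_real (\<Sum>b\<in>B. (cmod (representation B x b))\<^sup>2)"
    by (simp add: basis_form_def flip: complex_norm_square)
  show "0 \<le> Re (basis_form C B x x)"
    unfolding eq by (simp add: sum_nonneg)
  assume "basis_form C B x x = 0"
  then have "representation B x b = 0" if "b \<in> B" for b
    using B(1) that unfolding eq of_real_eq_0_iff by (subst (asm) sum_nonneg_eq_0_iff) auto
  then show "x = 0"
    using sum_representation_eq [of B x B] B x by simp
qed

lemma basis_form_right_unique:
  assumes "h \<in> V" "h' \<in> V" "\<And>f. f \<in> V \<Longrightarrow> basis_form C B f h = basis_form C B f h'"
  shows "h = h'"
proof -
  note Q = inner_product_basis_form
  have "h - h' \<in> V"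
    using assms inner_productD(1) [OF Q] by (simp add: subspace_diff)
  moreover have "basis_form C B f (h - h') = 0" if "f \<in> V" for f
    using assms(3) [OF that] inner_product_rules(5) [OF Q assms(1,2) that] by simp
  ultimately have "h - h' = 0"
    by (blast intro: inner_productD(6) [OF Q])
  then show ?thesis
    by simp
qed

lemma functional_represented_by_basis_form:
  assumes add: "\<And>f g. f \<in> V \<Longrightarrow> g \<in> V \<Longrightarrow> l (f + g) = l f + l g"
    and scl: "\<And>c f. f \<in> V \<Longrightarrow> l (scl C c f) = c * l f"
  shows "\<exists>h\<in>V. \<forall>f\<in>V. basis_form C B f h = l f"
proof -
  have BV: "b \<in> V" if "b \<in> B" for b
    using that B span_base by blast
  have sub: "subspace V"
    using B by auto
  have l0: "l 0 = 0"
    using scl [of 0 0] subspace_0 [OF sub] by simp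
  have l_sum: "l (\<Sum>b\<in>A. scl C (c b) b) = (\<Sum>b\<in>A. c b * l b)" if "finite A" "A \<subseteq> B" for A c
    using that
  proof (induction A rule: finite_induct)
    case (insert a A)
    then have "(\<Sum>b\<in>A. scl C (c b) b) \<in> V" "scl C (c a) a \<in> V" "a \<in> V"
      using BV by (auto intro!: subspace_sum subspace_scale sub)
    then show ?case
      using insert by (simp add: add scl)
  qed (simp add: l0)
  define h where "h = (\<Sum>b\<in>B. scl C (cnj (l b)) b)"
  have h: "h \<in> V"
    unfolding h_def by (intro subspace_sum subspace_scale sub BV)
  have rep_h: "representation B h b = cnj (l b)" if "b \<in> B" for b
  proof -
    have "representation B h = (\<lambda>b. if b \<in> B then cnj (l b) else 0)"
    proof (rule representation_eqI [OF B(2)])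
      have "{b. (if b \<in> B then cnj (l b) else 0) \<noteq> 0} \<subseteq> B"
        by auto
      then show "finite {b. (if b \<in> B then cnj (l b) else 0) \<noteq> 0}"
        using B(1) finite_subset by blast
      then show "(\<Sum>b | (if b \<in> B then cnj (l b) else 0) \<noteq> 0. scl C (if b \<in> B then cnj (l b) else 0) b) = h"
        unfolding h_def using B(1) by (intro sum.mono_neutral_cong_left) auto
    qed (use B h in \<open>auto split: if_splits\<close>)
    then show ?thesis
      using that by simp
  qed
  have "basis_form C B f h = l f" if f: "f \<in> V" for f
  proof -
    have "basis_form C B f h = (\<Sum>b\<in>B. representation B f b * l b)"
      by (simp add: basis_form_def rep_h)
    also have "\<dots> = l (\<Sum>b\<in>B. scl C (representation B f b) b)"
      using l_sum [OF B(1) subset_refl] by simp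
    finally show ?thesis
      using sum_representation_eq [of B f B] B f by simp
  qed
  then show ?thesis
    using h by blast
qed

end

end

section \<open>The form \<open>\<kappa>'\<close> and rigid invariance\<close>

context semisimple_tensor_category
begin

lemma hom_basisD:
  assumes "hom_basis C X R \<B>" "S \<in> R" "X \<in> Obj C"
  shows "finite (\<B> S)" "independent (\<B> S)" "span (\<B> S) = Hom C X S" "simple_object C S" "S \<in> Obj C"
proof -
  show *: "independent (\<B> S)" "span (\<B> S) = Hom C X S" "simple_object C S" "S \<in> Obj C"
    using assms by (auto simp: hom_basis_def simple_representatives_def simple_object_def)
  obtain B where "finite B" "span B = Hom C X S"
    using Hom_finite_dim [of X S] * assms by blast
  then show "finite (\<B> S)"
    using * independent_span_bound [of B "\<B> S"] span_superset [of "\<B> S"] by simp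
qed

context
  fixes S DS
  assumes S: "simple_object C S" and DS: "left_dual C S DS"
begin

private lemma S_rules [simp]:
  "S \<in> Obj C" "fst DS \<in> Obj C" "arrow (Ev S DS)" "arrow (Coev S DS)"
  "(I S \<star> Ev S DS) \<bullet> (Coev S DS \<star> I S) = I S" "(Ev S DS \<star> I (fst DS)) \<bullet> (I (fst DS) \<star> Coev S DS) = I (fst DS)"
proof -
  show 1: "S \<in> Obj C"
    using S by (simp add: simple_object_def)
  show "fst DS \<in> Obj C" "arrow (Ev S DS)" "arrow (Coev S DS)"
    "(I S \<star> Ev S DS) \<bullet> (Coev S DS \<star> I S) = I S" "(Ev S DS \<star> I (fst DS)) \<bullet> (I (fst DS) \<star> Coev S DS) = I (fst DS)"
    using DS by (simp_all add: left_dual_iff [OF 1])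
qed

private lemma coev_S: "snd (snd DS) \<in> Hom C \<one> (S \<boxtimes> fst DS)"
  using DS by (cases DS) simp

lemma coev_simple_nonzero: "snd (snd DS) \<noteq> 0"
proof
  assume "snd (snd DS) = 0"
  then have "mor (Coev S DS \<star> I S) = scl C 0 (snd (snd DS)) \<otimes> ide C S"
    by (simp add: tens_def Coev_def I_def)
  also have "\<dots> = 0"
    using coev_S ide_in_Hom [of S] by (subst tar_scl_left [of \<one> "S \<boxtimes> fst DS" S S]) simp_all
  finally have "mor (Coev S DS \<star> I S) = 0" .
  moreover have "arrow (I S \<star> Ev S DS)"
    by simp
  ultimately have "mor ((I S \<star> Ev S DS) \<bullet> (Coev S DS \<star> I S)) = 0"
    by (simp add: comp_def cmp_zero_right [of "S \<boxtimes> fst DS \<boxtimes> S" S] arrow_def)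
  then show False
    using simple_ide_nonzero [OF S] by (simp add: mor_simps)
qed

text \<open>\<open>Hom(1, S \<otimes> S\<^sup>*)\<close> is identified with \<open>End(S) = \<complex>\<close> by bending the strand \<open>S\<^sup>*\<close>.\<close>

lemma Hom_one_simple_dual:
  assumes x: "x \<in> Hom C \<one> (S \<boxtimes> fst DS)"
  shows "\<exists>c. x = scl C c (snd (snd DS))"
proof -
  define y where "y = Arr \<one> x (S \<boxtimes> fst DS)"
  have [simp]: "arrow y" "src y = \<one>" "trg y = S \<boxtimes> fst DS"
    using x by (simp_all add: y_def arrow_Arr)
  define t where "t = (I S \<star> Ev S DS) \<bullet> (y \<star> I S)"
  have t [simp]: "arrow t" "src t = S" "trg t = S"
    by (simp_all add: t_def)
  have "(t \<star> I (fst DS)) \<bullet> Coev S DS =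
      (I S \<star> Ev S DS \<star> I (fst DS)) \<bullet> (y \<star> I S \<star> I (fst DS)) \<bullet> Coev S DS"
    by (simp add: t_def whisker)
  also have "(y \<star> I S \<star> I (fst DS)) \<bullet> Coev S DS = (I S \<star> I (fst DS) \<star> Coev S DS) \<bullet> y"
    using tens_slide [of y "Coev S DS"] by simp
  also have "(I S \<star> Ev S DS \<star> I (fst DS)) \<bullet> (I S \<star> I (fst DS) \<star> Coev S DS) \<bullet> y = y"
    by (simp add: rewrite_left [OF tens_comp])
  finally have y: "y = (t \<star> I (fst DS)) \<bullet> Coev S DS" ..
  have "mor t \<in> Hom C S S"
    using t by (simp add: arrow_def)
  then obtain c where c: "mor t = scl C c (ide C S)"
    using schur_scalar [OF S] by blast
  have "x = (scl C c (ide C S) \<otimes> ide C (fst DS)) \<cdot> snd (snd DS)"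
    using arg_cong [OF y, of mor] c by (simp add: y_def comp_def tens_def I_def Coev_def)
  also have "scl C c (ide C S) \<otimes> ide C (fst DS) = scl C c (ide C (S \<boxtimes> fst DS))"
    using tar_scl_left [of S S "fst DS" "fst DS" "ide C S" "ide C (fst DS)" c]
    by (simp add: ide_in_Hom tar_ide)
  also have "\<dots> \<cdot> snd (snd DS) = scl C c (snd (snd DS))"
    using coev_S ide_in_Hom [of "S \<boxtimes> fst DS"] ide_cmp [OF _ _ coev_S]
    by (subst cmp_scl_left [of \<one> "S \<boxtimes> fst DS" "S \<boxtimes> fst DS"]) simp_all
  finally show ?thesis
    by blast
qed

lemma kappa_unique:
  assumes "(f \<otimes> g) \<cdot> snd (snd DX) = scl C c (snd (snd DS))"
  shows "kappa C DX DS f g = c"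
proof -
  have "kappa C DX DS f g = (THE c. (f \<otimes> g) \<cdot> snd (snd DX) = scl C c (snd (snd DS)))"
    by (cases DX; cases DS) simp
  also have "\<dots> = c"
    using assms coev_simple_nonzero by (intro the_equality) auto
  finally show ?thesis .
qed

context
  fixes X DX
  assumes X: "X \<in> Obj C" and DX: "left_dual C X DX"
begin

private lemma X_rules [simp]: "X \<in> Obj C" "fst DX \<in> Obj C" "snd (snd DX) \<in> Hom C \<one> (X \<boxtimes> fst DX)"
  using X DX by (cases DX, simp)+

lemma kappa_eq:
  assumes f: "f \<in> Hom C X S" and g: "g \<in> Hom C (fst DX) (fst DS)"
  shows "(f \<otimes> g) \<cdot> snd (snd DX) = scl C (kappa C DX DS f g) (snd (snd DS))"
proof -
  have "(f \<otimes> g) \<cdot> snd (snd DX) \<in> Hom C \<one> (S \<boxtimes> fst DS)"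
    using f g by (intro cmp_in_Hom [of _ "X \<boxtimes> fst DX"] tar_in_Hom) simp_all
  then show ?thesis
    using Hom_one_simple_dual kappa_unique by metis
qed

lemma kappa_linear:
  assumes f: "f \<in> Hom C X S" and f': "f' \<in> Hom C X S" and g: "g \<in> Hom C (fst DX) (fst DS)"
  shows "kappa C DX DS (f + f') g = kappa C DX DS f g + kappa C DX DS f' g"
    and "kappa C DX DS (scl C c f) g = c * kappa C DX DS f g"
proof -
  have *: "f \<otimes> g \<in> Hom C (X \<boxtimes> fst DX) (S \<boxtimes> fst DS)" "f' \<otimes> g \<in> Hom C (X \<boxtimes> fst DX) (S \<boxtimes> fst DS)"
    using f f' g by (simp_all add: tar_in_Hom)
  show "kappa C DX DS (f + f') g = kappa C DX DS f g + kappa C DX DS f' g"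
    using kappa_eq [OF f g] kappa_eq [OF f' g] tar_add_left [of X S "fst DX" "fst DS" f f' g]
      cmp_add_left [OF _ _ _ X_rules(3) *] f f' g
    by (intro kappa_unique) (simp add: scale_left_distrib)
  show "kappa C DX DS (scl C c f) g = c * kappa C DX DS f g"
    using kappa_eq [OF f g] tar_scl_left [of X S "fst DX" "fst DS" f g c]
      cmp_scl_left [OF _ _ _ X_rules(3) *(1)] f g
    by (intro kappa_unique) simp
qed

text \<open>A morphism slides along the coevaluation to the other strand and becomes its dual.\<close>

lemma kappa_dual_arrow:
  assumes Y: "Y \<in> Obj C" and DY: "left_dual C Y DY" and a: "a \<in> Hom C Y X"
    and f: "f \<in> Hom C X S" and g: "g \<in> Hom C (fst DY) (fst DS)"
  shows "kappa C DY DS (f \<cdot> a) g = kappa C DX DS f (g \<cdot> dual_arrow C DY DX a)"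
proof -
  define F where "F = Arr X f S"
  define G where "G = Arr (fst DY) g (fst DS)"
  define A where "A = Arr Y a X"
  have DY': "fst DY \<in> Obj C" "arrow (Coev Y DY)" and DX': "arrow (Coev X DX)"
    using Y DY X DX by (simp_all add: left_dual_iff)
  have A: "arrow A" "src A = Y" "trg A = X"
    using a Y by (simp_all add: A_def arrow_Arr)
  have FG: "arrow F" "src F = X" "trg F = S" "arrow G" "src G = fst DY" "trg G = fst DS"
    using f g DY' by (simp_all add: F_def G_def arrow_Arr)
  note [simp] = Y DY' DX' A FG
  have T: "arrow (transp DY DX A)"
    by (rule arrow_transp [OF Y X DY DX A])
  have "((F \<bullet> A) \<star> G) \<bullet> Coev Y DY = (F \<star> G) \<bullet> (A \<star> I (fst DY)) \<bullet> Coev Y DY"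
    by (simp add: rewrite_left [OF tens_comp])
  also have "\<dots> = (F \<star> G) \<bullet> (I X \<star> transp DY DX A) \<bullet> Coev X DX"
    by (simp only: Coev_transp [OF Y X DY DX A])
  also have "\<dots> = (F \<star> (G \<bullet> transp DY DX A)) \<bullet> Coev X DX"
    using T by (simp add: rewrite_left [OF tens_comp])
  finally have "((f \<cdot> a) \<otimes> g) \<cdot> snd (snd DY) = (f \<otimes> (g \<cdot> dual_arrow C DY DX a)) \<cdot> snd (snd DX)"
    by (simp add: arr_eq_iff comp_def tens_def F_def G_def A_def Coev_def)
  also have "\<dots> = scl C (kappa C DX DS f (g \<cdot> dual_arrow C DY DX a)) (snd (snd DS))"
    using T f g DY' by (intro kappa_eq cmp_in_Hom [of _ "fst DY"]) (simp_all add: arrow_def A_def)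
  finally show ?thesis
    by (rule kappa_unique)
qed

end

end

end

section \<open>Rigid invariance means self-adjointness\<close>

context semisimple_tensor_category
begin

definition hom_selfadjoint :: "'a set \<Rightarrow> ('a \<Rightarrow> 'b set) \<Rightarrow> 'a \<Rightarrow> 'b \<Rightarrow> bool" where
  "hom_selfadjoint R \<B> X b \<longleftrightarrow> (\<forall>S\<in>R. \<forall>f\<in>Hom C X S. \<forall>g\<in>Hom C X S.
     basis_form C (\<B> S) (f \<cdot> b) g = basis_form C (\<B> S) f (g \<cdot> b))"

context
  fixes X R \<B> S DX DS
  assumes X: "X \<in> Obj C" and basis: "hom_basis C X R \<B>" and S: "S \<in> R"
    and DX: "left_dual C X DX" and DS: "left_dual C S DS"
begin

private lemmas basis_S = hom_basisD [OF basis S X]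

lemma M_map_eqI:
  assumes "h \<in> Hom C X S" "\<And>f. f \<in> Hom C X S \<Longrightarrow> basis_form C (\<B> S) f h = kappa C DX DS f g"
  shows "M_map C (\<B> S) X DX S DS g = h"
  unfolding M_map_def
  using assms basis_form_right_unique [OF basis_S(1-3)] by (intro the_equality) auto

lemma M_map_in_Hom:
  assumes g: "g \<in> Hom C (fst DX) (fst DS)"
  shows "M_map C (\<B> S) X DX S DS g \<in> Hom C X S"
    and "f \<in> Hom C X S \<Longrightarrow> basis_form C (\<B> S) f (M_map C (\<B> S) X DX S DS g) = kappa C DX DS f g"
proof -
  note linear = kappa_linear [OF basis_S(4) DS X DX _ _ g]
  obtain h where h: "h \<in> Hom C X S" "\<And>f. f \<in> Hom C X S \<Longrightarrow> basis_form C (\<B> S) f h = kappa C DX DS f g"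
    using functional_represented_by_basis_form [OF basis_S(1-3), of "\<lambda>f. kappa C DX DS f g"] linear
    by blast
  note eq = M_map_eqI [OF h]
  show "M_map C (\<B> S) X DX S DS g \<in> Hom C X S"
    "f \<in> Hom C X S \<Longrightarrow> basis_form C (\<B> S) f (M_map C (\<B> S) X DX S DS g) = kappa C DX DS f g"
    using h by (simp_all add: eq)
qed

text \<open>
  The functional \<open>\<langle>\<cdot>, h\<rangle>\<close> is composition with some \<open>s : S \<rightarrow> X\<close>, hence \<open>\<kappa>'(\<cdot>, s\<^sup>*)\<close>.
\<close>

lemma M_map_surj:
  assumes h: "h \<in> Hom C X S"
  obtains g where "g \<in> Hom C (fst DX) (fst DS)" "M_map C (\<B> S) X DX S DS g = h"
proof -
  note Q = inner_product_basis_form [OF basis_S(1-3)]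
  have R: "simple_representatives C R"
    using basis by (simp add: hom_basis_def)
  obtain s where s: "s \<in> Hom C S X"
    "\<And>f. f \<in> Hom C X S \<Longrightarrow> f \<cdot> s = scl C (basis_form C (\<B> S) f h) (ide C S)"
    using functional_represented_by_composition [OF R S X, of "\<lambda>f. basis_form C (\<B> S) f h"]
      inner_productD(2,3) [OF Q] h by metis
  have DS': "fst DS \<in> Obj C" "snd (snd DS) \<in> Hom C \<one> (S \<boxtimes> fst DS)"
    using DS by (cases DS, simp)+
  have [simp]: "S \<in> Obj C"
    by (rule basis_S(5))
  define A where "A = Arr S s X"
  have A: "arrow A" "src A = S" "trg A = X"
    using s(1) X by (simp_all add: A_def arrow_Arr)
  define g where "g = dual_arrow C DS DX s"
  have g: "g \<in> Hom C (fst DX) (fst DS)"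
    using arrow_transp [OF _ X DS DX A] by (simp add: arrow_def g_def A_def)
  have "M_map C (\<B> S) X DX S DS g = h"
  proof (rule M_map_eqI [OF h])
    fix f assume f: "f \<in> Hom C X S"
    have "kappa C DX DS f g = kappa C DX DS f (ide C (fst DS) \<cdot> g)"
      using ide_cmp [OF _ _ g] DS' DX by (cases DX) simp
    also have "\<dots> = kappa C DS DS (f \<cdot> s) (ide C (fst DS))"
      unfolding g_def using DS' s(1) f
      by (intro kappa_dual_arrow [OF basis_S(4) DS X DX _ DS, symmetric] ide_in_Hom) simp_all
    also have "\<dots> = basis_form C (\<B> S) f h"
    proof (rule kappa_unique [OF basis_S(4) DS])
      have "(f \<cdot> s) \<otimes> ide C (fst DS) = scl C (basis_form C (\<B> S) f h) (ide C (S \<boxtimes> fst DS))"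
        unfolding s(2) [OF f]
        using tar_scl_left [of S S "fst DS" "fst DS" "ide C S" "ide C (fst DS)"] DS'
        by (simp add: ide_in_Hom tar_ide)
      then show "((f \<cdot> s) \<otimes> ide C (fst DS)) \<cdot> snd (snd DS) = scl C (basis_form C (\<B> S) f h) (snd (snd DS))"
        using cmp_scl_left [of \<one> "S \<boxtimes> fst DS" "S \<boxtimes> fst DS" "snd (snd DS)" "ide C (S \<boxtimes> fst DS)"]
          ide_cmp [OF _ _ DS'(2)] DS' by (simp add: ide_in_Hom)
    qed
    finally show "basis_form C (\<B> S) f h = kappa C DX DS f g" ..
  qed
  then show thesis
    using that g by blast
qed

end

text \<open>
  Write \<open>b = i p\<close> with \<open>p = i\<^sup>*\<close>, so that \<open>b\<^sup>* = b\<close> and \<open>\<kappa>'(f b, g) = \<kappa>'(f, g b)\<close>. Then rigid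
  invariance says \<open>M'(W b) = V b\<close> for \<open>V = Hom(X,S)\<close> and \<open>W = Hom(X,S\<^sup>*)\<close>. On the other hand
  \<open>\<langle>f, M'(g b)\<rangle> = \<kappa>'(f b, g)\<close> shows that \<open>M'(W b)\<close> is the orthogonal complement of
  \<open>V (1 - b)\<close>. Hence the condition is that \<open>f \<mapsto> f b\<close> is an orthogonal projection.
\<close>

lemma rigid_invariant_iff_selfadjoint:
  assumes X: "frobenius_algebra C X" and basis: "hom_basis C (ob X) R \<B>"
    and DS: "\<And>S. S \<in> R \<Longrightarrow> left_dual C S (DS S)" and A: "frobenius_subalgebra C X (A, i)"
  shows "rigid_invariant C R \<B> DS (ob X) (frob_dual C X) (ob A) (frob_dual C A) i (adj C A X i)
    \<longleftrightarrow> hom_selfadjoint R \<B> (ob X) (sub_idem C X (A, i))"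
proof -
  define p where "p = adj C A X i"
  define b where "b = i \<cdot> p"
  have ob: "ob X \<in> Obj C" "ob A \<in> Obj C"
    using X A by (auto simp: frobenius_algebra_iff)
  note [simp] = ob
  have i: "i \<in> Hom C (ob A) (ob X)" and pi: "p \<cdot> i = ide C (ob A)"
    using A by (simp_all add: algebra_mono_def monic_def p_def)
  note DX = left_dual_frob_dual [OF X]
  have DA: "left_dual C (ob A) (frob_dual C A)"
    using A left_dual_frob_dual by simp
  have "arrow (transp (frob_dual C A) (frob_dual C X) (Arr (ob A) i (ob X)))"
    using i by (intro arrow_transp [OF _ _ DA DX]) (simp_all add: arrow_Arr)
  then have p: "p \<in> Hom C (ob X) (ob A)"
    by (simp add: arrow_def p_def adj_def)
  have b: "b \<in> Hom C (ob X) (ob X)"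
    unfolding b_def using i p by (intro cmp_in_Hom [of _ "ob A"]) simp_all
  have pb: "p \<cdot> b = p"
    unfolding b_def using i p pi cmp_assoc [of "ob X" "ob A" "ob X" "ob A" p i p] ide_cmp [OF _ _ p] by simp
  have adj_b: "dual_arrow C (frob_dual C X) (frob_dual C X) b = b"
    using frob_idem_sub_idem [OF X A] by (simp add: frob_idem_def adj_def b_def p_def)
  have split: "split_subobject C (ob X) (ob A) i p"
    using i p pi by (simp add: split_subobject_def)
  have image_eq: "M_map C (\<B> S) (ob X) (frob_dual C X) S (DS S) ` {g \<cdot> p | g. g \<in> Hom C (ob A) (fst (DS S))}
      = {f \<cdot> p | f. f \<in> Hom C (ob A) S} \<longleftrightarrow>
    (\<forall>f\<in>Hom C (ob X) S. \<forall>g\<in>Hom C (ob X) S.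
      basis_form C (\<B> S) (f \<cdot> b) g = basis_form C (\<B> S) f (g \<cdot> b))" (is "?rigid \<longleftrightarrow> ?sa")
    if S: "S \<in> R" for S
  proof -
    define V where "V = Hom C (ob X) S"
    define W where "W = Hom C (ob X) (fst (DS S))"
    define F where "F = basis_form C (\<B> S)"
    define M where "M = M_map C (\<B> S) (ob X) (frob_dual C X) S (DS S)"
    note BS = hom_basisD [OF basis S ob(1)]
    note Q = inner_product_basis_form [OF BS(1-3), folded F_def V_def]
    have So: "S \<in> Obj C" "fst (DS S) \<in> Obj C"
      using BS(5) DS [OF S] by (simp_all add: left_dual_iff)
    note [simp] = So
    note M = M_map_in_Hom [OF ob(1) basis S DX DS [OF S], folded M_def V_def F_def, unfolded fst_frob_dual, folded W_def]
    note M_eqI = M_map_eqI [OF ob(1) basis S DX DS [OF S], folded M_def V_def F_def]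
    note M_surj = M_map_surj [OF ob(1) basis S DX DS [OF S], folded M_def V_def, unfolded fst_frob_dual, folded W_def]
    have Vb: "f \<cdot> b \<in> V" if "f \<in> V" for f
      using cmp_in_Hom [of "ob X" "ob X" S b f] that b by (simp add: V_def)
    have Wb: "g \<cdot> b \<in> W" if "g \<in> W" for g
      using cmp_in_Hom [of "ob X" "ob X" "fst (DS S)" b g] that b by (simp add: W_def)
    have bb: "b \<cdot> b = b"
      using frob_idem_sub_idem [OF X A] by (simp add: frob_idem_def b_def p_def)
    have fbb: "(f \<cdot> b) \<cdot> b = f \<cdot> b" if "f \<in> V" for f
      using that b bb cmp_assoc [of "ob X" "ob X" "ob X" S b b f] by (simp add: V_def)
    have kappa_b: "kappa C (frob_dual C X) (DS S) (f \<cdot> b) g = kappa C (frob_dual C X) (DS S) f (g \<cdot> b)"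
      if "f \<in> V" "g \<in> W" for f g
      using kappa_dual_arrow [OF BS(4) DS [OF S] ob(1) DX ob(1) DX b] that adj_b
      by (simp add: V_def W_def)
    have Hom_p: "{h \<cdot> p | h. h \<in> Hom C (ob A) T} = {f \<cdot> b | f. f \<in> Hom C (ob X) T}"
      if T: "T \<in> Obj C" for T
    proof (intro Collect_eqI iffI; elim exE conjE)
      fix x h assume h: "x = h \<cdot> p" "h \<in> Hom C (ob A) T"
      have "h \<cdot> p \<in> Hom C (ob X) T" "(h \<cdot> p) \<cdot> b = h \<cdot> p"
        using cmp_in_Hom [of "ob X" "ob A" T p h] cmp_assoc [of "ob X" "ob X" "ob A" T b p h] T h p b pb by simp_all
      then show "\<exists>f. x = f \<cdot> b \<and> f \<in> Hom C (ob X) T"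
        using h by metis
    next
      fix x f assume f: "x = f \<cdot> b" "f \<in> Hom C (ob X) T"
      have "f \<cdot> i \<in> Hom C (ob A) T" "(f \<cdot> i) \<cdot> p = f \<cdot> b"
        using cmp_in_Hom [of "ob A" "ob X" T i f] cmp_assoc [of "ob X" "ob A" "ob X" T p i f] T f p i
        by (simp_all add: b_def)
      then show "\<exists>h. x = h \<cdot> p \<and> h \<in> Hom C (ob A) T"
        using f by metis
    qed
    have rigid_iff: "?rigid \<longleftrightarrow> M ` {g \<cdot> b | g. g \<in> W} = {f \<cdot> b | f. f \<in> V}"
      by (simp add: Hom_p M_def V_def W_def)
    show ?thesis
    proof
      assume ?rigid
      then have image: "M ` {g \<cdot> b | g. g \<in> W} = {f \<cdot> b | f. f \<in> V}"
        by (simp add: rigid_iff)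
      have orth: "F (f - f \<cdot> b) (g \<cdot> b) = 0" if f: "f \<in> V" and g: "g \<in> V" for f g
      proof -
        obtain w where w: "w \<in> W" "g \<cdot> b = M (w \<cdot> b)"
          using image g by blast
        have d: "f - f \<cdot> b \<in> V"
          using f Vb inner_productD(1) [OF Q] by (simp add: subspace_diff)
        have "F (f - f \<cdot> b) (g \<cdot> b) = kappa C (frob_dual C X) (DS S) (f - f \<cdot> b) (w \<cdot> b)"
          using M(2) [OF Wb [OF w(1)] d] w(2) by simp
        also have "\<dots> = kappa C (frob_dual C X) (DS S) ((f - f \<cdot> b) \<cdot> b) w"
          using kappa_b [OF d w(1)] by simp
        also have "(f - f \<cdot> b) \<cdot> b = 0"
          using cmp_diff_left [of "ob X" "ob X" S b f "f \<cdot> b"] f Vb [OF f] fbb [OF f] b by (simp add: V_def)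
        also have "kappa C (frob_dual C X) (DS S) 0 w = 0"
          using M(2) [OF w(1)] inner_product_rules(1) [OF Q f f M(1) [OF w(1)]] inner_productD(1) [OF Q] subspace_0
          by fastforce
        finally show ?thesis .
      qed
      have proj: "F f (g \<cdot> b) = F (f \<cdot> b) (g \<cdot> b)" if "f \<in> V" "g \<in> V" for f g
        using orth [OF that] inner_product_rules(3) [OF Q that(1) Vb [OF that(1)] Vb [OF that(2)]] by simp
      show ?sa
        unfolding F_def [symmetric] V_def [symmetric]
      proof (intro ballI)
        fix f g assume fg: "f \<in> V" "g \<in> V"
        have "F (f \<cdot> b) g = cnj (F g (f \<cdot> b))"
          using inner_productD(4) [OF Q fg(2) Vb [OF fg(1)]] .
        also have "\<dots> = cnj (F (g \<cdot> b) (f \<cdot> b))"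
          using proj fg by simp
        also have "\<dots> = F (f \<cdot> b) (g \<cdot> b)"
          using inner_productD(4) [OF Q Vb [OF fg(2)] Vb [OF fg(1)]] by simp
        finally show "F (f \<cdot> b) g = F f (g \<cdot> b)"
          using proj fg by simp
      qed
    next
      assume ?sa
      then have sa: "\<And>f g. f \<in> V \<Longrightarrow> g \<in> V \<Longrightarrow> F (f \<cdot> b) g = F f (g \<cdot> b)"
        by (simp add: V_def F_def)
      have Mb: "M (w \<cdot> b) = M w \<cdot> b" if w: "w \<in> W" for w
      proof (rule M_eqI)
        show "M w \<cdot> b \<in> V"
          using M(1) w Vb by blast
        fix f assume f: "f \<in> V"
        show "F f (M w \<cdot> b) = kappa C (frob_dual C X) (DS S) f (w \<cdot> b)"
          using sa [OF f M(1) [OF w]] M(2) [OF w Vb [OF f]] kappa_b [OF f w] by simp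
      qed
      have "M ` {g \<cdot> b | g. g \<in> W} = {f \<cdot> b | f. f \<in> V}"
      proof (intro equalityI subsetI)
        fix x assume "x \<in> M ` {g \<cdot> b | g. g \<in> W}"
        then show "x \<in> {f \<cdot> b | f. f \<in> V}"
          using Mb M(1) by blast
      next
        fix x assume "x \<in> {f \<cdot> b | f. f \<in> V}"
        then obtain f where f: "x = f \<cdot> b" "f \<in> V"
          by blast
        obtain w where w: "w \<in> W" "M w = f"
          using M_surj [OF f(2)] by blast
        then have "x = M (w \<cdot> b)"
          using f Mb by simp
        then show "x \<in> M ` {g \<cdot> b | g. g \<in> W}"
          using w by blast
      qed
      then show ?rigid
        by (simp add: rigid_iff)
    qed
  qed
  have "adj C A X i = p" "dual_arrow C (frob_dual C A) (frob_dual C X) i = p"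
    by (simp_all add: p_def adj_def)
  then show ?thesis
    using image_eq split by (simp add: rigid_invariant_def hom_selfadjoint_def b_def)
qed

end

section \<open>The meet of two self-adjoint Frobenius idempotents\<close>

context semisimple_tensor_category
begin

lemma transp_comp:
  assumes ob: "X \<in> Obj C" "Y \<in> Obj C" "Z \<in> Obj C"
    and D: "left_dual C X DX" "left_dual C Y DY" "left_dual C Z DZ"
    and f: "arrow f" "src f = X" "trg f = Y" and g: "arrow g" "src g = Y" "trg g = Z"
  shows "transp DX DZ (g \<bullet> f) = transp DX DY f \<bullet> transp DY DZ g"
proof (rule transp_eqI [OF ob(1,3) D(1,3)])
  note [simp] = ob f g
  have [simp]: "fst DX \<in> Obj C" "fst DY \<in> Obj C" "fst DZ \<in> Obj C"
    "arrow (Ev X DX)" "arrow (Ev Y DY)" "arrow (Ev Z DZ)"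
    using D by (simp_all add: left_dual_iff)
  have [simp]: "arrow (transp DX DY f)" "arrow (transp DY DZ g)"
    using arrow_transp [OF ob(1,2) D(1,2) f] arrow_transp [OF ob(2,3) D(2,3) g] by simp_all
  have "Ev Z DZ \<bullet> (I (fst DZ) \<star> (g \<bullet> f)) = (Ev Z DZ \<bullet> (I (fst DZ) \<star> g)) \<bullet> (I (fst DZ) \<star> f)"
    by (simp add: whisker)
  also have "\<dots> = (Ev Y DY \<bullet> (I (fst DY) \<star> f)) \<bullet> (transp DY DZ g \<star> I X)"
    unfolding Ev_transp [OF ob(2,3) D(2,3) g] using tens_slide [of "transp DY DZ g" f] by simp
  also have "\<dots> = Ev X DX \<bullet> ((transp DX DY f \<bullet> transp DY DZ g) \<star> I X)"
    unfolding Ev_transp [OF ob(1,2) D(1,2) f] by (simp add: whisker)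
  finally show "Ev Z DZ \<bullet> (I (fst DZ) \<star> (g \<bullet> f)) =
      Ev X DX \<bullet> ((transp DX DY f \<bullet> transp DY DZ g) \<star> I X)" .
  show "arrow (transp DX DY f \<bullet> transp DY DZ g)"
    by simp
qed (use f g in simp_all)

lemma dual_arrow_add:
  assumes ob: "X \<in> Obj C" "Y \<in> Obj C" and D: "left_dual C X DX" "left_dual C Y DY"
    and f: "f \<in> Hom C X Y" "g \<in> Hom C X Y"
  shows "dual_arrow C DX DY (f + g) = dual_arrow C DX DY f + dual_arrow C DX DY g"
proof -
  obtain X' ex nx Y' ey ny where D_eq: "DX = (X', ex, nx)" "DY = (Y', ey, ny)"
    by (metis prod_cases3)
  have D': "X' \<in> Obj C" "Y' \<in> Obj C" "nx \<in> Hom C \<one> (X \<boxtimes> X')" "ey \<in> Hom C (Y' \<boxtimes> Y) \<one>"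
    using D D_eq by simp_all
  note [simp] = ob D' ide_in_Hom
  have fi: "h \<otimes> ide C X' \<in> Hom C (X \<boxtimes> X') (Y \<boxtimes> X')"
    and ifi: "ide C Y' \<otimes> h \<otimes> ide C X' \<in> Hom C (Y' \<boxtimes> X \<boxtimes> X') (Y' \<boxtimes> Y \<boxtimes> X')"
    if "h \<in> Hom C X Y" for h
    using that by (auto intro!: tar_in_Hom)
  have n: "ide C Y' \<otimes> nx \<in> Hom C Y' (Y' \<boxtimes> X \<boxtimes> X')"
    using tar_in_Hom [of Y' Y' \<one> "X \<boxtimes> X'" "ide C Y'" nx] by simp
  have e: "ey \<otimes> ide C X' \<in> Hom C (Y' \<boxtimes> Y \<boxtimes> X') X'"
    using tar_in_Hom [of "Y' \<boxtimes> Y" \<one> X' X' ey "ide C X'"] by simp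
  have "(ide C Y' \<otimes> (f + g) \<otimes> ide C X') \<cdot> (ide C Y' \<otimes> nx) =
      (ide C Y' \<otimes> f \<otimes> ide C X') \<cdot> (ide C Y' \<otimes> nx) + (ide C Y' \<otimes> g \<otimes> ide C X') \<cdot> (ide C Y' \<otimes> nx)"
    using tar_add_left [of X Y X' X' f g "ide C X'"] f
      tar_add_right [of Y' Y' "X \<boxtimes> X'" "Y \<boxtimes> X'" "ide C Y'" "f \<otimes> ide C X'" "g \<otimes> ide C X'"]
      cmp_add_left [OF _ _ _ n ifi ifi, of f g] fi by simp
  then show ?thesis
    using cmp_add_right [OF _ _ _ cmp_in_Hom [OF _ _ _ n ifi] cmp_in_Hom [OF _ _ _ n ifi] e, of f g] f
    by (simp add: D_eq)
qed

lemma finite_spanning_subset: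
  assumes "U \<subseteq> Hom C Y Z" "Y \<in> Obj C" "Z \<in> Obj C" "subspace U"
  obtains A where "finite A" "independent A" "span A = U"
proof -
  obtain G where G: "finite G" "span G = Hom C Y Z"
    using Hom_finite_dim assms(2,3) by blast
  obtain A where A: "A \<subseteq> U" "independent A" "U \<subseteq> span A"
    using maximal_independent_subset by blast
  then have "finite A"
    using independent_span_bound [OF G(1) A(2)] assms(1) G(2) by blast
  moreover have "span A = U"
    using A assms(4) by (simp add: span_subspace)
  ultimately show thesis
    using that A(2) by blast
qed

context
  fixes X
  assumes X: "frobenius_algebra C X"
begin

private lemma ob: "ob X \<in> Obj C"
  using X by (simp add: frobenius_algebra_iff)

private abbreviation (input) "E \<equiv> Hom C (ob X) (ob X)"

private lemma E_closed: "f \<in> E \<Longrightarrow> g \<in> E \<Longrightarrow> f \<cdot> g \<in> E" "ide C (ob X) \<in> E"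
  "f \<in> E \<Longrightarrow> g \<in> E \<Longrightarrow> f + g \<in> E" "f \<in> E \<Longrightarrow> g \<in> E \<Longrightarrow> f - g \<in> E"
  using ob cmp_in_Hom [of "ob X" "ob X" "ob X" g f] ide_in_Hom
    subspace_add [OF Hom_subspace [OF ob ob]] subspace_diff [OF Hom_subspace [OF ob ob]]
  by simp_all

lemma adj_in_Hom: "f \<in> E \<Longrightarrow> adj C X X f \<in> E"
  using arrow_transp [OF ob ob left_dual_frob_dual [OF X] left_dual_frob_dual [OF X], of "Arr (ob X) f (ob X)"]
  by (simp add: ob arrow_def adj_def)

lemma adj_cmp: "f \<in> E \<Longrightarrow> g \<in> E \<Longrightarrow> adj C X X (g \<cdot> f) = adj C X X f \<cdot> adj C X X g"
  using transp_comp [OF ob ob ob left_dual_frob_dual [OF X] left_dual_frob_dual [OF X]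
      left_dual_frob_dual [OF X], of "Arr (ob X) f (ob X)" "Arr (ob X) g (ob X)"]
  by (simp add: ob arrow_def adj_def arr_eq_iff mor_simps)

lemma adj_add: "f \<in> E \<Longrightarrow> g \<in> E \<Longrightarrow> adj C X X (f + g) = adj C X X f + adj C X X g"
  unfolding adj_def by (intro dual_arrow_add [OF ob ob left_dual_frob_dual [OF X] left_dual_frob_dual [OF X]])

lemma adj_ide: "adj C X X (ide C (ob X)) = ide C (ob X)"
  using adj_self_iff [OF X, of "I (ob X)"] ob by (simp add: mor_simps)

lemma adj_complement:
  assumes "b \<in> E" "adj C X X b = b"
  shows "adj C X X (ide C (ob X) - b) = ide C (ob X) - b"
  using adj_add [of "ide C (ob X) - b" b] assms E_closed adj_ide by (simp add: algebra_simps)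

lemma frob_idem_ide: "frob_idem X (ide C (ob X))"
  using frob_idem_iff [OF X, of "I (ob X)"] X by (simp add: mor_simps frobenius_algebra_iff)

lemma hom_selfadjoint_ide:
  assumes "hom_basis C (ob X) R \<B>"
  shows "hom_selfadjoint R \<B> (ob X) (ide C (ob X))"
  using cmp_ide [OF ob hom_basisD(5) [OF assms _ ob]] by (simp add: hom_selfadjoint_def)

text \<open>
  The forms on the spaces \<open>Hom(X,S)\<close> give an inner product on \<open>End(X)\<close>: the rows of an
  endomorphism in a decomposition of \<open>X\<close> into simple objects lie in these spaces.
\<close>

lemma End_inner_product:
  assumes basis: "hom_basis C (ob X) R \<B>"
  obtains Q where "inner_product_on E Q"
    "\<And>b f g. b \<in> E \<Longrightarrow> hom_selfadjoint R \<B> (ob X) b \<Longrightarrow> f \<in> E \<Longrightarrow> g \<in> E \<Longrightarrow> Q (f \<cdot> b) g = Q f (g \<cdot> b)"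
proof -
  have R: "simple_representatives C R"
    using basis by (simp add: hom_basis_def)
  obtain n :: nat and S i p where S: "\<And>k. k < n \<Longrightarrow> S k \<in> R" "\<And>k. k < n \<Longrightarrow> i k \<in> Hom C (S k) (ob X)"
    "\<And>k. k < n \<Longrightarrow> p k \<in> Hom C (ob X) (S k)" and sum: "(\<Sum>k<n. i k \<cdot> p k) = ide C (ob X)"
    using decomposition_into_representatives [OF R ob] by blast
  note BS = hom_basisD [OF basis S(1) ob]
  have F: "inner_product_on (Hom C (ob X) (S k)) (basis_form C (\<B> (S k)))" if "k < n" for k
    using inner_product_basis_form [OF BS(1-3)] that by simp
  have pf: "p k \<cdot> f \<in> Hom C (ob X) (S k)" if "k < n" "f \<in> E" for k f
    using cmp_in_Hom [of "ob X" "ob X" "S k" f "p k"] that S ob BS(5) by simp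
  define Q where "Q f g = (\<Sum>k<n. basis_form C (\<B> (S k)) (p k \<cdot> f) (p k \<cdot> g))" for f g
  have Re_nonneg: "0 \<le> Re (basis_form C (\<B> (S k)) (p k \<cdot> f) (p k \<cdot> f))" if "k < n" "f \<in> E" for k f
    using inner_productD(5) [OF F] pf that by simp
  have "inner_product_on E Q"
    unfolding inner_product_on_def
  proof (intro conjI ballI allI impI)
    show "subspace E"
      using ob by (simp add: Hom_subspace)
  next
    fix f g h assume "f \<in> E" "g \<in> E" "h \<in> E"
    then show "Q (f + g) h = Q f h + Q g h"
      unfolding Q_def sum.distrib [symmetric]
      using cmp_add_right [OF ob ob BS(5) _ _ S(3), of _ f g] inner_productD(2) [OF F] pf
      by (intro sum.cong) simp_all
  next
    fix c f g assume "f \<in> E" "g \<in> E"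
    then show "Q (scl C c f) g = c * Q f g"
      unfolding Q_def sum_distrib_left
      using cmp_scl_right [OF ob ob BS(5) _ S(3), of _ f c] inner_productD(3) [OF F] pf
      by (intro sum.cong) simp_all
  next
    fix f g assume "f \<in> E" "g \<in> E"
    then show "Q g f = cnj (Q f g)"
      unfolding Q_def cnj_sum using inner_productD(4) [OF F] pf
      by (intro sum.cong) blast+
  next
    fix f assume f: "f \<in> E"
    show "0 \<le> Re (Q f f)"
      unfolding Q_def Re_sum using Re_nonneg f by (intro sum_nonneg) simp
    assume "Q f f = 0"
    then have "(\<Sum>k<n. Re (basis_form C (\<B> (S k)) (p k \<cdot> f) (p k \<cdot> f))) = 0"
      unfolding Q_def by (metis Re_sum zero_complex.simps(1))
    then have Re0: "Re (basis_form C (\<B> (S k)) (p k \<cdot> f) (p k \<cdot> f)) = 0" if "k < n" for k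
      using that Re_nonneg f by (subst (asm) sum_nonneg_eq_0_iff) auto
    have "p k \<cdot> f = 0" if k: "k < n" for k
    proof -
      define z where "z = basis_form C (\<B> (S k)) (p k \<cdot> f) (p k \<cdot> f)"
      have "z = cnj z"
        using inner_productD(4) [OF F [OF k] pf [OF k f] pf [OF k f]] by (simp add: z_def)
      then have "z = 0"
        using Re0 [OF k] by (simp add: z_def [symmetric] complex_eq_iff)
      then show ?thesis
        using inner_productD(6) [OF F [OF k] pf [OF k f]] by (simp add: z_def)
    qed
    moreover have "f = (\<Sum>k<n. i k \<cdot> (p k \<cdot> f))"
    proof -
      have ip: "i k \<cdot> p k \<in> E" if "k < n" for k
        using cmp_in_Hom [of "ob X" "S k" "ob X" "p k" "i k"] that S ob BS(5) by simp
      have "f = (\<Sum>k<n. i k \<cdot> p k) \<cdot> f"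
        unfolding sum using ide_cmp [OF ob ob f] by simp
      also have "\<dots> = (\<Sum>k<n. (i k \<cdot> p k) \<cdot> f)"
        using ip f ob by (intro cmp_sum_left [of "ob X" "ob X" "ob X"]) simp_all
      also have "\<dots> = (\<Sum>k<n. i k \<cdot> (p k \<cdot> f))"
        using S ob BS(5) f by (intro sum.cong cmp_assoc [of "ob X" "ob X" "S k" "ob X" for k]) auto
      finally show ?thesis .
    qed
    moreover have "i k \<cdot> 0 = 0" if "k < n" for k
      using cmp_zero_right [OF BS(5) ob S(2)] that by simp
    ultimately show "f = 0"
      by simp
  qed
  moreover have "Q (f \<cdot> b) g = Q f (g \<cdot> b)"
    if b: "b \<in> E" "hom_selfadjoint R \<B> (ob X) b" and fg: "f \<in> E" "g \<in> E" for b f g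
    unfolding Q_def
  proof (rule sum.cong [OF refl])
    fix k assume "k \<in> {..<n}"
    then have k: "k < n" by simp
    have "p k \<cdot> (f \<cdot> b) = (p k \<cdot> f) \<cdot> b" "p k \<cdot> (g \<cdot> b) = (p k \<cdot> g) \<cdot> b"
      using cmp_assoc [OF ob ob ob BS(5) b(1) _ S(3)] k fg by simp_all
    then show "basis_form C (\<B> (S k)) (p k \<cdot> (f \<cdot> b)) (p k \<cdot> g) =
        basis_form C (\<B> (S k)) (p k \<cdot> f) (p k \<cdot> (g \<cdot> b))"
      using b(2) S(1) k pf fg by (simp add: hom_selfadjoint_def)
  qed
  ultimately show thesis
    using that by blast
qed

context
  fixes R \<B>
  assumes basis: "hom_basis C (ob X) R \<B>"
begin

text \<open>
  In \<open>End(X)\<close> with this inner product, right multiplications by \<open>b\<^sub>1\<close> and \<open>b\<^sub>2\<close> are orthogonal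
  projections. Let \<open>c\<close> be the component of \<open>1\<close> orthogonal to the left ideal
  \<open>U = End(X)(1 - b\<^sub>1) + End(X)(1 - b\<^sub>2)\<close>. Orthogonality gives \<open>c b\<^sub>1 = c = c b\<^sub>2\<close>. Applying the
  duality to \<open>1 = c + u\<close>, where \<open>c u\<^sup>* = 0 = u c\<^sup>*\<close>, gives \<open>c = c c\<^sup>* = c\<^sup>*\<close>. Moreover \<open>1 = c + u\<close>
  shows that \<open>c\<close> fixes whatever \<open>b\<^sub>1\<close> and \<open>b\<^sub>2\<close> fix, such as the unit and the products of
  elements of the image of \<open>c\<close>.
\<close>

lemma meet_idempotent:
  assumes b1: "frob_idem X b\<^sub>1" "hom_selfadjoint R \<B> (ob X) b\<^sub>1"
    and b2: "frob_idem X b\<^sub>2" "hom_selfadjoint R \<B> (ob X) b\<^sub>2"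
  obtains c where "frob_idem X c" "hom_selfadjoint R \<B> (ob X) c"
    "c \<cdot> b\<^sub>1 = c" "b\<^sub>1 \<cdot> c = c" "c \<cdot> b\<^sub>2 = c" "b\<^sub>2 \<cdot> c = c"
    "\<And>W h. W \<in> Obj C \<Longrightarrow> h \<in> Hom C W (ob X) \<Longrightarrow> b\<^sub>1 \<cdot> h = h \<Longrightarrow> b\<^sub>2 \<cdot> h = h \<Longrightarrow> c \<cdot> h = h"
proof -
  let ?one = "ide C (ob X)"
  let ?star = "adj C X X"
  define d1 where "d1 = ?one - b\<^sub>1"
  define d2 where "d2 = ?one - b\<^sub>2"
  have bE: "b\<^sub>1 \<in> E" "b\<^sub>2 \<in> E" and star_b: "?star b\<^sub>1 = b\<^sub>1" "?star b\<^sub>2 = b\<^sub>2"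
    using b1 b2 by (simp_all add: frob_idem_def)
  have dE [simp]: "d1 \<in> E" "d2 \<in> E"
    using bE by (simp_all add: d1_def d2_def E_closed)
  note [simp] = ob E_closed bE
  note assoc = cmp_assoc [OF ob ob ob ob]
  have star_d: "?star d1 = d1" "?star d2 = d2"
    using bE star_b by (simp_all add: d1_def d2_def adj_complement)
  have mult_d: "f \<cdot> d1 = f - f \<cdot> b\<^sub>1" "f \<cdot> d2 = f - f \<cdot> b\<^sub>2"
    if "f \<in> Hom C (ob X) Y" "Y \<in> Obj C" for f Y
    using that cmp_ide [of "ob X" Y f] by (simp_all add: d1_def d2_def cmp_diff_right [of "ob X" "ob X" Y])
  have d_mult: "d1 \<cdot> f = f - b\<^sub>1 \<cdot> f" "d2 \<cdot> f = f - b\<^sub>2 \<cdot> f"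
    if "f \<in> Hom C Y (ob X)" "Y \<in> Obj C" for f Y
    using that ide_cmp [of Y "ob X" f] by (simp_all add: d1_def d2_def cmp_diff_left [of Y "ob X" "ob X"])
  obtain Q where Q: "inner_product_on E Q"
    and Q_sa: "\<And>b f g. b \<in> E \<Longrightarrow> hom_selfadjoint R \<B> (ob X) b \<Longrightarrow> f \<in> E \<Longrightarrow> g \<in> E
      \<Longrightarrow> Q (f \<cdot> b) g = Q f (g \<cdot> b)"
    using End_inner_product [OF basis] by blast
  have Q_d: "Q (f \<cdot> d1) g = Q f (g \<cdot> d1)" "Q (f \<cdot> d2) g = Q f (g \<cdot> d2)" if "f \<in> E" "g \<in> E" for f g
    using that Q_sa b1 b2 mult_d [of _ "ob X"]
    by (simp_all add: inner_product_rules(3) [OF Q] inner_product_rules(5) [OF Q])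
  define U where "U = {y \<cdot> d1 + z \<cdot> d2 | y z. y \<in> E \<and> z \<in> E}"
  have "subspace U"
  proof (rule subspaceI)
    have "0 \<cdot> d1 + 0 \<cdot> d2 \<in> U"
      unfolding U_def using zero_in_Hom [OF ob ob] by blast
    then show "0 \<in> U"
      using cmp_zero_left [of "ob X" "ob X"] by simp
  next
    fix v w assume "v \<in> U" "w \<in> U"
    then obtain y z y' z' where *: "v = y \<cdot> d1 + z \<cdot> d2" "w = y' \<cdot> d1 + z' \<cdot> d2"
      "y \<in> E" "z \<in> E" "y' \<in> E" "z' \<in> E"
      unfolding U_def by blast
    then have "v + w = (y + y') \<cdot> d1 + (z + z') \<cdot> d2"
      by (simp add: cmp_add_left [of "ob X" "ob X" "ob X"])
    then show "v + w \<in> U"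
      unfolding U_def using * E_closed by blast
  next
    fix t v assume "v \<in> U"
    then obtain y z where *: "v = y \<cdot> d1 + z \<cdot> d2" "y \<in> E" "z \<in> E"
      unfolding U_def by blast
    then have "scl C t v = scl C t y \<cdot> d1 + scl C t z \<cdot> d2"
      by (simp add: cmp_scl_left [of "ob X" "ob X" "ob X"] scale_right_distrib)
    moreover have "scl C t y \<in> E" "scl C t z \<in> E"
      using * by (simp_all add: subspace_scale Hom_subspace)
    ultimately show "scl C t v \<in> U"
      unfolding U_def by blast
  qed
  moreover have "U \<subseteq> E"
    unfolding U_def by auto
  ultimately obtain A where A: "finite A" "span A = U"
    using finite_spanning_subset [of U "ob X" "ob X"] by auto
  have "A \<subseteq> E"
    using A(2) span_superset [of A] \<open>U \<subseteq> E\<close> by blast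
  then obtain u where u: "u \<in> U" "\<And>w. w \<in> U \<Longrightarrow> Q (?one - u) w = 0"
    using orthogonal_projection [OF Q A(1), of ?one] A(2) by auto
  obtain y z where yz: "u = y \<cdot> d1 + z \<cdot> d2" "y \<in> E" "z \<in> E"
    using u(1) unfolding U_def by blast
  define c where "c = ?one - u"
  have uE: "u \<in> E"
    using u(1) \<open>U \<subseteq> E\<close> by blast
  have cE [simp]: "c \<in> E"
    using uE by (simp add: c_def)
  have in_U: "f \<cdot> d1 \<in> U" "f \<cdot> d2 \<in> U" if "f \<in> E" for f
  proof -
    have "f \<cdot> d1 + 0 \<cdot> d2 \<in> U" "0 \<cdot> d1 + f \<cdot> d2 \<in> U"
      unfolding U_def using that zero_in_Hom [OF ob ob] by blast+
    then show "f \<cdot> d1 \<in> U" "f \<cdot> d2 \<in> U"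
      using cmp_zero_left [of "ob X" "ob X"] by simp_all
  qed
  \<comment> \<open>Move one factor \<open>d1\<close> to the other side: \<open>c\<close> is orthogonal to \<open>(c d1) d1 \<in> U\<close>.\<close>
  have "Q (c \<cdot> d1) (c \<cdot> d1) = 0" "Q (c \<cdot> d2) (c \<cdot> d2) = 0"
    using u(2) in_U by (simp_all add: Q_d c_def [symmetric])
  then have cd: "c \<cdot> d1 = 0" "c \<cdot> d2 = 0"
    using inner_productD(6) [OF Q] by simp_all
  then have cb: "c \<cdot> b\<^sub>1 = c" "c \<cdot> b\<^sub>2 = c"
    using mult_d [of c "ob X"] by simp_all
  have dc: "d1 \<cdot> ?star c = 0" "d2 \<cdot> ?star c = 0"
  proof -
    have "?star 0 = 0"
      using adj_add [of 0 0] by simp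
    then show "d1 \<cdot> ?star c = 0" "d2 \<cdot> ?star c = 0"
      using adj_cmp [of d1 c] adj_cmp [of d2 c] cd star_d by simp_all
  qed
  have sE [simp]: "?star f \<in> E" if "f \<in> E" for f
    using that adj_in_Hom by blast
  have "c = c \<cdot> ?star (c + u)"
    using cmp_ide [OF ob ob cE] adj_ide by (simp add: c_def)
  also have "\<dots> = c \<cdot> ?star c + c \<cdot> (d1 \<cdot> ?star y + d2 \<cdot> ?star z)"
    using yz uE star_d by (simp add: adj_add adj_cmp cmp_add_right [of "ob X" "ob X" "ob X"])
  also have "c \<cdot> (d1 \<cdot> ?star y + d2 \<cdot> ?star z) = (c \<cdot> d1) \<cdot> ?star y + (c \<cdot> d2) \<cdot> ?star z"
    using yz by (simp add: assoc cmp_add_right [of "ob X" "ob X" "ob X"])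
  finally have c1: "c = c \<cdot> ?star c"
    using yz cd cmp_zero_left [of "ob X" "ob X"] by simp
  have "?star c = (c + u) \<cdot> ?star c"
    using ide_cmp [OF ob ob sE [OF cE]] by (simp add: c_def)
  also have "\<dots> = c \<cdot> ?star c + (y \<cdot> (d1 \<cdot> ?star c) + z \<cdot> (d2 \<cdot> ?star c))"
    using yz uE by (simp add: assoc cmp_add_left [of "ob X" "ob X" "ob X"])
  finally have star_c: "?star c = c"
    using yz dc c1 cmp_zero_right [of "ob X" "ob X"] by simp
  have bc: "b\<^sub>1 \<cdot> c = c" "b\<^sub>2 \<cdot> c = c"
    using adj_cmp [of b\<^sub>1 c] adj_cmp [of b\<^sub>2 c] cb star_c star_b by simp_all
  have absorbs: "c \<cdot> h = h" if "W \<in> Obj C" "h \<in> Hom C W (ob X)" "b\<^sub>1 \<cdot> h = h" "b\<^sub>2 \<cdot> h = h" for W h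
  proof -
    have "h = (c + u) \<cdot> h"
      using ide_cmp [of W "ob X" h] that by (simp add: c_def)
    also have "\<dots> = c \<cdot> h + (y \<cdot> (d1 \<cdot> h) + z \<cdot> (d2 \<cdot> h))"
      using yz uE that by (simp add: cmp_assoc [of W "ob X" "ob X" "ob X"] cmp_add_left [of W "ob X" "ob X"])
    also have "y \<cdot> (d1 \<cdot> h) + z \<cdot> (d2 \<cdot> h) = 0"
      using that yz d_mult [of h W] cmp_zero_right [of "ob X" "ob X"] by simp
    finally show ?thesis
      by simp
  qed
  have "frob_idem X c"
    unfolding frob_idem_def
  proof (intro conjI cE star_c)
    have unt: "unt X \<in> Hom C \<one> (ob X)" and mul: "mult X \<in> Hom C (ob X \<boxtimes> ob X) (ob X)"
      using X by (simp_all add: frobenius_algebra_def algebra_def)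
    show "c \<cdot> c = c"
      using absorbs [OF ob cE bc] .
    show "c \<cdot> unt X = unt X"
      using absorbs [OF _ unt] b1 b2 by (simp add: frob_idem_def)
    have cc: "c \<otimes> c \<in> Hom C (ob X \<boxtimes> ob X) (ob X \<boxtimes> ob X)"
      by (simp add: tar_in_Hom)
    have closed: "b \<cdot> mult X \<cdot> (c \<otimes> c) = mult X \<cdot> (c \<otimes> c)"
      if b: "b \<in> E" "b \<cdot> c = c" "b \<cdot> mult X \<cdot> (b \<otimes> b) = mult X \<cdot> (b \<otimes> b)" for b
    proof -
      have bb: "b \<otimes> b \<in> Hom C (ob X \<boxtimes> ob X) (ob X \<boxtimes> ob X)"
        using b by (simp add: tar_in_Hom)
      have "(b \<otimes> b) \<cdot> (c \<otimes> c) = c \<otimes> c"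
        using interchange [of "ob X" "ob X" "ob X" "ob X" "ob X" "ob X" c b c b] b by simp
      moreover have "mult X \<cdot> (b \<otimes> b) \<in> Hom C (ob X \<boxtimes> ob X) (ob X)"
        using cmp_in_Hom [OF _ _ _ bb mul] by simp
      ultimately show ?thesis
        using b(3) cmp_assoc [of "ob X \<boxtimes> ob X" "ob X \<boxtimes> ob X" "ob X \<boxtimes> ob X" "ob X" "c \<otimes> c" "b \<otimes> b" "mult X"]
          cmp_assoc [of "ob X \<boxtimes> ob X" "ob X \<boxtimes> ob X" "ob X" "ob X" "c \<otimes> c" "mult X \<cdot> (b \<otimes> b)" b] b(1) bb mul cc
        by simp
    qed
    show "c \<cdot> mult X \<cdot> (c \<otimes> c) = mult X \<cdot> (c \<otimes> c)"
      using closed [OF bE(1) bc(1)] closed [OF bE(2) bc(2)] b1 b2 cmp_in_Hom [OF _ _ _ cc mul]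
      by (intro absorbs [of "ob X \<boxtimes> ob X"]) (simp_all add: frob_idem_def)
  qed
  moreover have "hom_selfadjoint R \<B> (ob X) c"
    unfolding hom_selfadjoint_def
  proof (intro ballI)
    fix S f g assume S: "S \<in> R" and fg: "f \<in> Hom C (ob X) S" "g \<in> Hom C (ob X) S"
    note BS = hom_basisD [OF basis S ob]
    note F = inner_product_basis_form [OF BS(1-3)]
    note [simp] = BS(5)
    have fE: "f \<cdot> x \<in> Hom C (ob X) S" if "f \<in> Hom C (ob X) S" "x \<in> E" for f x
      using cmp_in_Hom [OF ob ob BS(5) that(2,1)] .
    have assoc_S: "(f \<cdot> x) \<cdot> x' = f \<cdot> (x \<cdot> x')" if "f \<in> Hom C (ob X) S" "x \<in> E" "x' \<in> E" for f x x'
      using cmp_assoc [OF ob ob ob BS(5) that(3,2,1)] .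
    have orth: "basis_form C (\<B> S) (f \<cdot> c) (g \<cdot> u) = 0"
      if fg: "f \<in> Hom C (ob X) S" "g \<in> Hom C (ob X) S" for f g
    proof -
      have "basis_form C (\<B> S) (f \<cdot> c) (h \<cdot> d1) = 0" "basis_form C (\<B> S) (f \<cdot> c) (h \<cdot> d2) = 0"
        if h: "h \<in> Hom C (ob X) S" for h
      proof -
        have fc: "f \<cdot> c \<in> Hom C (ob X) S" "(f \<cdot> c) \<cdot> b\<^sub>1 = f \<cdot> c" "(f \<cdot> c) \<cdot> b\<^sub>2 = f \<cdot> c"
          using fE fg(1) cb by (simp_all add: assoc_S)
        have "basis_form C (\<B> S) (f \<cdot> c) (h \<cdot> b) = basis_form C (\<B> S) ((f \<cdot> c) \<cdot> b) h"
          if "hom_selfadjoint R \<B> (ob X) b" for b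
          using that S fc(1) h by (simp add: hom_selfadjoint_def)
        from this [OF b1(2)] this [OF b2(2)] show
          "basis_form C (\<B> S) (f \<cdot> c) (h \<cdot> d1) = 0" "basis_form C (\<B> S) (f \<cdot> c) (h \<cdot> d2) = 0"
          using fc h fE by (simp_all add: mult_d [OF h] inner_product_rules(5) [OF F])
      qed
      moreover have "g \<cdot> u = (g \<cdot> y) \<cdot> d1 + (g \<cdot> z) \<cdot> d2"
        using yz fg(2) by (simp add: cmp_add_right [of "ob X" "ob X" S] assoc_S)
      ultimately show ?thesis
        using fE fg yz(2,3) by (simp add: inner_product_rules(4) [OF F])
    qed
    have "basis_form C (\<B> S) (f \<cdot> c) g = basis_form C (\<B> S) (f \<cdot> c) (g \<cdot> c)"
      if fg: "f \<in> Hom C (ob X) S" "g \<in> Hom C (ob X) S" for f g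
    proof -
      have "g = g \<cdot> c + g \<cdot> u"
        using cmp_add_right [OF ob ob BS(5) cE uE fg(2)] cmp_ide [OF ob BS(5) fg(2)] by (simp add: c_def)
      then have "basis_form C (\<B> S) (f \<cdot> c) g = basis_form C (\<B> S) (f \<cdot> c) (g \<cdot> c + g \<cdot> u)"
        by simp
      also have "\<dots> = basis_form C (\<B> S) (f \<cdot> c) (g \<cdot> c)"
        using orth [OF fg] fE fg uE by (simp add: inner_product_rules(4) [OF F])
      finally show ?thesis .
    qed
    note proj = this
    have "basis_form C (\<B> S) f (g \<cdot> c) = cnj (basis_form C (\<B> S) (g \<cdot> c) f)"
      using inner_productD(4) [OF F fE [OF fg(2) cE] fg(1)] .
    also have "\<dots> = cnj (basis_form C (\<B> S) (g \<cdot> c) (f \<cdot> c))"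
      using proj fg by simp
    also have "\<dots> = basis_form C (\<B> S) (f \<cdot> c) (g \<cdot> c)"
      using inner_productD(4) [OF F fE [OF fg(2) cE] fE [OF fg(1) cE]] by simp
    finally show "basis_form C (\<B> S) (f \<cdot> c) g = basis_form C (\<B> S) f (g \<cdot> c)"
      using proj fg by simp
  qed
  ultimately show thesis
    using that cb bc absorbs by blast
qed

end

end

end

section \<open>Joins by minimal rank\<close>

context semisimple_tensor_category
begin

text \<open>The order of the Frobenius subalgebra poset, in terms of the idempotents.\<close>

definition idem_le :: "'b \<Rightarrow> 'b \<Rightarrow> bool" where
  "idem_le b c \<longleftrightarrow> b \<cdot> c = b \<and> b = c \<cdot> b"

definition sa_frob_idems :: "'a set \<Rightarrow> ('a \<Rightarrow> 'b set) \<Rightarrow> ('a, 'b) frob \<Rightarrow> 'b set" where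
  "sa_frob_idems R \<B> X = {b. frob_idem X b \<and> hom_selfadjoint R \<B> (ob X) b}"

lemma idems_closed: "b \<in> sa_frob_idems R \<B> X \<Longrightarrow> b \<in> Hom C (ob X) (ob X)"
  by (simp add: sa_frob_idems_def frob_idem_def)

lemma idem_le_refl: "b \<in> sa_frob_idems R \<B> X \<Longrightarrow> idem_le b b"
  by (simp add: sa_frob_idems_def frob_idem_def idem_le_def)

lemma idem_le_antisym: "idem_le b c \<Longrightarrow> idem_le c b \<Longrightarrow> b = c"
  by (metis idem_le_def)

lemma idem_le_trans:
  assumes "idem_le b c" "idem_le c d" "ob X \<in> Obj C"
    "b \<in> sa_frob_idems R \<B> X" "c \<in> sa_frob_idems R \<B> X" "d \<in> sa_frob_idems R \<B> X"
  shows "idem_le b d"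
proof -
  note assoc = cmp_assoc [OF assms(3,3,3,3)] and E = assms(4-6) [THEN idems_closed]
  have "b \<cdot> d = (b \<cdot> c) \<cdot> d" "d \<cdot> b = d \<cdot> (c \<cdot> b)"
    using assms(1) by (simp_all add: idem_le_def)
  moreover have "(b \<cdot> c) \<cdot> d = b \<cdot> (c \<cdot> d)" "(d \<cdot> c) \<cdot> b = d \<cdot> (c \<cdot> b)"
    using E by (auto intro: assoc)
  moreover have "c \<cdot> d = c" "d \<cdot> c = c" "b \<cdot> c = b" "c \<cdot> b = b"
    using assms(1,2) by (simp_all add: idem_le_def)
  ultimately show ?thesis
    by (simp add: idem_le_def)
qed

lemma subspace_eqI_dim:
  assumes "U \<subseteq> V" "V \<subseteq> Hom C Y Z" "Y \<in> Obj C" "Z \<in> Obj C" "subspace U" "subspace V" "dim V \<le> dim U"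
  shows "U = V"
proof -
  obtain A where A: "finite A" "independent A" "span A = U"
    using finite_spanning_subset [of U Y Z] assms by blast
  have "A \<subseteq> V"
    using A(3) span_superset [of A] assms(1) by blast
  then obtain B where B: "A \<subseteq> B" "B \<subseteq> V" "independent B" "V \<subseteq> span B"
    using maximal_independent_subset_extend [OF _ A(2)] by blast
  obtain G where "finite G" "span G = Hom C Y Z"
    using Hom_finite_dim assms(3,4) by blast
  then have "finite B"
    using independent_span_bound [of G B] B assms(2) by blast
  moreover have "card B \<le> card A"
    using basis_card_eq_dim [OF B(2,4,3)] basis_card_eq_dim [of A U] A assms(7) span_superset [of A] by simp
  ultimately have "A = B"
    using B(1) card_seteq by blast
  then show ?thesis
    using A(3) B(4) assms(1) by blast
qed

context
  fixes X R \<B>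
  assumes X: "frobenius_algebra C X" and basis: "hom_basis C (ob X) R \<B>"
begin

private lemma ob_X: "ob X \<in> Obj C"
  using X by (simp add: frobenius_algebra_iff)

private lemmas assoc = cmp_assoc [OF ob_X ob_X ob_X ob_X]

lemma idems_meet:
  assumes "b\<^sub>1 \<in> sa_frob_idems R \<B> X" "b\<^sub>2 \<in> sa_frob_idems R \<B> X"
  obtains c where "c \<in> sa_frob_idems R \<B> X" "idem_le c b\<^sub>1" "idem_le c b\<^sub>2"
    "\<And>d. d \<in> sa_frob_idems R \<B> X \<Longrightarrow> idem_le d b\<^sub>1 \<Longrightarrow> idem_le d b\<^sub>2 \<Longrightarrow> idem_le d c"
    "\<And>W h. W \<in> Obj C \<Longrightarrow> h \<in> Hom C W (ob X) \<Longrightarrow> b\<^sub>1 \<cdot> h = h \<Longrightarrow> b\<^sub>2 \<cdot> h = h \<Longrightarrow> c \<cdot> h = h"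
proof -
  obtain c where c: "frob_idem X c" "hom_selfadjoint R \<B> (ob X) c"
    "c \<cdot> b\<^sub>1 = c" "b\<^sub>1 \<cdot> c = c" "c \<cdot> b\<^sub>2 = c" "b\<^sub>2 \<cdot> c = c"
    "\<And>W h. W \<in> Obj C \<Longrightarrow> h \<in> Hom C W (ob X) \<Longrightarrow> b\<^sub>1 \<cdot> h = h \<Longrightarrow> b\<^sub>2 \<cdot> h = h \<Longrightarrow> c \<cdot> h = h"
    using meet_idempotent [OF X basis] assms unfolding sa_frob_idems_def by blast
  have greatest: "idem_le d c" if d: "d \<in> sa_frob_idems R \<B> X" "idem_le d b\<^sub>1" "idem_le d b\<^sub>2" for d
  proof -
    have "c \<cdot> d = d"
      using c(7) [OF ob_X idems_closed [OF d(1)]] d(2,3) by (simp add: idem_le_def)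
    \<comment> \<open>Dualise, both idempotents being self-dual.\<close>
    moreover from this have "d \<cdot> c = d"
      using adj_cmp [OF X idems_closed [OF d(1)], of c] c(1) d(1) by (simp add: sa_frob_idems_def frob_idem_def)
    ultimately show ?thesis
      by (simp add: idem_le_def)
  qed
  show thesis
    using c greatest by (intro that [of c]) (auto simp: sa_frob_idems_def idem_le_def)
qed

text \<open>
  The identity is an upper bound. An upper bound \<open>d\<close> for which \<open>d End(X)\<close> has minimal dimension
  lies below every other upper bound \<open>d'\<close>: the meet of \<open>d\<close> and \<open>d'\<close> is again an upper bound, and it
  cannot have smaller rank than \<open>d\<close>.
\<close>

lemma idems_join:
  assumes b: "b\<^sub>1 \<in> sa_frob_idems R \<B> X" "b\<^sub>2 \<in> sa_frob_idems R \<B> X"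
  obtains d where "d \<in> sa_frob_idems R \<B> X" "idem_le b\<^sub>1 d" "idem_le b\<^sub>2 d"
    "\<And>d'. d' \<in> sa_frob_idems R \<B> X \<Longrightarrow> idem_le b\<^sub>1 d' \<Longrightarrow> idem_le b\<^sub>2 d' \<Longrightarrow> idem_le d d'"
proof -
  define ub where "ub d \<longleftrightarrow> d \<in> sa_frob_idems R \<B> X \<and> idem_le b\<^sub>1 d \<and> idem_le b\<^sub>2 d" for d
  define img where "img d = (\<lambda>x. d \<cdot> x) ` Hom C (ob X) (ob X)" for d
  have "ub (ide C (ob X))"
    using frob_idem_ide [OF X] hom_selfadjoint_ide [OF X basis] b [THEN idems_closed]
      cmp_ide [OF ob_X ob_X] ide_cmp [OF ob_X ob_X] by (simp add: ub_def sa_frob_idems_def idem_le_def)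
  then obtain d where d: "ub d" "\<And>d'. ub d' \<Longrightarrow> dim (img d) \<le> dim (img d')"
    using ex_has_least_nat [of ub "ide C (ob X)" "\<lambda>d. dim (img d)"] by blast
  have sub: "subspace (img e)" "img e \<subseteq> Hom C (ob X) (ob X)" if "e \<in> Hom C (ob X) (ob X)" for e
  proof -
    note Hsub = Hom_subspace [OF ob_X ob_X]
    show "img e \<subseteq> Hom C (ob X) (ob X)"
      unfolding img_def using cmp_in_Hom [OF ob_X ob_X ob_X _ that] by blast
    show "subspace (img e)"
    proof (rule subspaceI)
      show "0 \<in> img e"
        using cmp_zero_right [OF ob_X ob_X that] zero_in_Hom [OF ob_X ob_X] unfolding img_def by (metis image_eqI)
    next
      fix x y assume "x \<in> img e" "y \<in> img e"
      then obtain v w where "x = e \<cdot> v" "y = e \<cdot> w" "v \<in> Hom C (ob X) (ob X)" "w \<in> Hom C (ob X) (ob X)"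
        by (auto simp: img_def)
      then show "x + y \<in> img e"
        using cmp_add_right [OF ob_X ob_X ob_X _ _ that, of v w] subspace_add [OF Hsub, of v w]
        unfolding img_def by (metis image_eqI)
    next
      fix t x assume "x \<in> img e"
      then obtain v where "x = e \<cdot> v" "v \<in> Hom C (ob X) (ob X)"
        by (auto simp: img_def)
      then show "scl C t x \<in> img e"
        using cmp_scl_right [OF ob_X ob_X ob_X _ that, of v t] subspace_scale [OF Hsub, of v t]
        unfolding img_def by (metis image_eqI)
    qed
  qed
  have "idem_le d d'" if d': "ub d'" for d'
  proof -
    obtain c where c: "c \<in> sa_frob_idems R \<B> X" "idem_le c d" "idem_le c d'"
      "\<And>e. e \<in> sa_frob_idems R \<B> X \<Longrightarrow> idem_le e d \<Longrightarrow> idem_le e d' \<Longrightarrow> idem_le e c"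
      by (rule idems_meet [of d d']) (use d(1) d' in \<open>auto simp: ub_def\<close>)
    have "ub c"
      using c b d(1) d' by (simp add: ub_def)
    have E: "c \<in> Hom C (ob X) (ob X)" "d \<in> Hom C (ob X) (ob X)"
      using c(1) d(1) idems_closed by (auto simp: ub_def)
    have "img c \<subseteq> img d"
    proof
      fix x assume "x \<in> img c"
      then obtain y where y: "x = c \<cdot> y" "y \<in> Hom C (ob X) (ob X)"
        by (auto simp: img_def)
      have "x = d \<cdot> (c \<cdot> y)"
        using c(2) y assoc [OF y(2) E] by (simp add: idem_le_def)
      then show "x \<in> img d"
        unfolding img_def using cmp_in_Hom [OF ob_X ob_X ob_X y(2) E(1)] by blast
    qed
    then have "img c = img d"
      using subspace_eqI_dim [of "img c" "img d" "ob X" "ob X"] sub E ob_X d(2) [OF \<open>ub c\<close>] by blast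
    moreover have "d \<in> img d"
      using cmp_ide [OF ob_X ob_X E(2)] ide_in_Hom [OF ob_X] unfolding img_def by (metis image_eqI)
    ultimately obtain y where y: "d = c \<cdot> y" "y \<in> Hom C (ob X) (ob X)"
      by (auto simp: img_def)
    have "c \<cdot> d = d"
      using assoc [OF y(2) E(1) E(1)] y(1) c(1) by (simp add: sa_frob_idems_def frob_idem_def)
    then have "c = d"
      using c(2) by (simp add: idem_le_def)
    then show ?thesis
      using c(3) by simp
  qed
  then show thesis
    using that [of d] d(1) by (simp add: ub_def)
qed

end

end

section \<open>Idempotents, subobjects and intersections\<close>

lemma (in abelian_linear_category) idempotent_splits:
  assumes X: "X \<in> Obj C" and b: "b \<in> Hom C X X" "b \<cdot> b = b"
  obtains P k r where "P \<in> Obj C" "k \<in> Hom C P X" "r \<in> Hom C X P" "r \<cdot> k = ide C P" "k \<cdot> r = b"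
proof -
  obtain K k J i j Q q where ij: "i \<in> Hom C X J" "j \<in> Hom C J X" "j \<cdot> i = b"
    and i: "is_cokernel C K X k J i" and j: "is_kernel C X Q q J j" and q: "is_cokernel C X X b Q q"
    using ex_canonical_decomposition [OF X X b(1)] by blast
  have [simp]: "J \<in> Obj C" "Q \<in> Obj C" "q \<in> Hom C X Q"
    using i q by (simp_all add: is_cokernel_def)
  have ij': "i \<cdot> j \<in> Hom C J J" "i \<cdot> (j \<cdot> i) \<in> Hom C X J"
    using ij X b cmp_in_Hom [of J X J j i] cmp_in_Hom [of X X J b i] by simp_all
  have "j \<cdot> (i \<cdot> (j \<cdot> i)) = j \<cdot> i"
    using b ij X cmp_assoc [of X X J X "j \<cdot> i" i j] by simp
  then have "i \<cdot> (j \<cdot> i) = i"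
    using kernel_monic [OF j] X ij ij' by (simp add: monic_def)
  then have "(i \<cdot> j) \<cdot> i = i"
    using cmp_assoc [of X J X J i j i] ij X by simp
  moreover have "\<exists>!l. l \<in> Hom C J J \<and> l \<cdot> i = i"
    using i ij by (simp add: is_cokernel_def)
  ultimately have "i \<cdot> j = ide C J"
    using ij'(1) ide_in_Hom [OF \<open>J \<in> Obj C\<close>] ide_cmp [OF X \<open>J \<in> Obj C\<close> ij(1)] by auto
  then show thesis
    using that [of J j i] ij by simp
qed

lemma (in linear_category) idem_of_split_subobject:
  assumes "split_subobject C X A i p" "X \<in> Obj C"
  shows "i \<cdot> p \<in> Hom C X X" "(i \<cdot> p) \<cdot> i = i"
    and "W \<in> Obj C \<Longrightarrow> f \<in> Hom C W A \<Longrightarrow> (i \<cdot> p) \<cdot> (i \<cdot> f) = i \<cdot> f"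
    and "W \<in> Obj C \<Longrightarrow> f \<in> Hom C W A \<Longrightarrow> p \<cdot> (i \<cdot> f) = f"
proof -
  have A: "A \<in> Obj C" "i \<in> Hom C A X" "p \<in> Hom C X A" "p \<cdot> i = ide C A"
    using assms(1) by (simp_all add: split_subobject_def)
  show b: "i \<cdot> p \<in> Hom C X X"
    using A assms(2) by (intro cmp_in_Hom [of X A X]) simp_all
  show bi: "(i \<cdot> p) \<cdot> i = i"
    using A assms(2) cmp_assoc [of A X A X i p i] cmp_ide by simp
  show "W \<in> Obj C \<Longrightarrow> f \<in> Hom C W A \<Longrightarrow> (i \<cdot> p) \<cdot> (i \<cdot> f) = i \<cdot> f"
    using bi A b assms(2) cmp_assoc [of W A X X f i "i \<cdot> p"] by simp
  show "W \<in> Obj C \<Longrightarrow> f \<in> Hom C W A \<Longrightarrow> p \<cdot> (i \<cdot> f) = f"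
    using A assms(2) cmp_assoc [of W A X A f i p] ide_cmp [of W A f] by simp
qed

text \<open>
  If \<open>c\<close> is the idempotent whose image consists of what \<open>i p\<close> and \<open>j q\<close> both fix, then the
  intersections of \<open>A\<close> and \<open>B\<close> are exactly the splittings of \<open>c\<close>.
\<close>

context linear_category
begin

context
  fixes X A B i j p q c
  assumes X: "X \<in> Obj C" and A: "split_subobject C X A i p" and B: "split_subobject C X B j q"
    and c: "c \<in> Hom C X X" "(i \<cdot> p) \<cdot> c = c" "(j \<cdot> q) \<cdot> c = c"
    and c_absorbs: "\<And>W h. W \<in> Obj C \<Longrightarrow> h \<in> Hom C W X \<Longrightarrow> (i \<cdot> p) \<cdot> h = h \<Longrightarrow> (j \<cdot> q) \<cdot> h = h \<Longrightarrow> c \<cdot> h = h"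
begin

private lemma AB: "A \<in> Obj C" "i \<in> Hom C A X" "p \<in> Hom C X A" "p \<cdot> i = ide C A"
  "B \<in> Obj C" "j \<in> Hom C B X" "q \<in> Hom C X B" "q \<cdot> j = ide C B"
  using A B by (simp_all add: split_subobject_def)

private lemma fixed:
  assumes "W \<in> Obj C" "f \<in> Hom C W A" "g \<in> Hom C W B" "i \<cdot> f = j \<cdot> g"
  shows "c \<cdot> (i \<cdot> f) = i \<cdot> f"
  using idem_of_split_subobject(3) [OF A X assms(1,2)] idem_of_split_subobject(3) [OF B X assms(1,3)]
    cmp_in_Hom [OF assms(1) AB(1) X assms(2) AB(2)] assms(4) by (intro c_absorbs [OF assms(1)]) simp_all

lemma splitting_is_intersection:
  assumes P: "P \<in> Obj C" "k \<in> Hom C P X" "r \<in> Hom C X P" "r \<cdot> k = ide C P" "k \<cdot> r = c"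
  shows "is_intersection C A i B j P k"
proof -
  have rk: "r \<cdot> (k \<cdot> h) = h" if "W \<in> Obj C" "h \<in> Hom C W P" for W h
    using that P X cmp_assoc [of W P X P h k r] ide_cmp [of W P h] by simp
  have eqs: "(i \<cdot> p) \<cdot> k = k" "(j \<cdot> q) \<cdot> k = k"
  proof -
    have *: "b \<cdot> k = k" if "b \<in> Hom C X X" "b \<cdot> c = c" for b
    proof -
      have "c \<cdot> k = k"
        using P X cmp_assoc [of P X P X k r k] cmp_ide [of P X k] by simp
      then show ?thesis
        using cmp_assoc [OF P(1) X X X P(2) c(1) that(1)] that(2) by simp
    qed
    show "(i \<cdot> p) \<cdot> k = k" "(j \<cdot> q) \<cdot> k = k"
      using * idem_of_split_subobject(1) [OF A X] idem_of_split_subobject(1) [OF B X] c by blast+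
  qed
  have ipk: "i \<cdot> (p \<cdot> k) = k" "j \<cdot> (q \<cdot> k) = k"
    using eqs cmp_assoc [OF P(1) X AB(1) X P(2) AB(3,2)] cmp_assoc [OF P(1) X AB(5) X P(2) AB(7,6)] by simp_all
  have pk: "p \<cdot> k \<in> Hom C P A" "q \<cdot> k \<in> Hom C P B"
    using cmp_in_Hom [OF P(1) X AB(1) P(2) AB(3)] cmp_in_Hom [OF P(1) X AB(5) P(2) AB(7)] .
  have "is_pullback C A B i j P (p \<cdot> k) (q \<cdot> k)"
    unfolding is_pullback_def
  proof (intro conjI ballI impI P(1) pk)
    show "i \<cdot> p \<cdot> k = j \<cdot> q \<cdot> k"
      using ipk by simp
    fix W f g assume W: "W \<in> Obj C" "f \<in> Hom C W A" "g \<in> Hom C W B" "i \<cdot> f = j \<cdot> g"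
    define h where "h = r \<cdot> (i \<cdot> f)"
    have "i \<cdot> f \<in> Hom C W X"
      using cmp_in_Hom [OF W(1) AB(1) X W(2) AB(2)] .
    then have h: "h \<in> Hom C W P" and kh: "k \<cdot> h = i \<cdot> f"
      using cmp_in_Hom [OF W(1) X P(1) _ P(3), of "i \<cdot> f"] cmp_assoc [OF W(1) X P(1) X _ P(3,2), of "i \<cdot> f"]
        fixed [OF W] P(5) by (simp_all add: h_def)
    have pkh: "(p \<cdot> k) \<cdot> l = p \<cdot> (k \<cdot> l)" "(q \<cdot> k) \<cdot> l = q \<cdot> (k \<cdot> l)" if "l \<in> Hom C W P" for l
      using cmp_assoc [OF W(1) P(1) X AB(1) that P(2) AB(3)] cmp_assoc [OF W(1) P(1) X AB(5) that P(2) AB(7)] .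
    show "\<exists>!h. h \<in> Hom C W P \<and> (p \<cdot> k) \<cdot> h = f \<and> (q \<cdot> k) \<cdot> h = g"
    proof (intro ex1I [of _ h] conjI h)
      show "(p \<cdot> k) \<cdot> h = f"
        using pkh h kh idem_of_split_subobject(4) [OF A X W(1,2)] by simp
      show "(q \<cdot> k) \<cdot> h = g"
        using pkh h kh W(4) idem_of_split_subobject(4) [OF B X W(1,3)] by simp
    next
      fix l assume l: "l \<in> Hom C W P \<and> (p \<cdot> k) \<cdot> l = f \<and> (q \<cdot> k) \<cdot> l = g"
      have "k \<cdot> l = (i \<cdot> (p \<cdot> k)) \<cdot> l"
        by (simp add: ipk)
      also have "\<dots> = i \<cdot> f"
        using cmp_assoc [OF W(1) P(1) AB(1) X _ pk(1) AB(2), of l] l by simp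
      finally show "l = h"
        using rk [OF W(1)] l by (metis h_def)
    qed
  qed
  then show ?thesis
    unfolding is_intersection_def using ipk by metis
qed

lemma intersection_is_splitting:
  assumes "is_intersection C A i B j P k"
  obtains r where "P \<in> Obj C" "k \<in> Hom C P X" "r \<in> Hom C X P" "r \<cdot> k = ide C P" "k \<cdot> r = c"
proof -
  obtain s t where st: "is_pullback C A B i j P s t" "k = i \<cdot> s"
    using assms by (auto simp: is_intersection_def)
  have P: "P \<in> Obj C" "s \<in> Hom C P A" "t \<in> Hom C P B" "i \<cdot> s = j \<cdot> t"
    and univ: "\<And>W f g. W \<in> Obj C \<Longrightarrow> f \<in> Hom C W A \<Longrightarrow> g \<in> Hom C W B \<Longrightarrow> i \<cdot> f = j \<cdot> g \<Longrightarrow>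
      \<exists>!h. h \<in> Hom C W P \<and> s \<cdot> h = f \<and> t \<cdot> h = g"
    using st(1) by (simp_all add: is_pullback_def)
  have k: "k \<in> Hom C P X"
    unfolding st(2) using cmp_in_Hom [OF P(1) AB(1) X P(2) AB(2)] .
  have pc: "p \<cdot> c \<in> Hom C X A" "q \<cdot> c \<in> Hom C X B" "i \<cdot> (p \<cdot> c) = c" "j \<cdot> (q \<cdot> c) = c"
    using cmp_in_Hom [OF X X AB(1) c(1) AB(3)] cmp_in_Hom [OF X X AB(5) c(1) AB(7)]
      cmp_assoc [OF X X AB(1) X c(1) AB(3,2)] cmp_assoc [OF X X AB(5) X c(1) AB(7,6)] c by simp_all
  then obtain r where r: "r \<in> Hom C X P" "s \<cdot> r = p \<cdot> c" "t \<cdot> r = q \<cdot> c"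
    using univ [OF X pc(1,2)] by auto
  have kr: "k \<cdot> r = c"
    unfolding st(2) using cmp_assoc [OF X P(1) AB(1) X r(1) P(2) AB(2)] r pc by simp
  have ck: "c \<cdot> k = k"
    unfolding st(2) using fixed [OF P] .
  have rk: "r \<cdot> k \<in> Hom C P P"
    using cmp_in_Hom [OF P(1) X P(1) k r(1)] .
  have "s \<cdot> (r \<cdot> k) = (p \<cdot> c) \<cdot> k"
    using cmp_assoc [OF P(1) X P(1) AB(1) k r(1) P(2)] r by simp
  also have "\<dots> = p \<cdot> k"
    using cmp_assoc [OF P(1) X X AB(1) k c(1) AB(3)] ck by simp
  finally have s: "s \<cdot> (r \<cdot> k) = s"
    using idem_of_split_subobject(4) [OF A X P(1,2)] st(2) by simp
  have "t \<cdot> (r \<cdot> k) = (q \<cdot> c) \<cdot> k"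
    using cmp_assoc [OF P(1) X P(1) AB(5) k r(1) P(3)] r by simp
  also have "\<dots> = q \<cdot> k"
    using cmp_assoc [OF P(1) X X AB(5) k c(1) AB(7)] ck by simp
  finally have t: "t \<cdot> (r \<cdot> k) = t"
    using idem_of_split_subobject(4) [OF B X P(1,3)] st(2) P(4) by simp
  have "s \<cdot> ide C P = s" "t \<cdot> ide C P = t"
    using cmp_ide [OF P(1) AB(1) P(2)] cmp_ide [OF P(1) AB(5) P(3)] .
  then have "r \<cdot> k = ide C P"
    using univ [OF P] rk ide_in_Hom [OF P(1)] s t by blast
  then show thesis
    using that P(1) k r(1) kr by blast
qed

end

end

section \<open>The poset of Frobenius \<open>\<B>\<close>-subalgebras\<close>

definition idem_class ::
  "('o, 'm::ab_group_add) tcat \<Rightarrow> ('o, 'm) frob \<Rightarrow> 'm \<Rightarrow> (('o, 'm) frob \<times> 'm) set" where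
  "idem_class C X b = {A. frobenius_subalgebra C X A \<and> sub_idem C X A = b}"

lemma sub_class_eq: "sub_class C X A = idem_class C X (sub_idem C X A)"
  by (simp add: sub_class_def idem_class_def)

context semisimple_tensor_category
begin

context
  fixes X R \<B> DS
  assumes X: "frobenius_algebra C X" and basis: "hom_basis C (ob X) R \<B>"
    and DS: "\<And>S. S \<in> R \<Longrightarrow> left_dual C S (DS S)"
begin

private lemma X_Obj: "ob X \<in> Obj C"
  using X by (simp add: frobenius_algebra_iff)

lemma frobenius_B_subalgebra_iff:
  "frobenius_B_subalgebra C R \<B> DS X (A, i) \<longleftrightarrow>
    frobenius_subalgebra C X (A, i) \<and> sub_idem C X (A, i) \<in> sa_frob_idems R \<B> X"
  using rigid_invariant_iff_selfadjoint [OF X basis DS] frob_idem_sub_idem [OF X]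
  by (auto simp: sa_frob_idems_def simp del: frobenius_subalgebra.simps)

lemma subalgebra_of_splitting:
  assumes "b \<in> sa_frob_idems R \<B> X" and P: "P \<in> Obj C" "k \<in> Hom C P (ob X)" "r \<in> Hom C (ob X) P"
    "r \<cdot> k = ide C P" "k \<cdot> r = b"
  obtains F where "ob F = P" "frobenius_B_subalgebra C R \<B> DS X (F, k)" "sub_idem C X (F, k) = b"
proof -
  have "frob_idem X (mor (Arr (ob X) b (ob X)))"
    using assms(1) by (simp add: sa_frob_idems_def)
  then obtain F where F: "ob F = P" "frobenius_subalgebra C X (F, k)" "adj C F X k = r"
    using frobenius_subalgebra_of_splitting [OF X _ _ _ P(1-4), of "Arr (ob X) b (ob X)"] P(5) by auto
  have "sub_idem C X (F, k) = b"
    using F(3) P(5) by simp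
  then show thesis
    using that [of F] F(1,2) assms(1) frobenius_B_subalgebra_iff [of F k] by blast
qed

lemma idem_class_nonempty:
  assumes "b \<in> sa_frob_idems R \<B> X"
  obtains A where "A \<in> idem_class C X b" "frobenius_B_subalgebra C R \<B> DS X A" "sub_idem C X A = b"
proof -
  have "b \<in> Hom C (ob X) (ob X)" "b \<cdot> b = b"
    using assms by (simp_all add: sa_frob_idems_def frob_idem_def)
  then obtain P k r where P: "P \<in> Obj C" "k \<in> Hom C P (ob X)" "r \<in> Hom C (ob X) P" "r \<cdot> k = ide C P" "k \<cdot> r = b"
    using idempotent_splits [OF X_Obj] by blast
  obtain F where "frobenius_B_subalgebra C R \<B> DS X (F, k)" "sub_idem C X (F, k) = b"
    using subalgebra_of_splitting [OF assms P] by blast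
  then show thesis
    using that [of "(F, k)"] unfolding idem_class_def frobenius_B_subalgebra_iff by blast
qed

private abbreviation (input) "L \<equiv> frobenius_B_poset C R \<B> DS X"
private abbreviation (input) "cls \<equiv> idem_class C X"

lemma carrier_B_poset: "carrier L = cls ` sa_frob_idems R \<B> X"
proof (intro equalityI subsetI)
  fix K assume "K \<in> carrier L"
  then obtain A i where "K = sub_class C X (A, i)" "frobenius_B_subalgebra C R \<B> DS X (A, i)"
    by (auto simp: frobenius_B_poset_def simp del: frobenius_B_subalgebra.simps)
  then show "K \<in> cls ` sa_frob_idems R \<B> X"
    unfolding frobenius_B_subalgebra_iff sub_class_eq by blast
next
  fix K assume "K \<in> cls ` sa_frob_idems R \<B> X"
  then obtain b where b: "b \<in> sa_frob_idems R \<B> X" "K = cls b"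
    by blast
  obtain A where "frobenius_B_subalgebra C R \<B> DS X A" "sub_idem C X A = b"
    using idem_class_nonempty [OF b(1)] by blast
  then have "\<exists>A. K = sub_class C X A \<and> frobenius_B_subalgebra C R \<B> DS X A"
    using b(2) sub_class_eq by metis
  then show "K \<in> carrier L"
    by (simp add: frobenius_B_poset_def del: frobenius_B_subalgebra.simps)
qed

lemma le_B_poset:
  assumes "b \<in> sa_frob_idems R \<B> X" "c \<in> sa_frob_idems R \<B> X"
  shows "cls b \<sqsubseteq>\<^bsub>L\<^esub> cls c \<longleftrightarrow> idem_le b c"
proof -
  have "cls b \<sqsubseteq>\<^bsub>L\<^esub> cls c \<longleftrightarrow> (\<exists>A\<in>cls b. \<exists>B\<in>cls c. idem_le (sub_idem C X A) (sub_idem C X B))"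
    by (simp add: frobenius_B_poset_def frobenius_poset_def idem_le_def)
  also have "\<dots> \<longleftrightarrow> (\<exists>A\<in>cls b. \<exists>B\<in>cls c. idem_le b c)"
    by (auto simp: idem_class_def simp del: frobenius_subalgebra.simps sub_idem.simps)
  also have "\<dots> \<longleftrightarrow> idem_le b c"
    using idem_class_nonempty assms by (metis ex_in_conv)
  finally show ?thesis .
qed

lemma eq_B_poset: "x .=\<^bsub>L\<^esub> y \<longleftrightarrow> x = y"
  by (simp add: frobenius_B_poset_def frobenius_poset_def)

lemma partial_order_B_poset: "partial_order L"
proof (unfold_locales, goal_cases)
  case (4 x)
  then show ?case
    using idem_le_refl by (auto simp: carrier_B_poset le_B_poset)
next
  case (5 x y)
  then obtain b c where "b \<in> sa_frob_idems R \<B> X" "c \<in> sa_frob_idems R \<B> X" "x = cls b" "y = cls c"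
    by (auto simp: carrier_B_poset)
  then show ?case
    using 5 idem_le_antisym [of b c] by (simp add: le_B_poset eq_B_poset)
next
  case (6 x y z)
  then obtain b c d where "b \<in> sa_frob_idems R \<B> X" "c \<in> sa_frob_idems R \<B> X" "d \<in> sa_frob_idems R \<B> X"
    "x = cls b" "y = cls c" "z = cls d"
    by (auto simp: carrier_B_poset)
  then show ?case
    using 6 idem_le_trans [of b c d X R \<B>] X_Obj by (simp add: le_B_poset)
qed (auto simp: eq_B_poset fun_eq_iff)

lemma greatest_B_poset:
  assumes b: "b\<^sub>1 \<in> sa_frob_idems R \<B> X" "b\<^sub>2 \<in> sa_frob_idems R \<B> X" and c: "c \<in> sa_frob_idems R \<B> X"
    and le: "idem_le c b\<^sub>1" "idem_le c b\<^sub>2"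
    and greatest: "\<And>d. d \<in> sa_frob_idems R \<B> X \<Longrightarrow> idem_le d b\<^sub>1 \<Longrightarrow> idem_le d b\<^sub>2 \<Longrightarrow> idem_le d c"
  shows "greatest L (cls c) (Lower L {cls b\<^sub>1, cls b\<^sub>2})"
  unfolding greatest_def Lower_def carrier_B_poset
  using b c le greatest by (auto simp: le_B_poset)

lemma least_B_poset:
  assumes b: "b\<^sub>1 \<in> sa_frob_idems R \<B> X" "b\<^sub>2 \<in> sa_frob_idems R \<B> X" and d: "d \<in> sa_frob_idems R \<B> X"
    and le: "idem_le b\<^sub>1 d" "idem_le b\<^sub>2 d"
    and least: "\<And>d'. d' \<in> sa_frob_idems R \<B> X \<Longrightarrow> idem_le b\<^sub>1 d' \<Longrightarrow> idem_le b\<^sub>2 d' \<Longrightarrow> idem_le d d'"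
  shows "least L (cls d) (Upper L {cls b\<^sub>1, cls b\<^sub>2})"
  unfolding least_def Upper_def carrier_B_poset
  using b d le least by (auto simp: le_B_poset)

lemma lattice_B_poset: "Lattice.lattice L"
proof -
  interpret partial_order L
    by (rule partial_order_B_poset)
  show ?thesis
  proof (unfold_locales, goal_cases)
    case (1 x y)
    then obtain b c where bc: "b \<in> sa_frob_idems R \<B> X" "c \<in> sa_frob_idems R \<B> X" "x = cls b" "y = cls c"
      by (auto simp: carrier_B_poset)
    obtain d where "d \<in> sa_frob_idems R \<B> X" "idem_le b d" "idem_le c d"
      "\<And>d'. d' \<in> sa_frob_idems R \<B> X \<Longrightarrow> idem_le b d' \<Longrightarrow> idem_le c d' \<Longrightarrow> idem_le d d'"
      by (rule idems_join [OF X basis bc(1,2)]) auto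
    then show ?case
      using least_B_poset [OF bc(1,2)] bc by blast
  next
    case (2 x y)
    then obtain b c where bc: "b \<in> sa_frob_idems R \<B> X" "c \<in> sa_frob_idems R \<B> X" "x = cls b" "y = cls c"
      by (auto simp: carrier_B_poset)
    obtain d where "d \<in> sa_frob_idems R \<B> X" "idem_le d b" "idem_le d c"
      "\<And>d'. d' \<in> sa_frob_idems R \<B> X \<Longrightarrow> idem_le d' b \<Longrightarrow> idem_le d' c \<Longrightarrow> idem_le d' d"
      by (rule idems_meet [OF X basis bc(1,2)]) auto
    then show ?case
      using greatest_B_poset [OF bc(1,2)] bc by blast
  qed
qed

lemma meet_B_poset:
  assumes "b\<^sub>1 \<in> sa_frob_idems R \<B> X" "b\<^sub>2 \<in> sa_frob_idems R \<B> X" "c \<in> sa_frob_idems R \<B> X" "idem_le c b\<^sub>1" "idem_le c b\<^sub>2"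
    "\<And>d. d \<in> sa_frob_idems R \<B> X \<Longrightarrow> idem_le d b\<^sub>1 \<Longrightarrow> idem_le d b\<^sub>2 \<Longrightarrow> idem_le d c"
  shows "cls b\<^sub>1 \<sqinter>\<^bsub>L\<^esub> cls b\<^sub>2 = cls c"
proof -
  interpret partial_order L
    by (rule partial_order_B_poset)
  show ?thesis
    unfolding meet_def inf_def
    using greatest_B_poset [OF assms] greatest_unique by (intro some_equality) blast+
qed

lemma split_subobject_subalgebra:
  assumes "frobenius_subalgebra C X (A, i)"
  shows "split_subobject C (ob X) (ob A) i (adj C A X i)"
proof -
  have A: "frobenius_algebra C A" and i: "i \<in> Hom C (ob A) (ob X)"
    using assms by (simp_all add: algebra_mono_def monic_def)
  have obA: "ob A \<in> Obj C"
    using A by (simp add: frobenius_algebra_iff)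
  have "adj C A X i \<in> Hom C (ob X) (ob A)"
    using arrow_transp [OF obA X_Obj left_dual_frob_dual [OF A] left_dual_frob_dual [OF X], of "Arr (ob A) i (ob X)"]
      i obA X_Obj by (simp add: arrow_def adj_def)
  then show ?thesis
    using assms i obA by (simp add: split_subobject_def)
qed

text \<open>
  A self-dual idempotent \<open>d\<close> is determined by its image: if \<open>c\<close> is self-dual with the
  same image, then \<open>d c = c\<close> and \<open>c d = d\<close>, and the first equation dualises to \<open>c d = c\<close>.
\<close>

lemma sub_idem_determined_by_image:
  assumes F: "frobenius_subalgebra C X (F, k)" and c: "frob_idem X c"
    and r: "r \<in> Hom C (ob X) (ob F)" "r \<cdot> k = ide C (ob F)" "k \<cdot> r = c"
  shows "sub_idem C X (F, k) = c"
proof -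
  define d where "d = sub_idem C X (F, k)"
  define s where "s = adj C F X k"
  have s: "ob F \<in> Obj C" "k \<in> Hom C (ob F) (ob X)" "s \<in> Hom C (ob X) (ob F)" "s \<cdot> k = ide C (ob F)"
    using split_subobject_subalgebra [OF F] by (simp_all add: split_subobject_def s_def)
  have d: "d = k \<cdot> s" "d \<in> Hom C (ob X) (ob X)" "adj C X X d = d"
    using frob_idem_sub_idem [OF X F] by (simp_all add: d_def s_def frob_idem_def)
  have cH: "c \<in> Hom C (ob X) (ob X)" "adj C X X c = c"
    using c by (simp_all add: frob_idem_def)
  have "d \<cdot> k = k" "c \<cdot> k = k"
    using s r d(1) X_Obj cmp_assoc [of "ob F" "ob X" "ob F" "ob X" k s k]
      cmp_assoc [of "ob F" "ob X" "ob F" "ob X" k r k] cmp_ide [of "ob F" "ob X" k] by simp_all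
  then have dc: "d \<cdot> c = c" and cd: "c \<cdot> d = d"
    using cmp_assoc [OF X_Obj s(1) X_Obj X_Obj r(1) s(2) d(2)] cmp_assoc [OF X_Obj s(1) X_Obj X_Obj s(3,2) cH(1)] r(3) d(1)
    by simp_all
  have "c \<cdot> d = c"
    using adj_cmp [OF X cH(1) d(2)] dc cH(2) d(3) by simp
  then show ?thesis
    using cd by (simp add: d_def)
qed

lemma intersection_B_subalgebras:
  assumes A: "frobenius_B_subalgebra C R \<B> DS X (A, i)" and B: "frobenius_B_subalgebra C R \<B> DS X (B, j)"
  shows "\<exists>P k. is_intersection C (ob A) i (ob B) j P k"
    and "is_intersection C (ob A) i (ob B) j P k \<Longrightarrow>
      \<exists>F. ob F = P \<and> frobenius_B_subalgebra C R \<B> DS X (F, k)"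
    and "is_intersection C (ob A) i (ob B) j (ob F) k \<Longrightarrow> frobenius_subalgebra C X (F, k) \<Longrightarrow>
      sub_class C X (A, i) \<sqinter>\<^bsub>L\<^esub> sub_class C X (B, j) = sub_class C X (F, k)"
proof -
  define b1 where "b1 = sub_idem C X (A, i)"
  define b2 where "b2 = sub_idem C X (B, j)"
  have b: "b1 \<in> sa_frob_idems R \<B> X" "b2 \<in> sa_frob_idems R \<B> X"
    and A': "frobenius_subalgebra C X (A, i)" and B': "frobenius_subalgebra C X (B, j)"
    using A B unfolding frobenius_B_subalgebra_iff b1_def b2_def by blast+
  obtain c where c: "c \<in> sa_frob_idems R \<B> X" and le: "idem_le c b1" "idem_le c b2"
    and greatest: "\<And>d. d \<in> sa_frob_idems R \<B> X \<Longrightarrow> idem_le d b1 \<Longrightarrow> idem_le d b2 \<Longrightarrow> idem_le d c"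
    and absorbs: "\<And>W h. W \<in> Obj C \<Longrightarrow> h \<in> Hom C W (ob X) \<Longrightarrow> b1 \<cdot> h = h \<Longrightarrow> b2 \<cdot> h = h \<Longrightarrow> c \<cdot> h = h"
    using idems_meet [OF X basis b] by metis
  have bc: "b1 \<cdot> c = c" "b2 \<cdot> c = c"
    using le by (simp_all add: idem_le_def)
  have b_eq: "b1 = i \<cdot> adj C A X i" "b2 = j \<cdot> adj C B X j"
    by (simp_all add: b1_def b2_def)
  note inter = X_Obj split_subobject_subalgebra [OF A'] split_subobject_subalgebra [OF B']
    idems_closed [OF c] bc [unfolded b_eq]
  have splitting: "is_intersection C (ob A) i (ob B) j P k"
    if "P \<in> Obj C" "k \<in> Hom C P (ob X)" "r \<in> Hom C (ob X) P" "r \<cdot> k = ide C P" "k \<cdot> r = c" for P k r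
    using absorbs unfolding b_eq by (rule splitting_is_intersection [OF inter _ that])
  have intersection: "\<exists>r. P \<in> Obj C \<and> k \<in> Hom C P (ob X) \<and> r \<in> Hom C (ob X) P \<and> r \<cdot> k = ide C P \<and> k \<cdot> r = c"
    if "is_intersection C (ob A) i (ob B) j P k" for P k
    by (rule intersection_is_splitting [OF inter _ that]) (use absorbs in \<open>unfold b_eq, blast+\<close>)
  have cc: "c \<cdot> c = c" "frob_idem X c"
    using c by (simp_all add: sa_frob_idems_def frob_idem_def)
  show "\<exists>P k. is_intersection C (ob A) i (ob B) j P k"
    by (rule idempotent_splits [OF X_Obj idems_closed [OF c] cc(1)]) (use splitting in blast)
  show "\<exists>F. ob F = P \<and> frobenius_B_subalgebra C R \<B> DS X (F, k)"
    if int: "is_intersection C (ob A) i (ob B) j P k"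
  proof -
    obtain r where "P \<in> Obj C" "k \<in> Hom C P (ob X)" "r \<in> Hom C (ob X) P" "r \<cdot> k = ide C P" "k \<cdot> r = c"
      using intersection [OF int] by blast
    then obtain F where "ob F = P" "frobenius_B_subalgebra C R \<B> DS X (F, k)"
      by (rule subalgebra_of_splitting [OF c])
    then show ?thesis
      by blast
  qed
  show "sub_class C X (A, i) \<sqinter>\<^bsub>L\<^esub> sub_class C X (B, j) = sub_class C X (F, k)"
    if int: "is_intersection C (ob A) i (ob B) j (ob F) k" and F: "frobenius_subalgebra C X (F, k)"
  proof -
    obtain r where "r \<in> Hom C (ob X) (ob F)" "r \<cdot> k = ide C (ob F)" "k \<cdot> r = c"
      using intersection [OF int] by blast
    then have "sub_idem C X (F, k) = c"
      by (rule sub_idem_determined_by_image [OF F cc(2)])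
    then show ?thesis
      using meet_B_poset [OF b c le greatest] unfolding sub_class_eq b1_def b2_def by blast
  qed
qed

end

end

theorem corollary5p16:
  fixes C :: "('o, 'm::ab_group_add) tcat" and X :: "('o, 'm) frob"
    and R :: "'o set" and \<B> :: "'o \<Rightarrow> 'm set" and DS :: "'o \<Rightarrow> ('o, 'm) dual_data"
  assumes "semisimple_tensor_category C"
    and "frobenius_algebra C X"
    and "hom_basis C (ob X) R \<B>"
    and "\<And>S. S \<in> R \<Longrightarrow> left_dual C S (DS S)"
  shows "Lattice.lattice (frobenius_B_poset C R \<B> DS X) \<and>
    (\<forall>A i B j. frobenius_B_subalgebra C R \<B> DS X (A, i) \<and> frobenius_B_subalgebra C R \<B> DS X (B, j) \<longrightarrow>
      (\<exists>P k. is_intersection C (ob A) i (ob B) j P k) \<and>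
      (\<forall>P k. is_intersection C (ob A) i (ob B) j P k \<longrightarrow>
        (\<exists>F. ob F = P \<and> frobenius_B_subalgebra C R \<B> DS X (F, k)) \<and>
        (\<forall>F. ob F = P \<and> frobenius_subalgebra C X (F, k) \<longrightarrow>
          sub_class C X (A, i) \<sqinter>\<^bsub>frobenius_B_poset C R \<B> DS X\<^esub> sub_class C X (B, j)
            = sub_class C X (F, k))))"
proof -
  interpret semisimple_tensor_category C
    by (rule assms(1))
  note intersection = intersection_B_subalgebras [OF assms(2-4)]
  show ?thesis
  proof (intro conjI allI impI; (elim conjE)?)
    show "Lattice.lattice (frobenius_B_poset C R \<B> DS X)"
      by (rule lattice_B_poset [OF assms(2-4)])
  next
    fix A i B j
    assume AB: "frobenius_B_subalgebra C R \<B> DS X (A, i)" "frobenius_B_subalgebra C R \<B> DS X (B, j)"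
    show "\<exists>P k. is_intersection C (ob A) i (ob B) j P k"
      by (rule intersection(1) [OF _ AB])
    fix P k assume int: "is_intersection C (ob A) i (ob B) j P k"
    show "\<exists>F. ob F = P \<and> frobenius_B_subalgebra C R \<B> DS X (F, k)"
      by (rule intersection(2) [OF _ AB int])
    fix F assume "ob F = P" "frobenius_subalgebra C X (F, k)"
    then show "sub_class C X (A, i) \<sqinter>\<^bsub>frobenius_B_poset C R \<B> DS X\<^esub> sub_class C X (B, j)
        = sub_class C X (F, k)"
      using intersection(3) [OF _ AB] int by blast
  qed
qed

end
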